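(* Let $\alpha>1$ satisfy $\zeta(\alpha)>4$, where $\zeta(\alpha)=\sum_{k=1}^\infty k^{-\alpha}$, and put $\beta=\alpha^{-1}$. Let $\mathbb{X}=\mathbb{N}\times\{0,1\}$, $\mathbb{Y}=\{0,1,2\}$. Let $(K_i)_{i\in\mathbb{Z}}$ and $(Z_k)_{k\in\mathbb{N}}$ be probabilistically independent random variables (all of them jointly independent) on a probability space $(\Omega,\mathcal{J},P)$ with $P(K_i=k)=k^{-\alpha}/\zeta(\alpha)$ for $k\in\mathbb{N}$ and $P(Z_k=z)=1/2$ for $z\in\{0,1\}$. Let $X_i=(K_i,Z_{K_i})$ and let $\mu=P((X_i)_{i\in\mathbb{Z}}\in\cdot)$ be the distribution of $(X_i)_{i\in\mathbb{Z}}$ on $\mathbb{X}^{\mathbb{Z}}$. Let $f:\mathbb{X}\to\mathbb{Y}^+$ be $f(k,z)=b(k)\,z\,2$ (concatenation), where $1b(k)\in\{0,1\}^+$ is the binary representation of $k\in\mathbb{N}$. Then $\mu\circ(f^{\mathbb{Z}})^{-1}$ is asymptotically mean stationary, and a process $(\bar Y_i)_{i\in\mathbb{Z}}$ (on a probability space with measure $\bar P$) distributed according to its stationary mean, $\bar P((\bar Y_i)_{i\in\mathbb{Z}}\in\cdot)=\overline{\mu\circ(f^{\mathbb{Z}})^{-1}}$, satisfies the following conditions: (a) $(\bar Y_i)_{i\in\mathbb{Z}}$ is a process over a finite alphabet; (b) $(\bar Y_i)_{i\in\mathbb{Z}}$ is stationary; (c) $(\bar Y_i)_{i\in\mathbb{Z}}$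 (i.e. its distribution) has finite energy; (d) there exist independent equidistributed binary random variables $(\bar Z_k)_{k\in\mathbb{N}}$, $\bar P(\bar Z_k=z)=1/2$ for $z\in\{0,1\}$, measurable with respect to the shift-invariant $\sigma$-field of $(\bar Y_i)_{i\in\mathbb{Z}}$, and functions $\bar s_k$ such that $$\lim_{n\to\infty}\bar P\left(\bar s_k(\bar Y_{i+1}^{i+n})=\bar Z_k\right)=1\quad\text{for all } i\in\mathbb{Z},\ k\in\mathbb{N},$$ and for all $\bar\delta\in(1/2,1)$ the sets $\bar U_{\bar\delta}(n):=\{k\in\mathbb{N}:\bar P(\bar s_k(\bar Y^n)=\bar Z_k)\ge\bar\delta\}$ satisfy $$\liminf_{n\to\infty}n^{-\beta}\,|\bar U_{\bar\delta}(n)|>0 .$$ Moreover, in (d) one may take $\bar Z_k=\bar s_k((\bar Y_i)_{i\in\mathbb{Z}})$, where for $w\in\mathbb{Y}^{\mathbb{Z}}\cup\mathbb{Y}^*$ $$\bar s_k(w)=\begin{cases}0 & \text{if } 2b(k)02\sqsubseteq w \text{ and } 2b(k)12\not\sqsubseteq w,\\ 1 & \text{if } 2b(k)12\sqsubseteq w\text{ and } 2b(k)02\not\sqsubseteq w,\\ 2&\text{else.}\end{cases}$$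
   Context: $\mathbb{N}=\{1,2,\dots\}$. For a countable alphabet $\mathbb{A}$: $\mathbb{A}^+=\bigcup_{n\in\mathbb{N}}\mathbb{A}^n$ is the set of nonempty strings, $\mathbb{A}^*=\mathbb{A}^+\cup\{\lambda\}$ with $\lambda$ the empty string (so $b(1)=\lambda$); $|u|$ is the length of a string $u$; $x_k^l=(x_i)_{k\le i\le l}$, $x^n=x_1^n$; $\mathbb{A}^{\mathbb{Z}}$ is the space of two-sided sequences with its product $\sigma$-algebra. $u\sqsubseteq v$ means that the string or two-sided sequence $v$ contains the string $u$ as a (contiguous) substring. For $f:\mathbb{X}\to\mathbb{Y}^*$, $f^{\mathbb{Z}}(x^{\mathbb{Z}})=\dots f(x_{-1})f(x_0)\mathbf{.}f(x_1)f(x_2)\dots$ is the two-sided concatenation, where the bold dot separates coordinates $\le 0$ from coordinates $\ge 1$ (so $f(x_1)$ starts at coordinate $1$). $\mu\circ(f^{\mathbb{Z}})^{-1}$ is the image measure on $\mathbb{Y}^{\mathbb{Z}}$. The shift is $T((x_i)_{i\in\mathbb{Z}})=(x_{i+1})_{i\in\mathbb{Z}}$. A probability measure $\mu$ on $\mathbb{A}^{\mathbb{Z}}$ is asymptotically mean stationary (AMS) if $\bar\mu(A)=\lim_{n\to\infty}\frac1n\sum_{i=0}^{n-1}\mu(T^{-i}A)$ exists for every measurable $A$; $\bar\mu$ is then a stationary probability measure, called the stationary mean of $\mu$. The cylinder of $u\in\mathbb{A}^*$ is $[u]=\{x^{\mathbb{Z}}:x^{|u|}=u\}$. A measure $\nu$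 on $\mathbb{A}^{\mathbb{Z}}$ has finite energy if there are $c<1$, $K<\infty$ with $\nu([uv])\le Kc^{|v|}\nu([u])$ for all $u,v\in\mathbb{A}^*$. The shift-invariant $\sigma$-field of a process $(\bar Y_i)$ is the preimage under the process of $\{A: T^{-1}A=A\}$, $A$ measurable in $\mathbb{Y}^{\mathbb{Z}}$; random variables are identified up to almost sure equality. *)

theory Defs
  imports "HOL-Probability.Probability" "HOL-Library.Sublist"
begin

text \<open>Alphabets are sets \<open>A\<close> (always countable and discrete here), strings are lists, and
  two-sided sequences are functions on \<^typ>\<open>int\<close>.\<close>

definition seq_space :: "'a set \<Rightarrow> (int \<Rightarrow> 'a) measure" where
  "seq_space A = PiM UNIV (\<lambda>_. count_space A)"

definition shift :: "(int \<Rightarrow> 'a) \<Rightarrow> int \<Rightarrow> 'a" where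
  "shift x = (\<lambda>i. x (i + 1))"

definition block :: "(int \<Rightarrow> 'a) \<Rightarrow> int \<Rightarrow> int \<Rightarrow> 'a list" where
  "block x k l = map x [k..l]"

definition occurs_in :: "'a list \<Rightarrow> (int \<Rightarrow> 'a) \<Rightarrow> bool" where
  "occurs_in u x \<longleftrightarrow> (\<exists>i. block x (i + 1) (i + int (length u)) = u)"

definition cylinder :: "'a set \<Rightarrow> 'a list \<Rightarrow> (int \<Rightarrow> 'a) set" where
  "cylinder A u = {x \<in> space (seq_space A). block x 1 (int (length u)) = u}"

text \<open>\<open>block_start f x i\<close> is the coordinate at which \<open>f (x i)\<close> begins, normalised so that
  \<open>f (x 1)\<close> begins at coordinate 1; at most one of the two sums is nonempty.\<close>

definition block_start :: "('a \<Rightarrow> 'b list) \<Rightarrow> (int \<Rightarrow> 'a) \<Rightarrow> int \<Rightarrow> int" where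
  "block_start f x i =
     1 + (\<Sum>j\<in>{1..<i}. int (length (f (x j)))) - (\<Sum>j\<in>{i..0}. int (length (f (x j))))"

text \<open>Meaningful whenever the concatenation is infinite in both directions, in particular if
  \<open>f\<close> never returns the empty string.\<close>

definition concat_two_sided :: "('a \<Rightarrow> 'b list) \<Rightarrow> (int \<Rightarrow> 'a) \<Rightarrow> int \<Rightarrow> 'b" where
  "concat_two_sided f x = (\<lambda>n.
     let i = (THE i. block_start f x i \<le> n \<and> n < block_start f x (i + 1))
     in f (x i) ! nat (n - block_start f x i))"

lemma block_start_1: "block_start f x 1 = 1"
  by (simp add: block_start_def)

lemma block_start_step: "block_start f x (i + 1) = block_start f x i + int (length (f (x i)))"
proof (cases "i \<ge> 1")
  case True
  then have "{1..<i + 1} = insert i {1..<i}" by auto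
  with True show ?thesis by (simp add: block_start_def)
next
  case False
  then have "{i..0} = insert i {i + 1..0}" by auto
  with False show ?thesis by (simp add: block_start_def)
qed

definition shift_average :: "(int \<Rightarrow> 'a) measure \<Rightarrow> (int \<Rightarrow> 'a) set \<Rightarrow> nat \<Rightarrow> real" where
  "shift_average M B n = (\<Sum>i<n. measure M ((shift ^^ i) -` B \<inter> space M)) / real n"

definition asymp_mean_stationary :: "'a set \<Rightarrow> (int \<Rightarrow> 'a) measure \<Rightarrow> bool" where
  "asymp_mean_stationary A M \<longleftrightarrow>
     prob_space M \<and> sets M = sets (seq_space A) \<and> (\<forall>B\<in>sets M. convergent (shift_average M B))"

text \<open>\<^const>\<open>measure_of\<close> returns the null measure if the set function is not countably additive.\<close>

definition stationary_mean :: "(int \<Rightarrow> 'a) measure \<Rightarrow> (int \<Rightarrow> 'a) measure" where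
  "stationary_mean M = measure_of (space M) (sets M) (\<lambda>B. ennreal (lim (shift_average M B)))"

definition stationary :: "(int \<Rightarrow> 'a) measure \<Rightarrow> bool" where
  "stationary M \<longleftrightarrow> distr M M shift = M"

definition finite_energy :: "'a set \<Rightarrow> (int \<Rightarrow> 'a) measure \<Rightarrow> bool" where
  "finite_energy A M \<longleftrightarrow> (\<exists>c<1. \<exists>K::real. \<forall>u\<in>lists A. \<forall>v\<in>lists A.
     measure M (cylinder A (u @ v)) \<le> K * c ^ length v * measure M (cylinder A u))"

definition process :: "'w measure \<Rightarrow> 'a set \<Rightarrow> (int \<Rightarrow> 'w \<Rightarrow> 'a) \<Rightarrow> bool" where
  "process P A Y \<longleftrightarrow> prob_space P \<and> (\<forall>i. Y i \<in> measurable P (count_space A))"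

definition process_law :: "'w measure \<Rightarrow> 'a set \<Rightarrow> (int \<Rightarrow> 'w \<Rightarrow> 'a) \<Rightarrow> (int \<Rightarrow> 'a) measure" where
  "process_law P A Y = distr P (seq_space A) (\<lambda>\<omega> i. Y i \<omega>)"

definition shift_invariant_sets :: "'a set \<Rightarrow> (int \<Rightarrow> 'a) set set" where
  "shift_invariant_sets A =
     {B \<in> sets (seq_space A). shift -` B \<inter> space (seq_space A) = B}"

definition shift_invariant_field ::
    "'w measure \<Rightarrow> 'a set \<Rightarrow> (int \<Rightarrow> 'w \<Rightarrow> 'a) \<Rightarrow> 'w measure" where
  "shift_invariant_field P A Y = vimage_algebra (space P) (\<lambda>\<omega> i. Y i \<omega>)
     (sigma (space (seq_space A)) (shift_invariant_sets A))"

fun bin_digits :: "nat \<Rightarrow> nat list" where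
  "bin_digits n = (if n = 0 then [] else bin_digits (n div 2) @ [n mod 2])"

declare bin_digits.simps [simp del]

definition bin_tail :: "nat \<Rightarrow> nat list" where
  "bin_tail k = tl (bin_digits k)"

lemma bin_digits_eq_Cons: "k \<ge> 1 \<Longrightarrow> bin_digits k = 1 # bin_tail k"
proof -
  have "bin_digits k \<noteq> [] \<and> hd (bin_digits k) = 1" if "k \<ge> 1" for k
    using that
  proof (induction k rule: less_induct)
    case (less k)
    show ?case
    proof (cases "k = 1")
      case True
      then show ?thesis by (simp add: bin_digits.simps)
    next
      case False
      with less.prems have "k div 2 < k" "k div 2 \<ge> 1" by auto
      with less.IH show ?thesis using less.prems by (subst (1 2) bin_digits.simps) auto
    qed
  qed
  then show "k \<ge> 1 \<Longrightarrow> bin_digits k = 1 # bin_tail k"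
    unfolding bin_tail_def by (metis list.exhaust_sel)
qed

definition code :: "nat \<times> nat \<Rightarrow> nat list" where
  "code = (\<lambda>(k, z). bin_tail k @ [z, 2])"

text \<open>The predictor is applied both to strings and to two-sided sequences, so it is defined
  relative to the predicate \<open>occ\<close> of occurring as a contiguous substring.\<close>

definition predictor :: "nat \<Rightarrow> (nat list \<Rightarrow> bool) \<Rightarrow> nat" where
  "predictor k occ =
     (let u0 = [2] @ bin_tail k @ [0, 2]; u1 = [2] @ bin_tail k @ [1, 2]
      in if occ u0 \<and> \<not> occ u1 then 0
         else if occ u1 \<and> \<not> occ u0 then 1
         else 2)"

definition predictor_str :: "nat \<Rightarrow> nat list \<Rightarrow> nat" where
  "predictor_str k w = predictor k (\<lambda>u. sublist u w)"

definition predictor_seq :: "nat \<Rightarrow> (int \<Rightarrow> nat) \<Rightarrow> nat" where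
  "predictor_seq k x = predictor k (\<lambda>u. occurs_in u x)"

definition predictable_set ::
    "'w measure \<Rightarrow> (int \<Rightarrow> 'w \<Rightarrow> nat) \<Rightarrow> (nat \<Rightarrow> 'w \<Rightarrow> nat) \<Rightarrow> (nat \<Rightarrow> nat list \<Rightarrow> nat)
      \<Rightarrow> real \<Rightarrow> nat \<Rightarrow> nat set" where
  "predictable_set P Y Z s \<delta> n =
     {k. k \<ge> 1 \<and> \<P>(\<omega> in P. s k (block (\<lambda>j. Y j \<omega>) 1 (int n)) = Z k \<omega>) \<ge> \<delta>}"

text \<open>Random variables are identified up to almost sure equality: \<open>Z k\<close> need only agree almost
  surely with a \<open>{0,1}\<close>-valued variable measurable with respect to the shift-invariant field.
  Cardinalities are taken in \<^typ>\<open>ennreal\<close> because \<open>predictable_set\<close> may be infinite for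
  general \<open>s\<close>.\<close>

definition encodes_bits ::
    "real \<Rightarrow> 'w measure \<Rightarrow> nat set \<Rightarrow> (int \<Rightarrow> 'w \<Rightarrow> nat) \<Rightarrow> (nat \<Rightarrow> 'w \<Rightarrow> nat)
      \<Rightarrow> (nat \<Rightarrow> nat list \<Rightarrow> nat) \<Rightarrow> bool" where
  "encodes_bits \<beta> P A Y Z s \<longleftrightarrow>
     prob_space.indep_vars P (\<lambda>_. count_space UNIV) Z {1..} \<and>
     (\<forall>k\<ge>1. \<forall>z\<in>{0, 1}. \<P>(\<omega> in P. Z k \<omega> = z) = 1 / 2) \<and>
     (\<forall>k\<ge>1. \<exists>Z' \<in> measurable (shift_invariant_field P A Y) (count_space {0, 1}).
        AE \<omega> in P. Z k \<omega> = Z' \<omega>) \<and>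
     (\<forall>i. \<forall>k\<ge>1.
        (\<lambda>n. \<P>(\<omega> in P. s k (block (\<lambda>j. Y j \<omega>) (i + 1) (i + int n)) = Z k \<omega>))
          \<longlonglongrightarrow> 1) \<and>
     (\<forall>\<delta>\<in>{1/2<..<1}.
        liminf (\<lambda>n. ennreal (real n powr (- \<beta>)) *
          emeasure (count_space UNIV) (predictable_set P Y Z s \<delta> n)) > 0)"

definition zeta_sum :: "real \<Rightarrow> real" where
  "zeta_sum \<alpha> = (\<Sum>k. real (Suc k) powr (- \<alpha>))"

end

theory Submission
  imports Defs
begin

text \<open>
  Write \<open>y\<close> for the concatenation of the blocks \<open>code (X i)\<close>, \<open>T\<close> for the shift, \<open>\<nu>\<close> for the law
  of \<open>y\<close>, and \<open>L\<close> for the mean length of a block.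

  \<^bold>\<open>Stationary mean.\<close> The length of a block depends only on its index \<open>K i\<close> and is logarithmic in it,
  so the lengths are independent with finite variance, and the first \<open>m\<close> blocks cover \<open>m * L\<close>
  letters up to an error of mean \<open>o(m)\<close> (\<open>weak_law_L1\<close>). For an event \<open>C\<close>, compare the number of
  \<open>i < n\<close> with \<open>(T ^ i) y \<in> C\<close> to the number of such \<open>i\<close> inside the first \<open>n / L\<close> blocks. The two counts
  run over initial segments of the letters, so they differ by at most the difference of the lengths of these
  segments, whatever \<open>C\<close> is. Since the source is stationary, the second count has mean
  \<open>n / L\<close> times the mean number of visits to \<open>C\<close> that start inside block 1. Hence the shift averages
  converge to \<open>\<rho> C\<close>, this mean number of visits divided by \<open>L\<close> (\<open>mean_law_stationary_limit\<close>).
  The limit is given by an explicit measure \<open>\<rho>\<close>, it is stationary, and on shift-invariant events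
  it agrees with \<open>\<nu>\<close> (\<open>measure_invariant\<close>).

  \<^bold>\<open>Finite energy.\<close> A bound \<open>\<nu> [w s] \<le> c * \<nu> [w]\<close> for every string \<open>w\<close> and letter \<open>s\<close> passes to \<open>\<rho>\<close>,
  because the preimage of a cylinder \<open>[u]\<close> under \<open>T ^ i\<close> is the disjoint union of the cylinders \<open>[q u]\<close>
  (\<open>finite_energyI\<close>). Cutting \<open>w\<close> after its last letter 2 leaves complete blocks and a prefix \<open>p\<close> of the
  next block. The index of that block is independent of everything else (\<open>emeasure_resample\<close>),
  so it suffices to bound, for each fixed choice of the bits, the mass of the indices whose
  code word extends \<open>p s\<close> by \<open>c\<close> times the mass of those whose code word extends \<open>p\<close>. Changing or
  adding one binary digit maps the former indices injectively to indices which extend \<open>p\<close> but not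
  \<open>p s\<close>, and at most triples them; under a power law this costs a constant factor
  (\<open>compatible_snoc_le\<close>).

  \<^bold>\<open>The bits.\<close> A letter 2 in \<open>y\<close> always ends a block, so \<open>2 b(k) z 2\<close> occurs in \<open>y\<close> only where some
  \<open>X i = (k, z)\<close> (\<open>occurs_code_iff\<close>). Almost surely every \<open>k\<close> occurs among the indices, and then the
  predictor applied to the whole of \<open>y\<close> returns \<open>Z k\<close>. This function is shift-invariant, so its
  joint law is the same under \<open>\<rho>\<close> as under \<open>\<nu>\<close> (\<open>measure_\<rho>_predictor\<close>). By the formula for \<open>\<rho>\<close>, a window
  of \<open>n\<close> letters contains the blocks \<open>2, \<dots>, m\<close> with \<open>m\<close> about \<open>n / (2 * L)\<close>, unless these are
  exceptionally long; it misses \<open>k\<close> with probability about \<open>(1 - p) ^ (m - 1)\<close>, where \<open>p\<close> is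
  proportional to \<open>k powr (- \<alpha>)\<close> (\<open>measure_misses_le\<close>). This is small as long as \<open>k\<close> is at most a small
  multiple of \<open>n powr (1 / \<alpha>)\<close>, which gives the rate (\<open>eventually_misses_le\<close>).
\<close>

section \<open>Concatenation of blocks\<close>

lemma block_start_shift:
  "block_start f (shift x) i = block_start f x (i + 1) - int (length (f (x 1)))"
proof (induction i rule: int_induct[where k = 1])
  case base
  show ?case using block_start_step[of f x 1] by (simp add: block_start_1)
next
  case (step1 i)
  then show ?case
    using block_start_step[of f x "i + 1"] block_start_step[of f "shift x" i]
    by (simp add: shift_def)
next
  case (step2 i)
  then show ?case
    using block_start_step[of f x i] block_start_step[of f "shift x" "i - 1"]
    by (simp add: shift_def)
qed

lemma shift_pow: "(shift ^^ n) x i = x (i + int n)"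
  by (induction n arbitrary: i) (simp_all add: shift_def algebra_simps)

lemma length_block [simp]: "length (block x k l) = nat (l - k + 1)"
  by (simp add: block_def)

lemma nth_block: "i < nat (l - k + 1) \<Longrightarrow> block x k l ! i = x (k + int i)"
  by (simp add: block_def)

lemma block_append: "k \<le> l \<Longrightarrow> l \<le> m + 1 \<Longrightarrow> block x k m = block x k (l - 1) @ block x l m"
  unfolding block_def map_append[symmetric]
  by (cases "l = m + 1") (simp_all add: upto_split1)

lemma block_shift_pow: "block ((shift ^^ n) x) k l = block x (k + int n) (l + int n)"
  by (rule nth_equalityI) (auto simp: nth_block shift_pow algebra_simps)

context
  fixes f :: "'a \<Rightarrow> 'b list" and x :: "int \<Rightarrow> 'a"
  assumes ne: "\<And>i. f (x i) \<noteq> []"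
begin

lemma block_start_less:
  assumes "i < j"
  shows "block_start f x i < block_start f x j"
  using \<open>i < j\<close>
proof (induction j rule: int_gr_induct)
  case base
  show ?case using ne[of i] by (simp add: block_start_step)
next
  case (step j)
  then show ?case using ne[of j] by (simp add: block_start_step)
qed

lemma block_start_mono:
  assumes "i \<le> j"
  shows "block_start f x i \<le> block_start f x j"
  using block_start_less[of i j] assms by (cases "i = j") auto

lemma block_start_diff_ge:
  assumes "i \<le> j"
  shows "j - i \<le> block_start f x j - block_start f x i"
  using \<open>i \<le> j\<close>
proof (induction j rule: int_ge_induct)
  case base
  show ?case by simp
next
  case (step j)
  moreover have "length (f (x j)) \<ge> 1" using ne[of j] by (simp add: Suc_leI)
  ultimately show ?case by (simp add: block_start_step)
qed

text \<open>Block starts grow by at least 1 from one block to the next, so the indices of the blocks that start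
  at or before \<open>n\<close> have a maximum.\<close>

lemma ex_block_containing:
  obtains i where "block_start f x i \<le> n" "n < block_start f x (i + 1)"
proof -
  let ?S = "{i. block_start f x i \<le> n}"
  have lo: "min n 1 \<in> ?S"
    using block_start_diff_ge[where i = "min n 1" and j = 1] by (simp add: block_start_1)
  have up: "i \<le> max n 1" if "i \<in> ?S" for i
    using that block_start_diff_ge[of 1 i] by (cases "1 \<le> i") (auto simp: block_start_1)
  define i where "i = Max (?S \<inter> {min n 1..})"
  have fin: "finite (?S \<inter> {min n 1..})"
    by (rule finite_subset[of _ "{min n 1..max n 1}"]) (use up in auto)
  have "i \<in> ?S \<inter> {min n 1..}"
    unfolding i_def using lo by (intro Max_in fin) auto
  moreover have "i + 1 \<notin> ?S"
  proof
    assume "i + 1 \<in> ?S"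
    with \<open>i \<in> ?S \<inter> {min n 1..}\<close> have "i + 1 \<in> ?S \<inter> {min n 1..}" by auto
    then have "i + 1 \<le> i" unfolding i_def by (intro Max_ge fin)
    then show False by simp
  qed
  ultimately show ?thesis using that[of i] by auto
qed

lemma block_containing_unique:
  assumes i: "block_start f x i \<le> n" "n < block_start f x (i + 1)"
    and j: "block_start f x j \<le> n" "n < block_start f x (j + 1)"
  shows "i = j"
proof (rule ccontr)
  assume "i \<noteq> j"
  then consider "i + 1 \<le> j" | "j + 1 \<le> i" by linarith
  then show False
    by cases (use block_start_mono[where i="i+1" and j=j]
        block_start_mono[where i="j+1" and j=i] i j in auto)
qed

lemma concat_two_sided_nth:
  assumes i: "block_start f x i \<le> n" "n < block_start f x (i + 1)"
  shows "concat_two_sided f x n = f (x i) ! nat (n - block_start f x i)"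
proof -
  have "(THE i. block_start f x i \<le> n \<and> n < block_start f x (i + 1)) = i"
    using i block_containing_unique by (intro the_equality) auto
  then show ?thesis by (simp add: concat_two_sided_def)
qed

lemma block_concat_block_start:
  shows "block (concat_two_sided f x) (block_start f x i) (block_start f x (i + 1) - 1) = f (x i)"
proof (rule nth_equalityI)
  show "length (block (concat_two_sided f x) (block_start f x i) (block_start f x (i + 1) - 1)) =
    length (f (x i))"
    by (simp add: block_start_step)
next
  fix j assume "j < length (block (concat_two_sided f x) (block_start f x i) (block_start f x (i + 1) - 1))"
  then have "j < length (f (x i))" by (simp add: block_start_step)
  then show "block (concat_two_sided f x) (block_start f x i) (block_start f x (i + 1) - 1) ! j = f (x i) ! j"
    by (simp add: nth_block block_start_step)
       (subst concat_two_sided_nth[where i = i], auto simp: block_start_step)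
qed

lemma block_concat_blocks:
  shows "block (concat_two_sided f x) 1 (block_start f x (int m + 1) - 1) =
    concat (map (\<lambda>i. f (x (int i))) [1..<Suc m])"
proof (induction m)
  case 0
  then show ?case by (simp add: block_start_1 block_def)
next
  case (Suc m)
  have "block (concat_two_sided f x) 1 (block_start f x (int (Suc m) + 1) - 1)
     = block (concat_two_sided f x) 1 (block_start f x (int m + 1) - 1) @
       block (concat_two_sided f x) (block_start f x (int m + 1)) (block_start f x (int m + 1 + 1) - 1)"
    using block_start_mono[where i=1 and j="int m + 1"]
          block_start_mono[where i="int m + 1" and j="int m + 1 + 1"]
    by (subst block_append[where l="block_start f x (int m + 1)"]) (auto simp: block_start_1 add_ac)
  also have "\<dots> = concat (map (\<lambda>i. f (x (int i))) [1..<Suc (Suc m)])"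
    using block_concat_block_start[of "int m + 1"] Suc.IH by (simp add: add_ac)
  finally show ?case .
qed

end

text \<open>Shifting the source by one symbol moves the start of the old second block to coordinate 1. This
  turns sums over source positions into sums over letters.\<close>

lemma concat_two_sided_shift:
  assumes ne: "\<And>i. f (x i) \<noteq> []"
  shows "concat_two_sided f (shift x) = (shift ^^ length (f (x 1))) (concat_two_sided f x)"
proof
  fix n
  have ne': "f (shift x i) \<noteq> []" for i using ne by (simp add: shift_def)
  obtain i where i: "block_start f (shift x) i \<le> n" "n < block_start f (shift x) (i + 1)"
    using ex_block_containing[of f "shift x" n, OF ne'] by auto
  have "concat_two_sided f (shift x) n = f (shift x i) ! nat (n - block_start f (shift x) i)"
    by (rule concat_two_sided_nth[of f "shift x", OF ne']) (use i in auto)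
  also have e: "shift x i = x (i + 1)" by (simp add: shift_def)
  also have "f (x (i + 1)) ! nat (n - block_start f (shift x) i) = concat_two_sided f x (n + int (length (f (x 1))))"
    by (subst concat_two_sided_nth[of f x "i + 1", OF ne])
       (use i in \<open>simp_all add: block_start_shift algebra_simps e\<close>)
  finally show "concat_two_sided f (shift x) n = (shift ^^ length (f (x 1))) (concat_two_sided f x) n"
    by (simp add: shift_pow)
qed

lemma measurable_seq_component [measurable]:
  "(\<lambda>x. x i) \<in> measurable (seq_space A) (count_space A)"
  unfolding seq_space_def by simp

lemma space_seq_space: "space (seq_space A) = {x. \<forall>i. x i \<in> A}"
  by (auto simp: seq_space_def space_PiM)

lemma measurable_seq_component_UNIV:
  "(\<lambda>x. x i) \<in> measurable (seq_space A) (count_space UNIV)"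
  using measurable_seq_component[of i A] by (rule measurable_compose) simp

lemma measurable_seq_spaceI:
  assumes "\<And>i. (\<lambda>\<omega>. Y \<omega> i) \<in> measurable M (count_space A)"
  shows "Y \<in> measurable M (seq_space A)"
proof -
  have "(\<lambda>\<omega>. \<lambda>i\<in>UNIV. Y \<omega> i) \<in> measurable M (seq_space A)"
    unfolding seq_space_def by (intro measurable_restrict) (use assms in auto)
  then show ?thesis by (simp add: restrict_UNIV)
qed

lemma measurable_shift [measurable]: "shift \<in> measurable (seq_space A) (seq_space A)"
  by (rule measurable_seq_spaceI) (simp add: shift_def)

lemma measurable_shift_pow [measurable]: "(shift ^^ n) \<in> measurable (seq_space A) (seq_space A)"
  by (rule measurable_seq_spaceI) (simp add: shift_pow)

lemma measurable_count_space_op: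
  fixes g :: "'w \<Rightarrow> 'b::countable"
  assumes g: "g \<in> measurable M (count_space UNIV)" and h: "h \<in> measurable M (count_space UNIV)"
  shows "(\<lambda>x. F (g x) (h x)) \<in> measurable M (count_space UNIV)"
  by (rule measurable_compose_countable[OF _ g]) (rule measurable_compose[OF h], simp)

lemma measurable_block_start [measurable]:
  "(\<lambda>x. block_start f x i) \<in> measurable (seq_space A) (count_space UNIV)"
proof -
  have [measurable]: "(\<lambda>x. int (length (f (x j)))) \<in> measurable (seq_space A) (count_space UNIV)" for j
    by (rule measurable_compose[OF measurable_seq_component]) simp
  have "(\<lambda>x. \<Sum>j\<in>J. int (length (f (x j)))) \<in> measurable (seq_space A) (count_space UNIV)"
    if "finite J" for J
    using that
  proof (induction J)
    case (insert j J)
    then show ?case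
      by (auto intro!: measurable_count_space_op[where F = "(+)"])
  qed simp
  then show ?thesis unfolding block_start_def
    by (intro measurable_count_space_op[where F = "(-)"] measurable_count_space_op[where F = "(+)"]) simp_all
qed

text \<open>The block that contains coordinate \<open>n\<close> depends on \<open>x\<close>, but there are only countably many candidates,
  and each candidate is recognised by a measurable condition on the block starts.\<close>

lemma measurable_concat_two_sided [measurable]:
  assumes f: "\<And>a. a \<in> A \<Longrightarrow> f a \<noteq> []" "\<And>a. a \<in> A \<Longrightarrow> set (f a) \<subseteq> B"
    and A: "countable A" and B: "countable B"
  shows "concat_two_sided f \<in> measurable (seq_space A) (seq_space B)"
proof (rule measurable_seq_spaceI)
  fix n
  have eq: "concat_two_sided f x n = f (x i) ! nat (n - block_start f x i)"
    if "x \<in> space (seq_space A)" "block_start f x i \<le> n" "n < block_start f x (i + 1)" for x i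
    using that f(1) by (intro concat_two_sided_nth) (auto simp: space_seq_space)
  have ex: "\<exists>i. block_start f x i \<le> n \<and> n < block_start f x (i + 1)"
    if "x \<in> space (seq_space A)" for x
    using that f(1) by (auto simp: space_seq_space intro: ex_block_containing[of f x n])
  show "(\<lambda>x. concat_two_sided f x n) \<in> measurable (seq_space A) (count_space B)"
  proof (subst measurable_count_space_eq_countable[OF B], safe)
    fix x assume x: "x \<in> space (seq_space A)"
    from ex[OF x] obtain i where i: "block_start f x i \<le> n" "n < block_start f x (i + 1)" by auto
    have "nat (n - block_start f x i) < length (f (x i))" using i by (simp add: block_start_step)
    moreover have "set (f (x i)) \<subseteq> B" using f(2) x by (auto simp: space_seq_space)
    ultimately show "concat_two_sided f x n \<in> B" using eq[OF x i] nth_mem by force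
  next
    fix b assume "b \<in> B"
    have "(\<lambda>x. concat_two_sided f x n) -` {b} \<inter> space (seq_space A) =
      {x \<in> space (seq_space A). \<exists>i. block_start f x i \<le> n \<and> n < block_start f x (i + 1) \<and>
         f (x i) ! nat (n - block_start f x i) = b}"
      using ex eq by fastforce
    also have "\<dots> \<in> sets (seq_space A)"
    proof -
      have [measurable]: "(\<lambda>x. x i) \<in> measurable (seq_space A) (count_space UNIV)" for i
        by (rule measurable_seq_component_UNIV)
      have [measurable]: "(\<lambda>x. f (x i) ! nat (n - c)) \<in> measurable (seq_space A) (count_space UNIV)" for i c
        by (rule measurable_compose[OF measurable_seq_component]) simp
      have [measurable]: "(\<lambda>x. f (x i) ! nat (n - block_start f x i)) \<in> measurable (seq_space A) (count_space UNIV)" for i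
        by (rule measurable_compose_countable[where f="\<lambda>c x. f (x i) ! nat (n - c)"]) measurable
      show ?thesis by measurable
    qed
    finally show "(\<lambda>x. concat_two_sided f x n) -` {b} \<inter> space (seq_space A) \<in> sets (seq_space A)" .
  qed
qed

section \<open>Stationary means\<close>

lemma shift_space: "x \<in> space (seq_space A) \<Longrightarrow> shift x \<in> space (seq_space A)"
  by (simp add: space_seq_space shift_def)

lemma shift_pow_space: "x \<in> space (seq_space A) \<Longrightarrow> (shift ^^ n) x \<in> space (seq_space A)"
  by (simp add: space_seq_space shift_pow)

text \<open>The limit of the shift averages is supposed to be given by a measure \<open>R\<close>. Then the set function in
  the definition of \<^const>\<open>stationary_mean\<close> is countably additive.\<close>

locale stationary_limit =
  fixes A :: "'a set" and M R :: "(int \<Rightarrow> 'a) measure"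
  assumes prob_M: "prob_space M" and sets_M: "sets M = sets (seq_space A)"
    and prob_R: "prob_space R" and sets_R: "sets R = sets (seq_space A)"
    and limit: "\<And>B. B \<in> sets (seq_space A) \<Longrightarrow> shift_average M B \<longlonglongrightarrow> measure R B"
begin

lemma space_M: "space M = space (seq_space A)" and space_R: "space R = space (seq_space A)"
  using sets_M sets_R by (auto dest: sets_eq_imp_space_eq)

lemma asymp_mean_stationary: "asymp_mean_stationary A M"
  unfolding asymp_mean_stationary_def using prob_M sets_M limit by (auto simp: convergent_def)

lemma stationary_mean: "stationary_mean M = R"
proof -
  have "stationary_mean M = measure_of (space R) (sets R) (emeasure R)"
    unfolding stationary_mean_def space_M space_R sets_M sets_R
  proof (rule measure_of_eq)
    show "sets (seq_space A) \<subseteq> Pow (space (seq_space A))" by (rule sets.space_closed)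
    fix B assume "B \<in> sigma_sets (space (seq_space A)) (sets (seq_space A))"
    then have "B \<in> sets (seq_space A)" by (simp add: sets.sigma_sets_eq)
    then show "ennreal (lim (shift_average M B)) = emeasure R B"
      using limit[of B] prob_R by (simp add: limI finite_measure.emeasure_eq_measure prob_space.finite_measure)
  qed
  then show ?thesis by (simp add: measure_of_of_measure)
qed

lemma vimage_shift_pow_Suc:
  "(shift ^^ n) -` (shift -` B \<inter> space (seq_space A)) \<inter> space (seq_space A) =
   (shift ^^ Suc n) -` B \<inter> space (seq_space A)"
  by (auto simp: shift_pow_space)

text \<open>Passing from \<open>B\<close> to its preimage under the shift changes the sum of \<open>n\<close> probabilities by two boundary terms
  only.\<close>

lemma stationary: "stationary R"
  unfolding stationary_def
proof (rule measure_eqI)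
  interpret M: prob_space M by (fact prob_M)
  interpret R: prob_space R by (fact prob_R)
  have shift_R: "shift \<in> measurable R R"
    using measurable_shift[of A] by (simp add: measurable_cong_sets[OF sets_R sets_R])
  show "sets (distr R R shift) = sets R" by simp
  fix B assume "B \<in> sets (distr R R shift)"
  then have B: "B \<in> sets (seq_space A)" by (simp add: sets_R)
  define B' where "B' = shift -` B \<inter> space (seq_space A)"
  have B': "B' \<in> sets (seq_space A)" unfolding B'_def by (rule measurable_sets[OF measurable_shift B])
  define a where "a i = measure M ((shift ^^ i) -` B \<inter> space M)" for i
  have a: "0 \<le> a i" "a i \<le> 1" for i unfolding a_def by auto
  have "shift_average M B' = (\<lambda>n. shift_average M B n + (a n - a 0) / real n)"
  proof
    fix n show "shift_average M B' n = shift_average M B n + (a n - a 0) / real n"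
  proof -
    have "(\<Sum>i<n. measure M ((shift ^^ i) -` B' \<inter> space M)) = (\<Sum>i<n. a (Suc i))"
      unfolding a_def space_M B'_def vimage_shift_pow_Suc ..
    also have "\<dots> = (\<Sum>i<n. a i) + (a n - a 0)" by (induction n) auto
    finally show ?thesis unfolding shift_average_def a_def[symmetric] by (simp add: add_divide_distrib)
  qed
  qed
  moreover have "(\<lambda>n. (a n - a 0) / real n) \<longlonglongrightarrow> 0"
  proof (rule tendsto_rabs_zero_cancel, rule tendsto_sandwich[where f = "\<lambda>_. 0" and h = "\<lambda>n. 1 / real n"])
    show "\<forall>\<^sub>F n in sequentially. \<bar>(a n - a 0) / real n\<bar> \<le> 1 / real n"
    proof (intro always_eventually allI)
      fix n
      have "\<bar>a n - a 0\<bar> \<le> 1" using a[of n] a[of 0] by linarith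
      then show "\<bar>(a n - a 0) / real n\<bar> \<le> 1 / real n" by (simp add: abs_divide divide_right_mono)
    qed
    show "(\<lambda>n. 1 / real n) \<longlonglongrightarrow> 0" by (rule lim_const_over_n)
  qed simp_all
  ultimately have "shift_average M B' \<longlonglongrightarrow> measure R B + 0"
    using tendsto_add[OF limit[OF B], of "\<lambda>n. (a n - a 0) / real n" 0] by simp
  then have "measure R B' = measure R B"
    using LIMSEQ_unique[OF limit[OF B']] by simp
  then show "emeasure (distr R R shift) B = emeasure R B"
    using B shift_R by (subst emeasure_distr) (auto simp: sets_R R.emeasure_eq_measure B'_def space_R)
qed

text \<open>For an invariant event all terms of the averages are equal. This determines the law under \<open>R\<close> of every
  shift-invariant function.\<close>

lemma measure_invariant:
  assumes B: "B \<in> shift_invariant_sets A"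
  shows "measure R B = measure M B"
proof -
  have B': "B \<in> sets (seq_space A)" "shift -` B \<inter> space (seq_space A) = B"
    using B by (auto simp: shift_invariant_sets_def)
  have "(shift ^^ i) -` B \<inter> space (seq_space A) = B" for i
  proof (induction i)
    case 0
    show ?case using B' by auto
  next
    case (Suc i)
    then show ?case using vimage_shift_pow_Suc[of i B] B' by (simp add: comp_def)
  qed
  then have "shift_average M B n = measure M B" if "n > 0" for n
    using that unfolding shift_average_def space_M by simp
  then have "shift_average M B \<longlonglongrightarrow> measure M B"
    by (intro tendsto_eventually eventually_mono[OF eventually_gt_at_top[of 0]]) auto
  with limit[OF B'(1)] show ?thesis by (rule LIMSEQ_unique)
qed

end

section \<open>Coding a stationary measure by blocks\<close>

lemma sum_indicator_diff:
  fixes a :: "nat \<Rightarrow> real"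
  assumes "\<And>i. 0 \<le> a i" "\<And>i. a i \<le> 1"
  shows "\<bar>sum a {..<n} - sum a {..<m}\<bar> \<le> \<bar>real n - real m\<bar>"
proof (induction n m rule: linorder_wlog)
  case (le n m)
  have "sum a {..<m} = sum a {..<n} + sum a {n..<m}"
    using le by (simp add: lessThan_atLeast0 sum.atLeastLessThan_concat)
  moreover have "0 \<le> sum a {n..<m}" using assms by (intro sum_nonneg)
  moreover have "sum a {n..<m} \<le> real m - real n"
    using sum_bounded_above[of "{n..<m}" a 1] assms le by (simp add: of_nat_diff)
  ultimately show ?case by simp
qed (simp add: abs_minus_commute)

locale stationary_coding =
  fixes A :: "'a set" and B :: "'b set" and M :: "(int \<Rightarrow> 'a) measure" and f :: "'a \<Rightarrow> 'b list"
  assumes prob_M: "prob_space M" and sets_M [measurable_cong]: "sets M = sets (seq_space A)"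
    and stationary_M: "distr M M shift = M"
    and countable_A: "countable A" and countable_B: "countable B"
    and nonempty: "\<And>a. a \<in> A \<Longrightarrow> f a \<noteq> []" and into_B: "\<And>a. a \<in> A \<Longrightarrow> set (f a) \<subseteq> B"
    and integrable_length: "integrable M (\<lambda>x. real (length (f (x 1))))"
begin

sublocale prob_space M by (fact prob_M)

abbreviation "y \<equiv> concat_two_sided f"

definition L where "L = (\<integral>x. real (length (f (x 1))) \<partial>M)"

definition S where "S m x = (\<Sum>r<m. length (f (x (int r + 1))))"

lemma space_M: "space M = space (seq_space A)"
  using sets_M by (rule sets_eq_imp_space_eq)

lemma in_A: "x \<in> space M \<Longrightarrow> x i \<in> A" by (simp add: space_M space_seq_space)

lemma shift_M [measurable]: "shift \<in> measurable M M" by measurable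

lemma shift_pow_M [measurable]: "shift ^^ n \<in> measurable M M" by measurable

lemma y_M [measurable]: "y \<in> measurable M (seq_space B)"
  using measurable_concat_two_sided[OF nonempty into_B countable_A countable_B]
  by (simp add: measurable_cong_sets[OF sets_M refl])

lemma length_M [measurable]: "(\<lambda>x. length (f (x i))) \<in> measurable M (count_space UNIV)"
  by (subst measurable_cong_sets[OF sets_M refl], rule measurable_compose[OF measurable_seq_component]) simp

lemma distr_shift_pow: "distr M M (shift ^^ n) = M"
proof (induction n)
  case 0
  show ?case by (simp add: distr_id)
next
  case (Suc n)
  have "distr M M (shift ^^ Suc n) = distr (distr M M (shift ^^ n)) M shift"
    by (subst distr_distr) (simp_all add: comp_def)
  then show ?case using Suc stationary_M by (simp add: comp_def)
qed

lemma length_ge_1: "x \<in> space M \<Longrightarrow> 1 \<le> length (f (x i))"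
  using nonempty[OF in_A, of x i] by (simp add: Suc_leI)

lemma L_ge_1: "1 \<le> L"
proof -
  have "(\<integral>x. 1 \<partial>M) \<le> L"
    unfolding L_def using length_ge_1[of _ 1]
    by (intro integral_mono integrable_length) (auto simp del: One_nat_def)
  then show ?thesis by (simp add: prob_space)
qed

definition visits where
  "visits C x = (\<Sum>j<length (f (x 1)). indicator C ((shift ^^ j) (y x)) :: real)"

lemma visits_le: "visits C x \<le> real (length (f (x 1)))"
  unfolding visits_def by (rule order.trans[OF sum_bounded_above[where K = 1]]) auto

lemma visits_nonneg: "0 \<le> visits C x"
  unfolding visits_def by (intro sum_nonneg) auto

lemma visits_M [measurable]:
  assumes [measurable]: "C \<in> sets (seq_space B)"
  shows "visits C \<in> borel_measurable M"
  unfolding visits_def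
  by (rule measurable_compose_countable[where f = "\<lambda>n x. \<Sum>j<n. indicator C ((shift ^^ j) (y x))"]) measurable

lemma integrable_visits: "C \<in> sets (seq_space B) \<Longrightarrow> integrable M (visits C)"
  by (rule Bochner_Integration.integrable_bound[OF integrable_length])
     (auto simp: visits_nonneg visits_le)

text \<open>This is the law of the coded sequence, seen from a uniformly chosen letter of block 1, after the
  source has been weighted by the length of that block (inversion of the Palm measure).\<close>

definition mean_law :: "(int \<Rightarrow> 'b) measure" where
  "mean_law = distr (density (M \<Otimes>\<^sub>M count_space UNIV)
      (\<lambda>(x, j). ennreal (1 / L) * indicator {..<length (f (x 1))} j))
     (seq_space B) (\<lambda>(x, j). (shift ^^ j) (y x))"

lemma sets_mean_law: "sets mean_law = sets (seq_space B)"
  by (simp add: mean_law_def)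

lemma emeasure_mean_law:
  assumes C [measurable]: "C \<in> sets (seq_space B)"
  shows "emeasure mean_law C = ennreal ((\<integral>x. visits C x \<partial>M) / L)"
proof -
  have [measurable]: "(\<lambda>(x, j). (shift ^^ j) (y x)) \<in> measurable (M \<Otimes>\<^sub>M count_space UNIV) (seq_space B)"
    unfolding case_prod_beta
    by (rule measurable_compose_countable[where f = "\<lambda>j p. (shift ^^ j) (y (fst p))"]) measurable
  have [measurable]: "(\<lambda>(x, j). ennreal (1 / L) * indicator {..<length (f (x 1))} j)
      \<in> borel_measurable (M \<Otimes>\<^sub>M count_space UNIV)"
    unfolding case_prod_beta
  proof (rule measurable_compose_countable[where g = snd and
        f = "\<lambda>j p. ennreal (1 / L) * indicator {..<length (f (fst p 1))} j"])
    fix j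
    have "(\<lambda>x. ennreal (1 / L) * indicator {..<length (f (x 1))} j) \<in> borel_measurable M"
      by (rule measurable_compose[OF length_M]) simp
    then show "(\<lambda>p. ennreal (1 / L) * indicator {..<length (f (fst p 1))} j)
        \<in> borel_measurable (M \<Otimes>\<^sub>M count_space UNIV)"
      by (rule measurable_compose[OF measurable_fst])
  qed simp
  interpret C: sigma_finite_measure "count_space (UNIV :: nat set)"
    by (rule sigma_finite_measure_count_space)
  have "emeasure mean_law C = (\<integral>\<^sup>+p. (case p of (x, j) \<Rightarrow> ennreal (1 / L) * indicator {..<length (f (x 1))} j) *
       indicator ((\<lambda>(x, j). (shift ^^ j) (y x)) -` C \<inter> space (M \<Otimes>\<^sub>M count_space UNIV)) p \<partial>(M \<Otimes>\<^sub>M count_space UNIV))"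
    unfolding mean_law_def by (subst emeasure_distr, simp, simp, subst emeasure_density) auto
  also have "\<dots> = (\<integral>\<^sup>+p. (case p of (x, j) \<Rightarrow> ennreal (1 / L) * indicator {..<length (f (x 1))} j *
       indicator C ((shift ^^ j) (y x))) \<partial>(M \<Otimes>\<^sub>M count_space UNIV))"
    by (intro nn_integral_cong) (auto simp: indicator_def space_pair_measure)
  also have "\<dots> = (\<integral>\<^sup>+x. \<integral>\<^sup>+j. ennreal (1 / L) * indicator {..<length (f (x 1))} j *
       indicator C ((shift ^^ j) (y x)) \<partial>count_space UNIV \<partial>M)"
    by (subst C.nn_integral_fst[symmetric]) (auto simp: case_prod_beta')
  also have "\<dots> = (\<integral>\<^sup>+x. ennreal (visits C x / L) \<partial>M)"
  proof (rule nn_integral_cong)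
    fix x
    have "(\<integral>\<^sup>+j. ennreal (1 / L) * indicator {..<length (f (x 1))} j *
       indicator C ((shift ^^ j) (y x)) \<partial>count_space UNIV)
      = (\<Sum>j<length (f (x 1)). ennreal (1 / L) * indicator C ((shift ^^ j) (y x)))"
      by (subst nn_integral_count_space'[where A = "{..<length (f (x 1))}"])
         (auto simp: indicator_def)
    also have "\<dots> = (\<Sum>j<length (f (x 1)). ennreal (1 / L * indicator C ((shift ^^ j) (y x))))"
      using L_ge_1 by (intro sum.cong) (auto simp: indicator_def)
    also have "\<dots> = ennreal (visits C x / L)"
      using L_ge_1 by (subst sum_ennreal) (auto simp: visits_def sum_divide_distrib)
    finally show "(\<integral>\<^sup>+j. ennreal (1 / L) * indicator {..<length (f (x 1))} j *
       indicator C ((shift ^^ j) (y x)) \<partial>count_space UNIV) = ennreal (visits C x / L)" .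
  qed
  also have "\<dots> = ennreal ((\<integral>x. visits C x \<partial>M) / L)"
    using L_ge_1 by (subst nn_integral_eq_integral) (auto simp: visits_nonneg integrable_visits C)
  finally show ?thesis .
qed

lemma integral_visits_nonneg: "0 \<le> (\<integral>x. visits C x \<partial>M)"
  by (intro integral_nonneg_AE AE_I2 visits_nonneg)

lemma measure_mean_law:
  "C \<in> sets (seq_space B) \<Longrightarrow> measure mean_law C = (\<integral>x. visits C x \<partial>M) / L"
  using L_ge_1 integral_visits_nonneg[of C] by (simp add: measure_def emeasure_mean_law)

lemma prob_mean_law: "prob_space mean_law"
proof
  have sp: "space mean_law = space (seq_space B)"
    using sets_mean_law by (rule sets_eq_imp_space_eq)
  have "(\<integral>x. visits (space (seq_space B)) x \<partial>M) = L"
    unfolding L_def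
  proof (rule Bochner_Integration.integral_cong)
    fix x assume "x \<in> space M"
    then have "y x \<in> space (seq_space B)" using measurable_space[OF y_M] by auto
    then show "visits (space (seq_space B)) x = real (length (f (x 1)))"
      by (simp add: visits_def shift_pow_space)
  qed simp
  then show "emeasure mean_law (space mean_law) = 1"
    using L_ge_1 by (simp add: sp emeasure_mean_law)
qed

text \<open>Consecutive blocks cover consecutive letters, so the visits counted block by block are the visits
  counted letter by letter.\<close>

lemma sum_visits:
  assumes "x \<in> space M"
  shows "(\<Sum>r<m. visits C ((shift ^^ r) x)) = (\<Sum>i<S m x. indicator C ((shift ^^ i) (y x)))"
proof (induction m)
  case 0
  show ?case by (simp add: S_def)
next
  case (Suc m)
  have y_shift: "y ((shift ^^ m) x) = (shift ^^ S m x) (y x)" for m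
  proof (induction m)
    case (Suc m)
    have "y (shift ((shift ^^ m) x)) = (shift ^^ length (f ((shift ^^ m) x 1))) (y ((shift ^^ m) x))"
      by (rule concat_two_sided_shift) (use nonempty in_A assms in \<open>simp add: shift_pow\<close>)
    then show ?case by (auto simp: Suc S_def shift_pow add_ac)
  qed (simp add: S_def)
  let ?a = "\<lambda>i. indicator C ((shift ^^ i) (y x)) :: real"
  have "visits C ((shift ^^ m) x) = (\<Sum>j<length (f (x (int m + 1))). ?a (S m x + j))"
    unfolding visits_def y_shift
    by (simp add: shift_pow funpow_add add_ac)
  also have "\<dots> = sum ?a {S m x..<S (Suc m) x}"
    by (rule sum.reindex_bij_witness[where i = "\<lambda>i. i - S m x" and j = "\<lambda>j. S m x + j"]) (auto simp: S_def)
  finally show ?case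
    using Suc.IH by (simp add: lessThan_atLeast0 sum.atLeastLessThan_concat S_def)
qed

lemma S_M [measurable]: "(\<lambda>x. real (S m x)) \<in> borel_measurable M"
  unfolding S_def of_nat_sum by measurable

lemma integrable_length_i: "integrable M (\<lambda>x. real (length (f (x (int r + 1)))))"
proof -
  have "integrable (distr M M (shift ^^ r)) (\<lambda>x. real (length (f (x 1))))"
    using integrable_length by (simp add: distr_shift_pow)
  then show ?thesis by (subst (asm) integrable_distr_eq) (auto simp: shift_pow add_ac)
qed

lemma integrable_S: "integrable M (\<lambda>x. real (S m x))"
  unfolding S_def of_nat_sum using integrable_length_i by auto

lemma integral_visits_shift:
  assumes [measurable]: "C \<in> sets (seq_space B)"
  shows "(\<integral>x. visits C ((shift ^^ r) x) \<partial>M) = (\<integral>x. visits C x \<partial>M)"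
    "integrable M (\<lambda>x. visits C ((shift ^^ r) x))"
proof -
  show "(\<integral>x. visits C ((shift ^^ r) x) \<partial>M) = (\<integral>x. visits C x \<partial>M)"
    by (subst (2) distr_shift_pow[of r, symmetric], subst integral_distr) auto
  have "integrable (distr M M (shift ^^ r)) (visits C)"
    using integrable_visits[OF assms] by (simp add: distr_shift_pow)
  then show "integrable M (\<lambda>x. visits C ((shift ^^ r) x))"
    by (subst (asm) integrable_distr_eq) auto
qed

text \<open>The left-hand side compares two counts of visits to \<open>C\<close>, one over the first \<open>n\<close> letters and one over
  the letters of the first \<open>m\<close> blocks. The right-hand side does not depend on \<open>C\<close>, and \<open>m\<close> may be chosen
  as a function of \<open>n\<close>.\<close>

lemma shift_average_bound:
  assumes C [measurable]: "C \<in> sets (seq_space B)"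
  shows "\<bar>real n * shift_average (distr M (seq_space B) y) C n - real m * (\<integral>x. visits C x \<partial>M)\<bar>
     \<le> (\<integral>x. \<bar>real (S m x) - real n\<bar> \<partial>M)"
proof -
  let ?a = "\<lambda>i x. indicator C ((shift ^^ i) (y x)) :: real"
  have a: "integrable M (?a i)" for i
    by (rule integrable_const_bound[where B = 1]) (auto simp: indicator_def)
  have "measure (distr M (seq_space B) y) ((shift ^^ i) -` C \<inter> space (distr M (seq_space B) y)) = (\<integral>x. ?a i x \<partial>M)" for i
  proof -
    have "measure (distr M (seq_space B) y) ((shift ^^ i) -` C \<inter> space (distr M (seq_space B) y))
      = measure M (y -` ((shift ^^ i) -` C \<inter> space (seq_space B)) \<inter> space M)"
      by (simp add: measure_distr measurable_sets[OF measurable_shift_pow C])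
    also have "\<dots> = (\<integral>x. indicator (y -` ((shift ^^ i) -` C \<inter> space (seq_space B)) \<inter> space M) x \<partial>M)"
      by simp
    also have "\<dots> = (\<integral>x. ?a i x \<partial>M)"
      using measurable_space[OF y_M] by (intro Bochner_Integration.integral_cong) (auto simp: indicator_def)
    finally show ?thesis .
  qed
  then have "real n * shift_average (distr M (seq_space B) y) C n = (\<integral>x. (\<Sum>i<n. ?a i x) \<partial>M)"
    by (simp add: shift_average_def Bochner_Integration.integral_sum[OF a])
  moreover have "(\<integral>x. (\<Sum>r<m. visits C ((shift ^^ r) x)) \<partial>M) = real m * (\<integral>x. visits C x \<partial>M)"
    using integral_visits_shift[OF C] by simp
  moreover have int: "integrable M (\<lambda>x. \<Sum>r<m. visits C ((shift ^^ r) x))" "integrable M (\<lambda>x. \<Sum>i<n. ?a i x)"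
    using integral_visits_shift(2)[OF C] a by auto
  ultimately have "\<bar>real n * shift_average (distr M (seq_space B) y) C n - real m * (\<integral>x. visits C x \<partial>M)\<bar>
     = \<bar>\<integral>x. (\<Sum>i<n. ?a i x) - (\<Sum>r<m. visits C ((shift ^^ r) x)) \<partial>M\<bar>"
    by simp
  also have "\<dots> \<le> (\<integral>x. \<bar>(\<Sum>i<n. ?a i x) - (\<Sum>r<m. visits C ((shift ^^ r) x))\<bar> \<partial>M)"
    by (rule integral_abs_bound)
  also have "\<dots> \<le> (\<integral>x. \<bar>real (S m x) - real n\<bar> \<partial>M)"
  proof (rule integral_mono)
    fix x assume "x \<in> space M"
    then show "\<bar>(\<Sum>i<n. ?a i x) - (\<Sum>r<m. visits C ((shift ^^ r) x))\<bar> \<le> \<bar>real (S m x) - real n\<bar>"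
      using sum_indicator_diff[of "\<lambda>i. ?a i x" n "S m x"]
      by (subst sum_visits) (auto simp: abs_minus_commute)
  qed (use int integrable_S in auto)
  finally show ?thesis .
qed

lemma integral_S_dist:
  "(\<integral>x. \<bar>real (S m x) - c\<bar> \<partial>M) \<le> (\<integral>x. \<bar>real (S m x) - d\<bar> \<partial>M) + \<bar>d - c\<bar>"
proof -
  have "(\<integral>x. \<bar>real (S m x) - c\<bar> \<partial>M) \<le> (\<integral>x. \<bar>real (S m x) - d\<bar> + \<bar>d - c\<bar> \<partial>M)"
  proof (rule integral_mono)
    show "\<bar>real (S m x) - c\<bar> \<le> \<bar>real (S m x) - d\<bar> + \<bar>d - c\<bar>" for x by linarith
  qed (use integrable_S in simp_all)
  also have "\<dots> = (\<integral>x. \<bar>real (S m x) - d\<bar> \<partial>M) + \<bar>d - c\<bar>"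
    using integrable_S by (subst Bochner_Integration.integral_add) (simp_all add: prob_space)
  finally show ?thesis .
qed

theorem shift_average_tendsto:
  assumes LLN: "(\<lambda>m. (\<integral>x. \<bar>real (S m x) - real m * L\<bar> \<partial>M) / real m) \<longlonglongrightarrow> 0"
    and C: "C \<in> sets (seq_space B)"
  shows "shift_average (distr M (seq_space B) y) C \<longlonglongrightarrow> measure mean_law C"
proof -
  \<comment> \<open>The number of blocks that cover about \<open>n\<close> letters.\<close>
  define m where "m n = nat \<lfloor>real n / L\<rfloor>" for n :: nat
  define D where "D m = (\<integral>x. \<bar>real (S m x) - real m * L\<bar> \<partial>M)" for m
  let ?G = "\<integral>x. visits C x \<partial>M"
  have L: "L > 0" using L_ge_1 by simp
  have m_le: "real (m n) \<le> real n / L" for n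
    unfolding m_def using L by (intro of_nat_floor) simp
  have m_ge: "real n / L \<le> real (m n) + 1" for n
    unfolding m_def by linarith
  have mn: "(\<lambda>n. real (m n) / real n) \<longlonglongrightarrow> 1 / L"
  proof (rule tendsto_sandwich[where f = "\<lambda>n. 1 / L - 1 / real n" and h = "\<lambda>n. 1 / L"])
    show "\<forall>\<^sub>F n in sequentially. 1 / L - 1 / real n \<le> real (m n) / real n"
      "\<forall>\<^sub>F n in sequentially. real (m n) / real n \<le> 1 / L"
      using L m_le m_ge
      by (auto intro!: eventually_mono[OF eventually_gt_at_top[of 0]] simp: field_simps)
    show "(\<lambda>n. 1 / L - 1 / real n) \<longlonglongrightarrow> 1 / L" using tendsto_diff[OF tendsto_const[of "1 / L"] lim_const_over_n[of 1]] by simp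
  qed simp
  have m_inf: "filterlim m at_top sequentially"
    unfolding filterlim_at_top
  proof
    fix Z
    show "\<forall>\<^sub>F n in sequentially. Z \<le> m n"
      using eventually_ge_at_top[of "nat \<lceil>real Z * L\<rceil>"]
    proof eventually_elim
      case (elim n)
      then have "real Z * L \<le> real n" by linarith
      then have "real Z \<le> real n / L" using L by (simp add: field_simps)
      then show "Z \<le> m n" unfolding m_def by linarith
    qed
  qed
  have bound: "\<bar>shift_average (distr M (seq_space B) y) C n - real (m n) / real n * ?G\<bar>
      \<le> real (m n) / real n * (D (m n) / real (m n)) + L / real n" if n: "n > 0" for n
  proof -
    have "real (m n) * L \<le> real n" "real n \<le> (real (m n) + 1) * L"
      using L m_le[of n] m_ge[of n] by (simp_all add: field_simps)
    then have le: "\<bar>real (m n) * L - real n\<bar> \<le> L" by (simp add: algebra_simps)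
    have e1: "real (m n) / real n * (D (m n) / real (m n)) = D (m n) / real n"
      by (cases "m n = 0") (auto simp: D_def S_def)
    have "\<bar>real n * shift_average (distr M (seq_space B) y) C n - real (m n) * ?G\<bar> \<le> D (m n) + L"
      using shift_average_bound[OF C, of n "m n"] integral_S_dist[of "m n" "real n" "real (m n) * L"] le
      unfolding D_def by linarith
    then have "\<bar>real n * shift_average (distr M (seq_space B) y) C n - real (m n) * ?G\<bar> / real n \<le> (D (m n) + L) / real n"
      by (rule divide_right_mono) simp
    moreover have "\<bar>shift_average (distr M (seq_space B) y) C n - real (m n) / real n * ?G\<bar>
      = \<bar>real n * shift_average (distr M (seq_space B) y) C n - real (m n) * ?G\<bar> / real n"
    proof -
      have "shift_average (distr M (seq_space B) y) C n - real (m n) / real n * ?G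
       = (real n * shift_average (distr M (seq_space B) y) C n - real (m n) * ?G) / real n"
        using n by (simp add: field_simps)
      then show ?thesis by (simp only: abs_divide)
    qed
    ultimately show ?thesis unfolding e1 by (simp only: add_divide_distrib)
  qed
  have "(\<lambda>n. D (m n) / real (m n)) \<longlonglongrightarrow> 0"
    using filterlim_compose[OF LLN m_inf] by (simp add: D_def)
  then have lim0: "(\<lambda>n. real (m n) / real n * (D (m n) / real (m n)) + L / real n) \<longlonglongrightarrow> 1 / L * 0 + 0"
    by (intro tendsto_add tendsto_mult mn lim_const_over_n)
  have "(\<lambda>n. shift_average (distr M (seq_space B) y) C n - real (m n) / real n * ?G) \<longlonglongrightarrow> 0"
  proof (rule Lim_null_comparison)
    show "\<forall>\<^sub>F n in sequentially. norm (shift_average (distr M (seq_space B) y) C n - real (m n) / real n * ?G)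
        \<le> real (m n) / real n * (D (m n) / real (m n)) + L / real n"
      using eventually_gt_at_top[of 0] by eventually_elim (simp only: real_norm_def bound)
    show "(\<lambda>n. real (m n) / real n * (D (m n) / real (m n)) + L / real n) \<longlonglongrightarrow> 0"
      using lim0 by simp
  qed
  from tendsto_add[OF this tendsto_mult[OF mn tendsto_const[of ?G]]]
  show ?thesis by (simp add: measure_mean_law[OF C])
qed

theorem mean_law_stationary_limit:
  assumes LLN: "(\<lambda>m. (\<integral>x. \<bar>real (S m x) - real m * L\<bar> \<partial>M) / real m) \<longlonglongrightarrow> 0"
  shows "stationary_limit B (distr M (seq_space B) y) mean_law"
proof (rule stationary_limit.intro)
  show "prob_space (distr M (seq_space B) y)" by (rule prob_space_distr) simp
qed (auto simp: prob_mean_law sets_mean_law shift_average_tendsto[OF LLN])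

end

section \<open>Binary expansions and the block code\<close>

text \<open>The number whose binary expansion is the digit 1 followed by \<open>q\<close>. It is the inverse of
  \<^const>\<open>bin_tail\<close>.\<close>

definition bin_value :: "nat list \<Rightarrow> nat" where
  "bin_value q = foldl (\<lambda>a d. 2 * a + d) 1 q"

lemma bin_digits_snoc: "2 * k + d \<ge> 1 \<Longrightarrow> d < 2 \<Longrightarrow> bin_digits (2 * k + d) = bin_digits k @ [d]"
  by (subst bin_digits.simps) auto

lemma bin_tail_snoc: "k \<ge> 1 \<Longrightarrow> d < 2 \<Longrightarrow> bin_tail (2 * k + d) = bin_tail k @ [d]"
  using bin_digits_eq_Cons[of k] bin_digits_snoc[of k d] by (simp add: bin_tail_def[of "2 * k + d"])

lemma bin_tail_1: "bin_tail 1 = []"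
  by (simp add: bin_tail_def bin_digits.simps)

lemma bin_value_snoc: "bin_value (q @ [d]) = 2 * bin_value q + d"
  by (simp add: bin_value_def)

lemma bin_value_ge_1: "bin_value q \<ge> 1"
  by (induction q rule: rev_induct) (simp add: bin_value_def, simp add: bin_value_snoc)

lemma bin_tail_bin_value: "set q \<subseteq> {0, 1} \<Longrightarrow> bin_tail (bin_value q) = q"
proof (induction q rule: rev_induct)
  case Nil
  show ?case using bin_tail_1 by (simp add: bin_value_def)
next
  case (snoc d q)
  then show ?case using bin_tail_snoc[OF bin_value_ge_1, of d q] by (auto simp: bin_value_snoc)
qed

lemma bin_value_surj: "k \<ge> 1 \<Longrightarrow> \<exists>q. set q \<subseteq> {0, 1} \<and> bin_value q = k"
proof (induction k rule: less_induct)
  case (less k)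
  show ?case
  proof (cases "k = 1")
    case True
    then show ?thesis by (intro exI[of _ "[]"]) (simp add: bin_value_def)
  next
    case False
    with less.prems have "k \<ge> 2" by simp
    then have "k div 2 < k" "1 \<le> k div 2" by simp_all
    from less.IH[OF this] obtain q where "set q \<subseteq> {0, 1}" "bin_value q = k div 2" by auto
    then show ?thesis by (intro exI[of _ "q @ [k mod 2]"]) (auto simp: bin_value_snoc)
  qed
qed

lemma bin_value_bin_tail: "k \<ge> 1 \<Longrightarrow> bin_value (bin_tail k) = k"
  using bin_value_surj bin_tail_bin_value by metis

lemma set_bin_tail: "k \<ge> 1 \<Longrightarrow> set (bin_tail k) \<subseteq> {0, 1}"
  using bin_value_surj bin_tail_bin_value by metis

text \<open>The fold is the value of \<open>r\<close> as an ordinary binary numeral, without the leading 1.\<close>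

lemma bin_value_append: "bin_value (q @ r) = bin_value q * 2 ^ length r + foldl (\<lambda>a d. 2 * a + d) 0 r"
  by (induction r rule: rev_induct) (auto simp: bin_value_def algebra_simps)

lemma power_length_le_bin_value: "2 ^ length q \<le> bin_value q"
  using bin_value_append[of "[]" q] by (simp add: bin_value_def)

lemma power_length_bin_tail_le: "k \<ge> 1 \<Longrightarrow> 2 ^ length (bin_tail k) \<le> k"
  using power_length_le_bin_value[of "bin_tail k"] bin_value_bin_tail[of k] by simp

text \<open>The shape of a code word: the letter 2 marks the end and appears nowhere else.\<close>

definition terminated :: "nat list \<Rightarrow> bool" where
  "terminated a \<longleftrightarrow> a \<noteq> [] \<and> last a = 2 \<and> 2 \<notin> set (butlast a)"

lemma terminated_nth: "terminated a \<Longrightarrow> t < length a \<Longrightarrow> a ! t = 2 \<longleftrightarrow> t = length a - 1"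
  unfolding terminated_def
  by (cases "t = length a - 1") (auto simp: last_conv_nth in_set_conv_nth nth_butlast)

lemma terminated_append: "set q \<subseteq> {0, 1} \<Longrightarrow> z \<in> {0, 1} \<Longrightarrow> terminated (q @ [z, 2])"
  by (auto simp: terminated_def butlast_append)

lemma terminated_code: "k \<ge> 1 \<Longrightarrow> z \<in> {0, 1} \<Longrightarrow> terminated (code (k, z))"
  using terminated_append[OF set_bin_tail] by (simp add: code_def)

lemma count_list_terminated: "terminated a \<Longrightarrow> count_list a 2 = 1"
  by (cases a rule: rev_cases) (auto simp: terminated_def)

lemma set_code: "k \<ge> 1 \<Longrightarrow> z \<in> {0, 1} \<Longrightarrow> set (code (k, z)) \<subseteq> {0, 1, 2}"
  using set_bin_tail[of k] by (auto simp: code_def)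

lemma code_nonempty: "code a \<noteq> []"
  by (cases a) (simp add: code_def)

lemma inj_on_code: "inj_on code ({1..} \<times> UNIV)"
proof (rule inj_onI)
  fix a b :: "nat \<times> nat" assume ab: "a \<in> {1..} \<times> UNIV" "b \<in> {1..} \<times> UNIV" "code a = code b"
  obtain k z k' z' where eq: "a = (k, z)" "b = (k', z')" by fastforce
  with ab have "bin_tail k = bin_tail k'" "z = z'" "k \<ge> 1" "k' \<ge> 1" by (auto simp: code_def)
  then show "a = b" using bin_value_bin_tail eq by metis
qed

lemma occurs_in_shift: "occurs_in u (shift x) \<longleftrightarrow> occurs_in u x"
proof -
  have "block (shift x) k l = block x (k + 1) (l + 1)" for k l
    using block_shift_pow[of 1 x k l] by simp
  then have "block (shift x) (i + 1) (i + int (length u)) = block x ((i + 1) + 1) ((i + 1) + int (length u))" for i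
    by (simp add: add_ac)
  then show ?thesis
    unfolding occurs_in_def by (metis diff_add_cancel)
qed

lemma predictor_seq_shift: "predictor_seq k (shift x) = predictor_seq k x"
  by (simp add: predictor_seq_def occurs_in_shift)

lemma predictor_seq_shift_pow: "predictor_seq k ((shift ^^ n) x) = predictor_seq k x"
  by (induction n) (simp_all add: predictor_seq_shift)

lemma block_split3:
  assumes "k \<le> a" "a \<le> b + 1" "b \<le> l"
  shows "block x k l = block x k (a - 1) @ block x a b @ block x (b + 1) l"
  using block_append[of k a l x] block_append[of a "b + 1" l x] assms by simp

lemma sublist_block: "k \<le> a \<Longrightarrow> a \<le> b + 1 \<Longrightarrow> b \<le> l \<Longrightarrow> sublist (block x a b) (block x k l)"
  using block_split3[of k a b l x] by (auto simp: sublist_def)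

lemma sublist_block_occurs:
  assumes "sublist u (block x k l)"
  shows "occurs_in u x"
proof -
  obtain ps ss where "block x k l = ps @ u @ ss" using assms by (auto simp: sublist_def)
  moreover define j where "j = k + int (length ps) - 1"
  moreover have "block x (j + 1) (j + int (length u)) = u"
  proof (rule nth_equalityI)
    fix i assume "i < length (block x (j + 1) (j + int (length u)))"
    then have i: "i < length u" by simp
    have len: "nat (l - k + 1) = length (ps @ u @ ss)"
      using calculation by (metis length_block)
    have "x (k + int (length ps + i)) = (ps @ u @ ss) ! (length ps + i)"
      using nth_block[of "length ps + i" l k x] i len calculation by simp
    then show "block x (j + 1) (j + int (length u)) ! i = u ! i"
      using i by (simp add: nth_block j_def nth_append add_ac)
  qed simp
  ultimately show ?thesis unfolding occurs_in_def by blast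
qed

lemma ex_split_after_last_2:
  "\<exists>w' p. w = w' @ p \<and> (w' = [] \<or> last w' = 2) \<and> (2 :: nat) \<notin> set p"
proof (induction w rule: rev_induct)
  case (snoc a w)
  then obtain w' p where w: "w = w' @ p" "w' = [] \<or> last w' = 2" "2 \<notin> set p" by blast
  show ?case
  proof (cases "a = 2")
    case True
    then show ?thesis by (intro exI[of _ "w @ [a]"] exI[of _ "[]"]) simp
  next
    case False
    then show ?thesis using w by (intro exI[of _ w'] exI[of _ "p @ [a]"]) simp
  qed
qed simp

text \<open>In a concatenation of code words every letter 2 ends a block, so the sequence can be decoded from
  any point on.\<close>

locale parsed_sequence =
  fixes x :: "int \<Rightarrow> nat \<times> nat"
  assumes x: "\<And>i. fst (x i) \<ge> 1" "\<And>i. snd (x i) \<in> {0, 1}"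
begin

abbreviation "y \<equiv> concat_two_sided code x"
abbreviation "bs \<equiv> block_start code x"

lemma terminated_x: "terminated (code (x i))"
  using terminated_code[OF x(1)[of i] x(2)[of i]] by simp

lemma y_nth: "t < length (code (x i)) \<Longrightarrow> y (bs i + int t) = code (x i) ! t"
  using concat_two_sided_nth[of code x i "bs i + int t", OF code_nonempty]
  by (simp add: block_start_step)

lemma y_before_block: "y (bs i - 1) = 2"
proof -
  have "y (bs (i - 1) + int (length (code (x (i - 1))) - 1)) = 2"
    using terminated_nth[OF terminated_x, of "length (code (x (i - 1))) - 1" "i - 1"] code_nonempty
    by (subst y_nth) auto
  then show ?thesis
    using block_start_step[of code x "i - 1"] code_nonempty[of "x (i - 1)"]
    by (simp add: of_nat_diff Suc_leI algebra_simps)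
qed

lemma ex_block_after_2:
  assumes "y n = 2"
  shows "\<exists>i. n = bs i - 1"
proof -
  obtain i where i: "bs i \<le> n" "n < bs (i + 1)"
    using ex_block_containing[of code x n, OF code_nonempty] .
  define t where "t = nat (n - bs i)"
  have t: "t < length (code (x i))" "n = bs i + int t"
    using i by (auto simp: t_def block_start_step)
  then have "t = length (code (x i)) - 1"
    using terminated_nth[OF terminated_x t(1)] y_nth[OF t(1)] assms by simp
  then show ?thesis
    using t by (intro exI[of _ "i + 1"]) (auto simp: block_start_step of_nat_diff)
qed

text \<open>Both \<open>w\<close> and the code word begin at the same coordinate and extend to the first letter 2 after it.\<close>

lemma block_eq_code:
  assumes w: "terminated w" and eq: "block y (bs i) (bs i + int (length w) - 1) = w"
  shows "code (x i) = w"
proof -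
  let ?a = "code (x i)"
  have y_w: "y (bs i + int t) = w ! t" if "t < length w" for t
    using nth_block[of t "bs i + int (length w) - 1" "bs i" y] that eq by simp
  have pos: "length w > 0" "length ?a > 0" using w code_nonempty by (auto simp: terminated_def)
  have agree: "w ! t = ?a ! t" if "t < length w" "t < length ?a" for t
    using y_w[OF that(1)] y_nth[OF that(2)] by simp
  have "\<not> length w < length ?a"
  proof
    assume lt: "length w < length ?a"
    define t where "t = length w - 1"
    have "t < length w" "t < length ?a" "t \<noteq> length ?a - 1" using lt pos unfolding t_def by linarith+
    then show False
      using agree[of t] terminated_nth[OF terminated_x, of t i] terminated_nth[OF w, of t] by (auto simp: t_def)
  qed
  moreover have "\<not> length ?a < length w"
  proof
    assume lt: "length ?a < length w"
    define t where "t = length ?a - 1"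
    have "t < length w" "t < length ?a" "t \<noteq> length w - 1" using lt pos unfolding t_def by linarith+
    then show False
      using agree[of t] terminated_nth[OF terminated_x, of t i] terminated_nth[OF w, of t] by (auto simp: t_def)
  qed
  ultimately show ?thesis
    using agree by (intro nth_equalityI) auto
qed

lemma block_with_separator:
  "block y (bs i - 1) (bs (i + 1) - 1) = 2 # code (x i)"
proof -
  have "block y (bs i - 1) (bs (i + 1) - 1) = block y (bs i - 1) (bs i - 1) @ block y (bs i) (bs (i + 1) - 1)"
    by (subst block_append[where l = "bs i"]) (auto simp: block_start_step)
  moreover have "block y (bs i - 1) (bs i - 1) = [2]" by (simp add: block_def y_before_block)
  ultimately show ?thesis
    using block_concat_block_start[of code x i, OF code_nonempty] by simp
qed

text \<open>The leading 2 forces the occurrence to start at a block boundary, and then injectivity of the code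
  identifies the source symbol.\<close>

lemma occurs_code_iff:
  assumes "k \<ge> 1" "z \<in> {0, 1}"
  shows "occurs_in (2 # code (k, z)) y \<longleftrightarrow> (\<exists>i. x i = (k, z))"
proof
  assume "occurs_in (2 # code (k, z)) y"
  then obtain p where p: "block y (p + 1) (p + 1 + int (length (code (k, z)))) = 2 # code (k, z)"
    unfolding occurs_in_def by (auto simp: add_ac)
  have "block y (p + 1) (p + 1 + int (length (code (k, z))))
    = y (p + 1) # block y (p + 2) (p + 1 + int (length (code (k, z))))"
    by (simp add: block_def upto_rec1 add.commute)
  with p have 2: "y (p + 1) = 2" "block y (p + 2) (p + 1 + int (length (code (k, z)))) = code (k, z)"
    by auto
  then obtain i where "p + 1 = bs i - 1" using ex_block_after_2 by blast
  then have "bs i = p + 2" by simp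
  then have "code (x i) = code (k, z)"
    using block_eq_code[OF terminated_code[OF assms], of i] 2(2) by (simp add: add_ac)
  then have "x i = (k, z)"
    using inj_onD[OF inj_on_code, of "x i" "(k, z)"] x(1)[of i] assms by (cases "x i") auto
  then show "\<exists>i. x i = (k, z)" ..
next
  assume "\<exists>i. x i = (k, z)"
  then obtain i where "x i = (k, z)" ..
  then show "occurs_in (2 # code (k, z)) y"
    using block_with_separator[of i] sublist_block_occurs[of "2 # code (k, z)" y "bs i - 1" "bs (i + 1) - 1"]
    by simp
qed

text \<open>The number of letters 2 in \<open>w'\<close> is the number of blocks that \<open>w'\<close> comprises. The string \<open>p\<close> is allowed to
  end in 2 so that the statement also applies when a letter 2 completes the block; it is
  never longer than the block, since an inner letter 2 would appear in \<open>butlast p\<close>.\<close>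

lemma prefix_iff:
  assumes w': "w' = [] \<or> last w' = 2" and p: "2 \<notin> set (butlast p)"
  defines "r \<equiv> count_list w' 2"
  shows "block y 1 (int (length (w' @ p))) = w' @ p \<longleftrightarrow>
    concat (map (\<lambda>i. code (x (int i))) [1..<Suc r]) = w' \<and> prefix p (code (x (int r + 1)))"
proof -
  define C where "C m = concat (map (\<lambda>i. code (x (int i))) [1..<Suc m])" for m
  have C_block: "block y 1 (bs (int m + 1) - 1) = C m" for m
    unfolding C_def by (rule block_concat_blocks) (rule code_nonempty)
  have bs_pos: "1 \<le> bs (int m + 1)" for m
    using block_start_mono[of code x 1 "int m + 1", OF code_nonempty] by (simp add: block_start_1)
  have C_len: "int (length (C m)) = bs (int m + 1) - 1" for m
    using arg_cong[OF C_block[of m], of length] bs_pos[of m] by simp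
  have C_count: "count_list (C m) 2 = m" for m
    by (induction m) (simp_all add: C_def count_list_terminated terminated_x)
  have split: "block y 1 (int (length (w' @ p))) = block y 1 (int (length w')) @
      block y (int (length w') + 1) (int (length w') + int (length p))"
    by (subst block_append[where l = "int (length w') + 1"]) auto
  have "block y 1 (int (length (w' @ p))) = w' @ p \<longleftrightarrow>
     block y 1 (int (length w')) = w' \<and>
     block y (int (length w') + 1) (int (length w') + int (length p)) = p"
    unfolding split by (subst append_eq_append_conv) auto
  also have "\<dots> \<longleftrightarrow> C r = w' \<and> block y (bs (int r + 1)) (bs (int r + 1) + int (length p) - 1) = p"
  proof -
    have "C r = w'" if eq: "block y 1 (int (length w')) = w'"
    proof (cases "w' = []")
      case True
      then show ?thesis by (simp add: r_def C_def)
    next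
      case False
      have "block y 1 (int (length w')) ! (length w' - 1) = y (int (length w'))"
        using False by (subst nth_block) (auto simp: of_nat_diff Suc_leI)
      then have "y (int (length w')) = 2" using w' False eq by (simp add: last_conv_nth)
      then obtain i where i: "int (length w') = bs i - 1" using ex_block_after_2 by blast
      have "1 \<le> i"
      proof (rule ccontr)
        assume "\<not> 1 \<le> i"
        then have "bs i \<le> bs 1" by (intro block_start_mono code_nonempty) simp
        moreover have "length w' > 0" using False by simp
        ultimately show False using i by (simp add: block_start_1)
      qed
      then obtain m where m: "i = int m + 1" by (metis add.commute zle_iff_zadd)
      then have "C m = w'" using C_block[of m] i eq by simp
      then show ?thesis using C_count[of m] by (simp add: r_def)
    qed
    moreover have "block y 1 (int (length w')) = w'" "int (length w') = bs (int r + 1) - 1" if "C r = w'"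
      using C_block[of r] C_len[of r] that by simp_all
    moreover from this(2) have "int (length w') + 1 = bs (int r + 1)"
        "int (length w') + int (length p) = bs (int r + 1) + int (length p) - 1" if "C r = w'"
      using that by simp_all
    ultimately show ?thesis by (cases "C r = w'") (simp_all only: simp_thms, blast?)
  qed
  also have "block y (bs (int r + 1)) (bs (int r + 1) + int (length p) - 1) = p \<longleftrightarrow>
      prefix p (code (x (int r + 1)))"
  proof
    let ?a = "code (x (int r + 1))"
    assume eq: "block y (bs (int r + 1)) (bs (int r + 1) + int (length p) - 1) = p"
    have y_p: "y (bs (int r + 1) + int t) = p ! t" if "t < length p" for t
      using nth_block[of t "bs (int r + 1) + int (length p) - 1" "bs (int r + 1)" y] that eq by simp
    have "length p \<le> length ?a"
    proof (rule ccontr)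
      assume len: "\<not> length p \<le> length ?a"
      have "p ! (length ?a - 1) = ?a ! (length ?a - 1)"
        using len code_nonempty[of "x (int r + 1)"]
        by (subst y_p[symmetric], simp, subst y_nth) auto
      also have "\<dots> = 2" using terminated_x[of "int r + 1"] by (auto simp: terminated_def last_conv_nth)
      finally have 2: "p ! (length ?a - 1) = 2" .
      have "length ?a > 0" using code_nonempty by simp
      then have lt: "length ?a - 1 < length (butlast p)" using len unfolding length_butlast by linarith
      then have "butlast p ! (length ?a - 1) = 2" using 2 by (simp add: nth_butlast)
      then have "2 \<in> set (butlast p)" using nth_mem[OF lt] by simp
      with p show False by simp
    qed
    moreover then have "take (length p) ?a = p"
      by (intro nth_equalityI) (auto simp flip: y_p y_nth)
    ultimately show "prefix p ?a" by (metis take_is_prefix)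
  next
    let ?a = "code (x (int r + 1))"
    assume "prefix p ?a"
    then obtain ss where "?a = p @ ss" by (auto simp: prefix_def)
    then show "block y (bs (int r + 1)) (bs (int r + 1) + int (length p) - 1) = p"
      using y_nth[of _ "int r + 1"] by (intro nth_equalityI) (auto simp: nth_block nth_append)
  qed
  finally show ?thesis unfolding C_def .
qed

end

text \<open>A realisation of the source: indices \<open>\<kappa> i\<close> and bits \<open>\<zeta> k\<close>.\<close>

locale bit_sequence =
  fixes \<kappa> :: "int \<Rightarrow> nat" and \<zeta> :: "nat \<Rightarrow> nat"
  assumes \<kappa>: "\<And>i. \<kappa> i \<ge> 1" and \<zeta>: "\<And>k. k \<ge> 1 \<Longrightarrow> \<zeta> k \<in> {0, 1}"
begin

abbreviation "x \<equiv> \<lambda>i. (\<kappa> i, \<zeta> (\<kappa> i))"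

sublocale parsed_sequence x
  by unfold_locales (use \<kappa> \<zeta> in auto)

lemma occurs_bit_iff:
  assumes "k \<ge> 1" "z \<in> {0, 1}"
  shows "occurs_in ([2] @ bin_tail k @ [z, 2]) y \<longleftrightarrow> \<zeta> k = z \<and> k \<in> range \<kappa>"
  using occurs_code_iff[OF assms] by (auto simp: code_def)

lemma predictor_seq_eq:
  assumes k: "k \<ge> 1"
  shows "predictor_seq k y = (if k \<in> range \<kappa> then \<zeta> k else 2)"
  using occurs_bit_iff[OF k, of 0] occurs_bit_iff[OF k, of 1] \<zeta>[OF k]
  unfolding predictor_seq_def predictor_def Let_def by auto

lemma predictor_str_eq:
  assumes k: "k \<ge> 1" and i: "\<kappa> i = k" and a: "a + 1 \<le> bs i - 1" and b: "bs (i + 1) - 1 \<le> b"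
  shows "predictor_str k (block y (a + 1) b) = \<zeta> k"
proof -
  have "sublist (2 # code (x i)) (block y (a + 1) b)"
    unfolding block_with_separator[symmetric]
    by (rule sublist_block) (use a b in \<open>auto simp: block_start_step\<close>)
  then have 1: "sublist ([2] @ bin_tail k @ [\<zeta> k, 2]) (block y (a + 1) b)"
    using i by (simp add: code_def)
  have 2: "\<not> sublist ([2] @ bin_tail k @ [z, 2]) (block y (a + 1) b)" if "z \<in> {0, 1}" "z \<noteq> \<zeta> k" for z
    using sublist_block_occurs occurs_bit_iff[OF k that(1)] that(2) by metis
  show ?thesis
    using 1 2[of 0] 2[of 1] \<zeta>[OF k] unfolding predictor_str_def predictor_def Let_def by auto
qed

end

section \<open>Extending a prefix of a code word\<close>

lemma measure_pmf_le_of_inj: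
  assumes inj: "inj_on \<phi> A" and sub: "\<phi> ` A \<subseteq> D"
    and le: "\<And>k. k \<in> A \<Longrightarrow> pmf \<kappa> k \<le> C * pmf \<kappa> (\<phi> k)" and C: "0 \<le> C"
  shows "measure_pmf.prob \<kappa> A \<le> C * measure_pmf.prob \<kappa> D"
proof -
  have "emeasure \<kappa> A = (\<integral>\<^sup>+k. pmf \<kappa> k \<partial>count_space A)" by (simp add: nn_integral_pmf)
  also have "\<dots> \<le> (\<integral>\<^sup>+k. ennreal C * pmf \<kappa> (\<phi> k) \<partial>count_space A)"
    using le C by (intro nn_integral_mono) (auto simp flip: ennreal_mult intro!: ennreal_leI)
  also have "\<dots> = ennreal C * emeasure \<kappa> (\<phi> ` A)"
    by (subst nn_integral_cmult) (auto simp: nn_integral_pmf'[OF inj])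
  also have "\<dots> \<le> ennreal C * emeasure \<kappa> D"
    by (intro mult_left_mono emeasure_mono) (use sub in auto)
  finally show ?thesis
    using C by (simp add: measure_pmf.emeasure_eq_measure ennreal_mult[symmetric])
qed

locale zipf =
  fixes \<alpha> c :: real and \<kappa> :: "nat pmf"
  assumes \<alpha>_pos: "\<alpha> > 0" and c_pos: "c > 0" and pmf_\<kappa>: "\<And>k. pmf \<kappa> k = real k powr (- \<alpha>) / c"
begin

lemma pmf_le_3:
  assumes "1 \<le> k" "1 \<le> j" "j \<le> 3 * k"
  shows "pmf \<kappa> k \<le> 3 powr \<alpha> * pmf \<kappa> j"
proof -
  have "(real (3 * k)) powr (- \<alpha>) \<le> real j powr (- \<alpha>)"
    using assms \<alpha>_pos by (intro powr_mono2') auto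
  moreover have "real k powr (- \<alpha>) = 3 powr \<alpha> * (real (3 * k)) powr (- \<alpha>)"
    by (simp add: powr_mult powr_minus field_simps)
  ultimately show ?thesis
    using c_pos by (simp add: pmf_\<kappa> divide_right_mono mult_left_mono)
qed

context
  fixes \<zeta> :: "nat \<Rightarrow> nat" and p :: "nat list"
  assumes \<zeta>: "\<And>k. k \<ge> 1 \<Longrightarrow> \<zeta> k \<in> {0, 1}" and p: "2 \<notin> set p"
begin

text \<open>The indices that remain possible after the prefix \<open>q\<close> of a block has been read, given the bits \<open>\<zeta>\<close>.\<close>

definition compatible where
  "compatible q = {k. k \<ge> 1 \<and> prefix q (code (k, \<zeta> k))}"

text \<open>If the block with index \<open>k\<close> ends right after \<open>p\<close>, then \<open>p\<close> is the binary tail of \<open>k\<close> followed by \<open>\<zeta> k\<close>, that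
  is, the binary tail of \<open>2 * k + \<zeta> k\<close>. The block of the latter index continues after \<open>p\<close> with a digit.\<close>

lemma compatible_2_le:
  "measure_pmf.prob \<kappa> (compatible (p @ [2])) \<le>
   3 powr \<alpha> * measure_pmf.prob \<kappa> (compatible p - compatible (p @ [2]))"
proof (rule measure_pmf_le_of_inj[where \<phi> = "\<lambda>k. 2 * k + \<zeta> k"])
  have p_eq: "k \<ge> 1" "\<zeta> k \<in> {0, 1}" "p = bin_tail k @ [\<zeta> k]" if mem: "k \<in> compatible (p @ [2])" for k
  proof -
    show k: "k \<ge> 1" using that by (simp add: compatible_def)
    show z: "\<zeta> k \<in> {0, 1}" using \<zeta>[OF k] .
    obtain t where "code (k, \<zeta> k) = (p @ [2]) @ t"
      using mem by (auto simp: compatible_def elim: prefixE)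
    then have t: "(bin_tail k @ [\<zeta> k]) @ [2] = p @ 2 # t" by (simp add: code_def)
    have "t = []"
    proof (rule ccontr)
      assume "t \<noteq> []"
      then have "bin_tail k @ [\<zeta> k] = p @ 2 # butlast t"
        using arg_cong[OF t, of butlast] by (simp add: butlast_append)
      then have "2 \<in> set (bin_tail k @ [\<zeta> k])" by simp
      then show False using set_bin_tail[OF k] z by auto
    qed
    then show "p = bin_tail k @ [\<zeta> k]" using t by simp
  qed
  show "inj_on (\<lambda>k. 2 * k + \<zeta> k) (compatible (p @ [2]))"
  proof (rule inj_onI)
    fix k k' assume k: "k \<in> compatible (p @ [2])" "k' \<in> compatible (p @ [2])"
    then have "bin_tail k = bin_tail k'" using p_eq(3)[of k] p_eq(3)[of k'] by simp
    then show "k = k'" using bin_value_bin_tail p_eq(1) k by metis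
  qed
  show "(\<lambda>k. 2 * k + \<zeta> k) ` compatible (p @ [2]) \<subseteq> compatible p - compatible (p @ [2])"
  proof safe
    fix k assume k: "k \<in> compatible (p @ [2])"
    let ?j = "2 * k + \<zeta> k"
    have j: "?j \<ge> 1" using p_eq(1)[OF k] by simp
    have "bin_tail ?j = p" using p_eq[OF k] by (subst bin_tail_snoc) auto
    then have code_j: "code (?j, \<zeta> ?j) = p @ [\<zeta> ?j, 2]" by (simp add: code_def)
    show "?j \<in> compatible p" using j code_j by (simp add: compatible_def)
    assume "?j \<in> compatible (p @ [2])"
    then have "prefix (p @ [2]) (p @ [\<zeta> ?j, 2])" using code_j by (simp add: compatible_def)
    then show False using \<zeta>[OF j] by auto
  qed
  show "pmf \<kappa> k \<le> 3 powr \<alpha> * pmf \<kappa> (2 * k + \<zeta> k)" if "k \<in> compatible (p @ [2])" for k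
    using p_eq(1,2)[OF that] by (intro pmf_le_3) auto
qed simp

text \<open>The letter \<open>s\<close> after \<open>p\<close> is either the bit attached to an index with binary tail \<open>p\<close>, or a further
  digit of the index.\<close>

lemma compatible_digit_cases:
  assumes s: "s \<in> {0, 1}"
  shows "compatible (p @ [s]) \<subseteq>
    {k \<in> compatible (p @ [s]). bin_tail k = p} \<union> {k. k \<ge> 1 \<and> (\<exists>t. bin_tail k = p @ s # t)}"
proof
  fix k assume k: "k \<in> compatible (p @ [s])"
  then obtain t where "code (k, \<zeta> k) = (p @ [s]) @ t"
    by (auto simp: compatible_def elim: prefixE)
  then have t: "bin_tail k @ [\<zeta> k, 2] = p @ s # t" by (simp add: code_def)
  have "t \<noteq> []" using arg_cong[OF t, of last] s by auto
  then obtain t' where t': "t = t' @ [2]"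
    using arg_cong[OF t, of last] by (cases t rule: rev_cases) auto
  with t have *: "bin_tail k @ [\<zeta> k] = p @ s # t'" by simp
  show "k \<in> {k \<in> compatible (p @ [s]). bin_tail k = p} \<union> {k. k \<ge> 1 \<and> (\<exists>t. bin_tail k = p @ s # t)}"
  proof (cases t' rule: rev_cases)
    case Nil
    then show ?thesis using * k by simp
  next
    case (snoc t'' d)
    then have "bin_tail k = p @ s # t''" using * by simp
    then show ?thesis using k by (auto simp: compatible_def)
  qed
qed

text \<open>In the first case of \<open>compatible_digit_cases\<close> the digit \<open>1 - s\<close> is appended to the index, in the
  second case the digit at position \<open>length p\<close> is flipped. Either map is injective, which accounts
  for the factor 2.\<close>

lemma compatible_digit_le:
  assumes s: "s \<in> {0, 1}"
  shows "measure_pmf.prob \<kappa> (compatible (p @ [s])) \<le>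
    2 * 3 powr \<alpha> * measure_pmf.prob \<kappa> (compatible p - compatible (p @ [s]))"
proof -
  let ?D = "compatible p - compatible (p @ [s])"
  let ?A = "{k \<in> compatible (p @ [s]). bin_tail k = p}"
  let ?B = "{k. k \<ge> 1 \<and> (\<exists>t. bin_tail k = p @ s # t)}"
  have D_I: "j \<in> ?D" if j: "j \<ge> 1" and "bin_tail j = p @ (1 - s) # t" for j t
  proof -
    have "code (j, \<zeta> j) = p @ (1 - s) # t @ [\<zeta> j, 2]" using that by (simp add: code_def)
    moreover have "s \<noteq> 1 - s" using s by auto
    ultimately show ?thesis
      using j by (auto simp: compatible_def)
  qed
  have "measure_pmf.prob \<kappa> ?A \<le> 3 powr \<alpha> * measure_pmf.prob \<kappa> ?D"
  proof (rule measure_pmf_le_of_inj[where \<phi> = "\<lambda>k. 2 * k + (1 - s)"])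
    show "inj_on (\<lambda>k. 2 * k + (1 - s)) ?A" by (auto simp: inj_on_def)
    show "(\<lambda>k. 2 * k + (1 - s)) ` ?A \<subseteq> ?D"
    proof
      fix j assume "j \<in> (\<lambda>k. 2 * k + (1 - s)) ` ?A"
      then obtain k where k: "k \<ge> 1" "bin_tail k = p" "j = 2 * k + (1 - s)"
        by (auto simp: compatible_def)
      then show "j \<in> ?D" using bin_tail_snoc[of k "1 - s"] s by (intro D_I[where t = "[]"]) auto
    qed
    show "pmf \<kappa> k \<le> 3 powr \<alpha> * pmf \<kappa> (2 * k + (1 - s))" if "k \<in> ?A" for k
      using that by (intro pmf_le_3) (auto simp: compatible_def)
  qed simp
  moreover have "measure_pmf.prob \<kappa> ?B \<le> 3 powr \<alpha> * measure_pmf.prob \<kappa> ?D"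
  proof (rule measure_pmf_le_of_inj)
    define \<phi> where "\<phi> k = bin_value ((bin_tail k)[length p := 1 - s])" for k
    have \<phi>: "\<phi> k \<ge> 1" "\<phi> k \<le> 3 * k" "bin_tail (\<phi> k) = p @ (1 - s) # t"
      if k: "k \<ge> 1" and t: "bin_tail k = p @ s # t" for k t
    proof -
      have set: "set (p @ (1 - s) # t) \<subseteq> {0, 1}" using set_bin_tail[OF k] s t by auto
      have \<phi>_k: "\<phi> k = bin_value (p @ (1 - s) # t)" by (simp add: \<phi>_def t)
      show "\<phi> k \<ge> 1" unfolding \<phi>_def by (rule bin_value_ge_1)
      show "bin_tail (\<phi> k) = p @ (1 - s) # t" using bin_tail_bin_value[OF set] \<phi>_k by simp
      let ?r = "foldl (\<lambda>a d. 2 * a + d) 0 t"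
      have *: "bin_value (p @ d # t) = (2 * bin_value p + d) * 2 ^ length t + ?r" for d
        using bin_value_append[of "p @ [d]" t] by (simp add: bin_value_snoc)
      have "\<phi> k \<le> (2 * bin_value p + 1) * 2 ^ length t + ?r"
        unfolding \<phi>_k * by (intro add_mono mult_right_mono) auto
      also have "\<dots> \<le> 3 * ((2 * bin_value p + s) * 2 ^ length t + ?r)"
      proof -
        have "2 * bin_value p + 1 \<le> 3 * (2 * bin_value p + s)" using bin_value_ge_1[of p] by simp
        then have "(2 * bin_value p + 1) * 2 ^ length t \<le> 3 * (2 * bin_value p + s) * 2 ^ length t"
          by (rule mult_right_mono) simp
        then show ?thesis by (simp add: algebra_simps)
      qed
      also have "\<dots> = 3 * k" using bin_value_bin_tail[OF k] t * by simp
      finally show "\<phi> k \<le> 3 * k" .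
    qed
    show "inj_on \<phi> ?B"
    proof (rule inj_onI)
      fix k k' assume "k \<in> ?B" "k' \<in> ?B" and eq: "\<phi> k = \<phi> k'"
      then obtain t t' where k: "k \<ge> 1" "bin_tail k = p @ s # t" and k': "k' \<ge> 1" "bin_tail k' = p @ s # t'"
        by auto
      with \<phi>(3)[OF k] \<phi>(3)[OF k'] eq have "bin_tail k = bin_tail k'" by simp
      then show "k = k'" using bin_value_bin_tail k(1) k'(1) by metis
    qed
    show "\<phi> ` ?B \<subseteq> ?D" using \<phi> D_I by blast
    show "pmf \<kappa> k \<le> 3 powr \<alpha> * pmf \<kappa> (\<phi> k)" if "k \<in> ?B" for k
      using that \<phi> by (auto intro!: pmf_le_3)
  qed simp
  moreover have "measure_pmf.prob \<kappa> (compatible (p @ [s])) \<le> measure_pmf.prob \<kappa> (?A \<union> ?B)"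
    using compatible_digit_cases[OF s] by (intro measure_pmf.finite_measure_mono) auto
  moreover have "measure_pmf.prob \<kappa> (?A \<union> ?B) \<le> measure_pmf.prob \<kappa> ?A + measure_pmf.prob \<kappa> ?B"
    by (rule measure_Un_le) auto
  ultimately show ?thesis by linarith
qed

text \<open>A part whose mass is at most \<open>C\<close> times the mass of the rest has at most the fraction \<open>C / (1 + C)\<close> of the
  whole.\<close>

lemma compatible_snoc_le:
  assumes s: "s \<in> {0, 1, 2}"
  shows "measure_pmf.prob \<kappa> (compatible (p @ [s])) \<le>
    2 * 3 powr \<alpha> / (1 + 2 * 3 powr \<alpha>) * measure_pmf.prob \<kappa> (compatible p)"
proof -
  define C :: real where "C = 2 * 3 powr \<alpha>"
  have C: "C > 0" by (simp add: C_def)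
  let ?S = "measure_pmf.prob \<kappa> (compatible (p @ [s]))"
  let ?D = "measure_pmf.prob \<kappa> (compatible p - compatible (p @ [s]))"
  have "?S \<le> C * ?D"
  proof (cases "s = 2")
    case True
    have "3 powr \<alpha> * ?D \<le> C * ?D" unfolding C_def by (intro mult_right_mono) auto
    then show ?thesis using compatible_2_le True by simp
  next
    case False
    then show ?thesis unfolding C_def using compatible_digit_le[of s] s by simp
  qed
  moreover have "?D = measure_pmf.prob \<kappa> (compatible p) - ?S"
    by (rule measure_pmf.finite_measure_Diff) (auto simp: compatible_def dest: append_prefixD)
  ultimately have "?S * (1 + C) \<le> C * measure_pmf.prob \<kappa> (compatible p)"
    by (simp add: algebra_simps)
  then have "?S \<le> C * measure_pmf.prob \<kappa> (compatible p) / (1 + C)"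
    using C by (simp add: pos_le_divide_eq)
  then show ?thesis by (simp add: C_def)
qed

end

end

section \<open>The source and the lengths of its blocks\<close>

lemma measurable_count_space_into:
  assumes f: "f \<in> measurable M (count_space UNIV)" and "countable A" and "\<And>x. x \<in> space M \<Longrightarrow> f x \<in> A"
  shows "f \<in> measurable M (count_space A)"
  using assms measurable_sets[OF f] by (subst measurable_count_space_eq_countable) auto

text \<open>The length of the binary tail is logarithmic in \<open>k\<close>, so its square is bounded by a multiple of any positive
  power of \<open>k\<close>.\<close>

lemma summable_powr_times_length_square:
  assumes "\<alpha> > 1"
  shows "summable (\<lambda>k. real k powr (- \<alpha>) * (real (length (bin_tail k)) + 2)\<^sup>2)"
proof -
  \<comment> \<open>The exponent \<open>- \<alpha> + 2 * \<delta> = - (\<alpha> + 1) / 2\<close> is still below \<open>- 1\<close>.\<close>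
  define \<delta> where "\<delta> = (\<alpha> - 1) / 4"
  define t where "t = \<delta> * ln 2"
  have \<delta>: "\<delta> > 0" using assms by (simp add: \<delta>_def)
  then have t: "t > 0" by (simp add: t_def)
  have le: "(real (length (bin_tail k)) + 2)\<^sup>2 \<le> (2 + 1 / t)\<^sup>2 * real k powr (2 * \<delta>)" if k: "k \<ge> 1" for k
  proof -
    define l where "l = real (length (bin_tail k))"
    have "1 + t * l \<le> exp (t * l)" by (rule exp_ge_add_one_self)
    moreover have "0 \<le> t * l" using t by (simp add: l_def)
    moreover define e where "e = exp (t * l)"
    ultimately have 1: "1 \<le> e" "t * l \<le> e" by linarith+
    then have "l \<le> 1 / t * e" using t by (simp add: field_simps)
    then have "l + 2 \<le> (2 + 1 / t) * e" using 1(1) by (simp add: distrib_right)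
    also have "e = (2 ^ length (bin_tail k)) powr \<delta>"
      by (simp add: e_def powr_def t_def l_def ln_realpow mult_ac)
    also have "\<dots> \<le> real k powr \<delta>"
      using power_length_bin_tail_le[OF k] \<delta> of_nat_mono[where 'a = real]
      by (intro powr_mono2) fastforce+
    finally have "l + 2 \<le> (2 + 1 / t) * real k powr \<delta>" using t by (simp add: mult_left_mono)
    then have "(l + 2)\<^sup>2 \<le> ((2 + 1 / t) * real k powr \<delta>)\<^sup>2"
      by (rule power_mono) (simp add: l_def)
    also have "\<dots> = (2 + 1 / t)\<^sup>2 * real k powr (2 * \<delta>)"
      using k by (simp add: power_mult_distrib power2_eq_square flip: powr_add)
    finally show ?thesis by (simp add: l_def)
  qed
  have "summable (\<lambda>k. (2 + 1 / t)\<^sup>2 * real k powr (- \<alpha> + 2 * \<delta>))"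
    by (intro summable_mult, subst summable_real_powr_iff) (use assms in \<open>simp add: \<delta>_def field_simps\<close>)
  then show ?thesis
  proof (rule summable_comparison_test')
    fix k :: nat
    assume "k \<ge> 1"
    have "real k powr (- \<alpha>) * (real (length (bin_tail k)) + 2)\<^sup>2
        \<le> real k powr (- \<alpha>) * ((2 + 1 / t)\<^sup>2 * real k powr (2 * \<delta>))"
      by (intro mult_left_mono le \<open>k \<ge> 1\<close>) simp
    also have "\<dots> = (2 + 1 / t)\<^sup>2 * real k powr (- \<alpha> + 2 * \<delta>)"
      unfolding powr_add by (simp add: mult_ac)
    finally show "norm (real k powr (- \<alpha>) * (real (length (bin_tail k)) + 2)\<^sup>2) \<le>
        (2 + 1 / t)\<^sup>2 * real k powr (- \<alpha> + 2 * \<delta>)" by simp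
  qed
qed

locale hidden_bits =
  fixes \<alpha> :: real and P :: "'w measure" and K :: "int \<Rightarrow> 'w \<Rightarrow> nat" and Z :: "nat \<Rightarrow> 'w \<Rightarrow> nat"
  assumes \<alpha>: "\<alpha> > 1" and prob_P: "prob_space P"
    and indep: "prob_space.indep_vars P
          (case_sum (\<lambda>_. count_space {1..}) (\<lambda>_. count_space {0, 1}))
          (case_sum K Z) (UNIV <+> {1..})"
    and K_dist: "\<And>i k. k \<ge> 1 \<Longrightarrow> \<P>(\<omega> in P. K i \<omega> = k) = real k powr (- \<alpha>) / zeta_sum \<alpha>"
    and Z_dist: "\<And>k z. k \<ge> 1 \<Longrightarrow> z \<in> {0, 1} \<Longrightarrow> \<P>(\<omega> in P. Z k \<omega> = z) = 1 / 2"
begin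

sublocale prob_space P by (fact prob_P)

abbreviation val :: "int + nat \<Rightarrow> nat measure" where
  "val \<equiv> case_sum (\<lambda>_. count_space {1..}) (\<lambda>_. count_space {0, 1})"

abbreviation V :: "int + nat \<Rightarrow> 'w \<Rightarrow> nat" where "V \<equiv> case_sum K Z"

abbreviation I :: "(int + nat) set" where "I \<equiv> UNIV <+> {1..}"

lemma V_measurable: "j \<in> I \<Longrightarrow> V j \<in> measurable P (val j)"
  using indep unfolding indep_vars_def by blast

lemma K_measurable: "K i \<in> measurable P (count_space {1..})"
  using V_measurable[OF InlI[OF UNIV_I], of i] by simp

lemma K_ge_1: "\<omega> \<in> space P \<Longrightarrow> K i \<omega> \<ge> 1"
  using measurable_space[OF K_measurable] by simp

lemma K_measurable' [measurable]: "K i \<in> measurable P (count_space UNIV)"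
  using K_measurable by (rule measurable_compose) simp

lemma Z_measurable: "k \<ge> 1 \<Longrightarrow> Z k \<in> measurable P (count_space {0, 1})"
  using V_measurable[OF InrI, of k] by simp

lemma Z_in: "\<omega> \<in> space P \<Longrightarrow> k \<ge> 1 \<Longrightarrow> Z k \<omega> \<in> {0, 1}"
  using measurable_space[OF Z_measurable] by simp

lemma zeta_sums: "(\<lambda>k. real k powr (- \<alpha>)) sums zeta_sum \<alpha>"
proof -
  have "summable (\<lambda>k. real k powr (- \<alpha>))" using \<alpha> by (subst summable_real_powr_iff) simp
  then have "summable (\<lambda>k. real (Suc k) powr (- \<alpha>))" by (subst summable_Suc_iff)
  then have "(\<lambda>k. real (Suc k) powr (- \<alpha>)) sums zeta_sum \<alpha>"
    unfolding zeta_sum_def by (rule summable_sums)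
  then show ?thesis by (subst (asm) sums_Suc_iff) simp
qed

lemma zeta_pos: "zeta_sum \<alpha> > 0"
proof -
  have "sum (\<lambda>k. real k powr (- \<alpha>)) {..<2} \<le> zeta_sum \<alpha>"
    using zeta_sums by (intro sum_le_suminf[THEN order.trans]) (auto simp: sums_iff)
  then show ?thesis by (simp add: numeral_2_eq_2)
qed

definition \<kappa> :: "nat pmf" where "\<kappa> = embed_pmf (\<lambda>k. real k powr (- \<alpha>) / zeta_sum \<alpha>)"

lemma pmf_\<kappa>: "pmf \<kappa> k = real k powr (- \<alpha>) / zeta_sum \<alpha>"
  unfolding \<kappa>_def
proof (rule pmf_embed_pmf)
  show "0 \<le> real k powr (- \<alpha>) / zeta_sum \<alpha>" for k using zeta_pos by simp
  have "(\<lambda>k. real k powr (- \<alpha>) / zeta_sum \<alpha>) sums (zeta_sum \<alpha> / zeta_sum \<alpha>)"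
    by (intro sums_divide zeta_sums)
  then have "(\<lambda>k. real k powr (- \<alpha>) / zeta_sum \<alpha>) sums 1" using zeta_pos by simp
  then have "(\<Sum>k. ennreal (real k powr (- \<alpha>) / zeta_sum \<alpha>)) = ennreal 1"
    using zeta_pos by (intro suminf_ennreal_eq) auto
  then show "(\<integral>\<^sup>+k. ennreal (real k powr (- \<alpha>) / zeta_sum \<alpha>) \<partial>count_space UNIV) = 1"
    by (simp add: nn_integral_count_space_nat)
qed

sublocale zipf \<alpha> "zeta_sum \<alpha>" \<kappa>
  by unfold_locales (use \<alpha> zeta_pos pmf_\<kappa> in auto)

lemma prob_K: "prob {\<omega> \<in> space P. K i \<omega> = k} = pmf \<kappa> k"
proof (cases "k \<ge> 1")
  case True
  then show ?thesis using K_dist by (simp add: pmf_\<kappa>)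
next
  case False
  then have "{\<omega> \<in> space P. K i \<omega> = k} = {}" using K_ge_1[of _ i] by auto
  then have "prob {\<omega> \<in> space P. K i \<omega> = k} = 0" by (metis measure_empty)
  then show ?thesis using False by (simp add: pmf_\<kappa>)
qed

lemma distr_K: "distr P (count_space UNIV) (K i) = measure_pmf \<kappa>"
proof (rule measure_eqI_countable[where A = UNIV])
  fix k
  have "emeasure (distr P (count_space UNIV) (K i)) {k} = emeasure P (K i -` {k} \<inter> space P)"
    by (simp add: emeasure_distr)
  also have "K i -` {k} \<inter> space P = {\<omega> \<in> space P. K i \<omega> = k}" by auto
  also have "emeasure P \<dots> = emeasure (measure_pmf \<kappa>) {k}"
    using prob_K by (simp add: emeasure_eq_measure emeasure_pmf_single)
  finally show "emeasure (distr P (count_space UNIV) (K i)) {k} = emeasure (measure_pmf \<kappa>) {k}" .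
qed simp_all

definition word_length :: "nat \<Rightarrow> real" where
  "word_length k = real (length (bin_tail k)) + 2"

lemma length_code: "real (length (code (k, z))) = word_length k"
  by (simp add: code_def word_length_def)

lemma integrable_\<kappa>_square: "integrable (measure_pmf \<kappa>) (\<lambda>k. (word_length k)\<^sup>2)"
proof -
  have "summable (\<lambda>k. pmf \<kappa> k * (word_length k)\<^sup>2)"
    using summable_divide[OF summable_powr_times_length_square[OF \<alpha>], of "zeta_sum \<alpha>"]
    by (simp add: pmf_\<kappa> word_length_def)
  then show ?thesis
    unfolding measure_pmf_eq_density
    by (subst integrable_density) (auto simp: integrable_count_space_nat_iff)
qed

lemma integrable_word_length_square: "integrable P (\<lambda>\<omega>. (word_length (K i \<omega>))\<^sup>2)"
  using integrable_\<kappa>_square distr_K[of i] K_measurable'[of i] integrable_distr_eq[of "K i" P "count_space UNIV" "\<lambda>k. (word_length k)\<^sup>2"]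
  by simp

lemma word_length_measurable [measurable]: "(\<lambda>\<omega>. word_length (K i \<omega>)) \<in> borel_measurable P"
  by measurable

lemma word_length_ge: "2 \<le> word_length k" by (simp add: word_length_def)

lemma integrable_word_length: "integrable P (\<lambda>\<omega>. word_length (K i \<omega>))"
proof (rule Bochner_Integration.integrable_bound[OF integrable_word_length_square])
  have "word_length k \<le> (word_length k)\<^sup>2" for k
    using word_length_ge[of k] by (simp add: power2_eq_square)
  then show "AE \<omega> in P. norm (word_length (K i \<omega>)) \<le> norm ((word_length (K i \<omega>))\<^sup>2)"
    using word_length_ge by (intro AE_I2) (smt (verit) real_norm_def)
qed simp

definition mean_length where "mean_length = measure_pmf.expectation \<kappa> word_length"

lemma expectation_K: "expectation (\<lambda>\<omega>. g (K i \<omega>)) = measure_pmf.expectation \<kappa> (g :: nat \<Rightarrow> real)"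
  unfolding distr_K[of i, symmetric] by (subst integral_distr) auto

lemma expectation_word_length: "expectation (\<lambda>\<omega>. word_length (K i \<omega>)) = mean_length"
  by (simp add: expectation_K mean_length_def)

text \<open>Indices and bits are independent as one family over a sum type; the value at \<open>Inr\<close> is a
  dummy, as the family is restricted to the indices.\<close>

lemma indep_K:
  assumes "\<And>i. g i \<in> measurable (count_space UNIV) borel"
  shows "indep_vars (\<lambda>_. borel) (\<lambda>j \<omega>. case j of Inl i \<Rightarrow> g i (K i \<omega>) | Inr _ \<Rightarrow> (0 :: real))
    (range Inl :: (int + nat) set)"
proof -
  have "indep_vars val V (range Inl)" by (rule indep_vars_subset[OF indep]) auto
  then have "indep_vars (\<lambda>_. borel) (\<lambda>j \<omega>. (case j of Inl i \<Rightarrow> g i | Inr _ \<Rightarrow> \<lambda>_. 0) (V j \<omega>)) (range Inl)"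
    by (rule indep_vars_compose2) (auto split: sum.split)
  moreover have "(\<lambda>j \<omega>. (case j of Inl i \<Rightarrow> g i | Inr _ \<Rightarrow> \<lambda>_. 0) (V j \<omega>)) =
     (\<lambda>j \<omega>. case j of Inl i \<Rightarrow> g i (K i \<omega>) | Inr _ \<Rightarrow> 0)"
    by (auto simp: fun_eq_iff split: sum.split)
  ultimately show ?thesis by simp
qed

lemma expectation_prod_K:
  assumes J: "finite J" and g: "\<And>i. i \<in> J \<Longrightarrow> integrable P (\<lambda>\<omega>. g i (K i \<omega>))"
  shows "expectation (\<lambda>\<omega>. \<Prod>i\<in>J. g i (K i \<omega>)) = (\<Prod>i\<in>J. expectation (\<lambda>\<omega>. g i (K i \<omega>)) :: real)"
    and "integrable P (\<lambda>\<omega>. \<Prod>i\<in>J. g i (K i \<omega>))"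
proof -
  let ?X = "\<lambda>(j :: int + nat) \<omega>. case j of Inl i \<Rightarrow> g i (K i \<omega>) | Inr _ \<Rightarrow> (0 :: real)"
  have ind: "indep_vars (\<lambda>_. borel) ?X (Inl ` J)"
    by (rule indep_vars_subset[OF indep_K]) auto
  have int: "integrable P (?X j)" if "j \<in> Inl ` J" for j using that g by auto
  have "(\<Prod>j\<in>Inl ` J. ?X j \<omega>) = (\<Prod>i\<in>J. g i (K i \<omega>))" for \<omega>
    by (subst prod.reindex) auto
  moreover have "(\<Prod>j\<in>Inl ` J. expectation (?X j)) = (\<Prod>i\<in>J. expectation (\<lambda>\<omega>. g i (K i \<omega>)))"
    by (subst prod.reindex) auto
  ultimately show "expectation (\<lambda>\<omega>. \<Prod>i\<in>J. g i (K i \<omega>)) = (\<Prod>i\<in>J. expectation (\<lambda>\<omega>. g i (K i \<omega>)))"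
    "integrable P (\<lambda>\<omega>. \<Prod>i\<in>J. g i (K i \<omega>))"
    using indep_vars_lebesgue_integral[OF finite_imageI[OF J] ind int]
      indep_vars_integrable[OF finite_imageI[OF J] ind int] by auto
qed

definition var_length where
  "var_length = measure_pmf.expectation \<kappa> (\<lambda>k. (word_length k - mean_length)\<^sup>2)"

definition total_length where
  "total_length m \<omega> = (\<Sum>r<m. word_length (K (int r + 1) \<omega>))"

lemma total_length_measurable [measurable]: "total_length m \<in> borel_measurable P"
  unfolding total_length_def by measurable

text \<open>The variance of the total length: the mixed terms vanish by independence.\<close>

lemma expectation_total_length_dev:
  shows "integrable P (\<lambda>\<omega>. (total_length m \<omega> - real m * mean_length)\<^sup>2)"
    and "expectation (\<lambda>\<omega>. (total_length m \<omega> - real m * mean_length)\<^sup>2) = real m * var_length"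
proof -
  define \<xi> where "\<xi> r \<omega> = word_length (K (int r + 1) \<omega>) - mean_length" for r :: nat and \<omega>
  have int: "integrable P (\<lambda>\<omega>. word_length (K i \<omega>) - mean_length)" for i
    using integrable_word_length by simp
  have prod: "expectation (\<lambda>\<omega>. \<xi> r \<omega> * \<xi> s \<omega>) = (if r = s then var_length else 0) \<and>
      integrable P (\<lambda>\<omega>. \<xi> r \<omega> * \<xi> s \<omega>)" for r s
  proof (cases "r = s")
    case True
    have "integrable P (\<lambda>\<omega>. (word_length (K (int r + 1) \<omega>) - mean_length)\<^sup>2)"
      unfolding power2_diff
      using integrable_word_length_square[of "int r + 1"] integrable_word_length[of "int r + 1"]
      by (intro Bochner_Integration.integrable_add Bochner_Integration.integrable_diff) auto
    then show ?thesis
      using True expectation_K[of "\<lambda>k. (word_length k - mean_length)\<^sup>2" "int r + 1"]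
      by (simp add: \<xi>_def power2_eq_square var_length_def)
  next
    case False
    have "expectation (\<lambda>\<omega>. word_length (K i \<omega>) - mean_length) = 0" for i
      using integrable_word_length[of i] by (simp add: expectation_word_length prob_space)
    then show ?thesis
      using False expectation_prod_K[of "{int r + 1, int s + 1}" "\<lambda>i k. word_length k - mean_length", OF _ int]
      by (simp add: \<xi>_def)
  qed
  have dev: "total_length m \<omega> - real m * mean_length = (\<Sum>r<m. \<xi> r \<omega>)" for \<omega>
    by (simp add: total_length_def \<xi>_def sum_subtractf)
  have sq: "(total_length m \<omega> - real m * mean_length)\<^sup>2 = (\<Sum>r<m. \<Sum>s<m. \<xi> r \<omega> * \<xi> s \<omega>)" for \<omega>
    unfolding dev power2_eq_square sum_product ..
  show "integrable P (\<lambda>\<omega>. (total_length m \<omega> - real m * mean_length)\<^sup>2)"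
    unfolding sq using prod by auto
  show "expectation (\<lambda>\<omega>. (total_length m \<omega> - real m * mean_length)\<^sup>2) = real m * var_length"
    unfolding sq using prod by (simp add: Bochner_Integration.integral_sum sum.delta)
qed

lemma var_length_nonneg: "0 \<le> var_length"
  unfolding var_length_def by (intro integral_nonneg_AE) simp

text \<open>The inequality \<open>\<bar>d\<bar> \<le> d\<^sup>2 / s + s\<close> with \<open>s = sqrt m\<close> reduces the first moment of the deviation to the
  second.\<close>

lemma weak_law_L1:
  "(\<lambda>m. expectation (\<lambda>\<omega>. \<bar>total_length m \<omega> - real m * mean_length\<bar>) / real m) \<longlonglongrightarrow> 0"
proof (rule Lim_null_comparison)
  show "\<forall>\<^sub>F m in sequentially. norm (expectation (\<lambda>\<omega>. \<bar>total_length m \<omega> - real m * mean_length\<bar>) / real m)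
      \<le> (var_length + 1) / sqrt (real m)"
    using eventually_gt_at_top[of 0]
  proof eventually_elim
    case (elim m)
    define s where "s = sqrt (real m)"
    have s: "s > 0" "real m = s * s" using elim by (auto simp: s_def)
    let ?D = "\<lambda>\<omega>. total_length m \<omega> - real m * mean_length"
    have le: "\<bar>?D \<omega>\<bar> \<le> (?D \<omega>)\<^sup>2 / s + s" for \<omega>
    proof -
      have "0 \<le> (\<bar>?D \<omega>\<bar> - s)\<^sup>2" "0 \<le> \<bar>?D \<omega>\<bar> * s" using s by auto
      then have "\<bar>?D \<omega>\<bar> * s \<le> (?D \<omega>)\<^sup>2 + s * s" by (simp add: power2_eq_square algebra_simps)
      then show ?thesis using s by (simp add: field_simps)
    qed
    have int: "integrable P (\<lambda>\<omega>. (?D \<omega>)\<^sup>2 / s + s)"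
      using expectation_total_length_dev(1)[of m] by auto
    have "expectation (\<lambda>\<omega>. \<bar>?D \<omega>\<bar>) \<le> expectation (\<lambda>\<omega>. (?D \<omega>)\<^sup>2 / s + s)"
    proof (rule integral_mono[OF _ int])
      show "integrable P (\<lambda>\<omega>. \<bar>?D \<omega>\<bar>)"
        using integrable_word_length by (auto simp: total_length_def)
    qed (rule le)
    also have "\<dots> = real m * var_length / s + s"
      using expectation_total_length_dev[of m] by (simp add: prob_space)
    also have "\<dots> = real m * ((var_length + 1) / s)" using s by (simp add: field_simps)
    finally have "expectation (\<lambda>\<omega>. \<bar>?D \<omega>\<bar>) / real m \<le> (var_length + 1) / s"
      using elim by (simp add: field_simps)
    then show ?case
      by (simp add: s_def)
  qed
  show "(\<lambda>m. (var_length + 1) / sqrt (real m)) \<longlonglongrightarrow> 0"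
    by (intro real_tendsto_divide_at_top[OF tendsto_const] filterlim_compose[OF sqrt_at_top filterlim_real_sequentially])
qed

end

section \<open>Finite energy\<close>

lemma measurable_block:
  fixes A :: "'a::countable set"
  shows "(\<lambda>x. block x k l) \<in> measurable (seq_space A) (count_space UNIV)"
proof -
  have "(\<lambda>x. map x js) \<in> measurable (seq_space A) (count_space UNIV)" for js :: "int list"
  proof (induction js)
    case (Cons j js)
    then show ?case
      unfolding list.map by (intro measurable_count_space_op[where F = "(#)"] measurable_seq_component_UNIV)
  qed simp
  then show ?thesis by (simp add: block_def)
qed

lemma cylinder_sets:
  fixes A :: "'a::countable set"
  shows "cylinder A u \<in> sets (seq_space A)"
proof -
  have "cylinder A u = (\<lambda>x. block x 1 (int (length u))) -` {u} \<inter> space (seq_space A)"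
    by (auto simp: cylinder_def)
  then show ?thesis using measurable_sets[OF measurable_block] by simp
qed

lemma shift_pow_vimage_cylinder:
  "(shift ^^ i) -` cylinder A u \<inter> space (seq_space A) =
   (\<Union>q\<in>{q. set q \<subseteq> A \<and> length q = i}. cylinder A (q @ u))"
proof (intro equalityI subsetI)
  fix x assume "x \<in> (shift ^^ i) -` cylinder A u \<inter> space (seq_space A)"
  then have x: "x \<in> space (seq_space A)" "(shift ^^ i) x \<in> cylinder A u" by auto
  let ?q = "block x 1 (int i)"
  have "set ?q \<subseteq> A" using x(1) by (auto simp: block_def space_seq_space)
  moreover have "block x 1 (int (length (?q @ u))) = ?q @ u"
    using x(2) block_append[of 1 "int i + 1" "int i + int (length u)" x]
    by (simp add: cylinder_def block_shift_pow add_ac)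
  ultimately show "x \<in> (\<Union>q\<in>{q. set q \<subseteq> A \<and> length q = i}. cylinder A (q @ u))"
    using x(1) by (intro UN_I[of ?q]) (simp_all add: cylinder_def)
next
  fix x assume "x \<in> (\<Union>q\<in>{q. set q \<subseteq> A \<and> length q = i}. cylinder A (q @ u))"
  then obtain q where q: "length q = i" and x: "x \<in> cylinder A (q @ u)" by auto
  then have "block x 1 (int (length q)) @ block x (int (length q) + 1) (int (length q) + int (length u)) = q @ u"
    using block_append[of 1 "int (length q) + 1" "int (length q) + int (length u)" x]
    by (simp add: cylinder_def)
  then have "block x (int (length q) + 1) (int (length q) + int (length u)) = u"
    by (subst (asm) append_eq_append_conv) auto
  with x q show "x \<in> (shift ^^ i) -` cylinder A u \<inter> space (seq_space A)"
    by (auto simp: cylinder_def block_shift_pow shift_pow_space add_ac)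
qed

text \<open>Writing the preimage of a cylinder under a power of the shift as a disjoint union of cylinders
  transfers the bound to every term of the shift averages, hence to the limit; then
  \<open>v\<close> is appended letter by letter.\<close>

lemma finite_energyI:
  fixes A :: "'a::countable set"
  assumes "stationary_limit A M R"
    and A: "finite A" and c: "0 \<le> c" "c < 1"
    and le: "\<And>w s. set w \<subseteq> A \<Longrightarrow> s \<in> A \<Longrightarrow>
      measure M (cylinder A (w @ [s])) \<le> c * measure M (cylinder A w)"
  shows "finite_energy A R"
proof -
  interpret stationary_limit A M R by fact
  interpret M: prob_space M by (fact prob_M)
  have sum: "measure M ((shift ^^ i) -` cylinder A u \<inter> space M) =
    (\<Sum>q\<in>{q. set q \<subseteq> A \<and> length q = i}. measure M (cylinder A (q @ u)))" for i u
    unfolding space_M shift_pow_vimage_cylinder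
  proof (rule M.finite_measure_finite_Union)
    show "finite {q. set q \<subseteq> A \<and> length q = i}" by (rule finite_lists_length_eq[OF A])
    show "(\<lambda>q. cylinder A (q @ u)) ` {q. set q \<subseteq> A \<and> length q = i} \<subseteq> M.events"
      using cylinder_sets sets_M by auto
    show "disjoint_family_on (\<lambda>q. cylinder A (q @ u)) {q. set q \<subseteq> A \<and> length q = i}"
      by (auto simp: disjoint_family_on_def cylinder_def)
  qed
  have step: "measure R (cylinder A (u @ [s])) \<le> c * measure R (cylinder A u)"
    if u: "set u \<subseteq> A" and s: "s \<in> A" for u s
  proof (rule LIMSEQ_le[OF limit[OF cylinder_sets] tendsto_mult[OF tendsto_const limit[OF cylinder_sets]]])
    have "shift_average M (cylinder A (u @ [s])) n \<le> c * shift_average M (cylinder A u) n" for n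
    proof -
      have "measure M ((shift ^^ i) -` cylinder A (u @ [s]) \<inter> space M) \<le>
         c * measure M ((shift ^^ i) -` cylinder A u \<inter> space M)" for i
        unfolding sum sum_distrib_left using le[of "q @ u" s for q] u s
        by (intro sum_mono) auto
      then have "(\<Sum>i<n. measure M ((shift ^^ i) -` cylinder A (u @ [s]) \<inter> space M)) \<le>
         c * (\<Sum>i<n. measure M ((shift ^^ i) -` cylinder A u \<inter> space M))"
        unfolding sum_distrib_left by (intro sum_mono)
      then show ?thesis unfolding shift_average_def times_divide_eq_right
        by (rule divide_right_mono) simp
    qed
    then show "\<exists>N. \<forall>n\<ge>N. shift_average M (cylinder A (u @ [s])) n \<le> c * shift_average M (cylinder A u) n"
      by blast
  qed
  have "measure R (cylinder A (u @ v)) \<le> c ^ length v * measure R (cylinder A u)"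
    if "set u \<subseteq> A" "set v \<subseteq> A" for u v
    using that(2)
  proof (induction v rule: rev_induct)
    case Nil
    show ?case by simp
  next
    case (snoc s v)
    have "measure R (cylinder A (u @ v @ [s])) \<le> c * measure R (cylinder A (u @ v))"
      using step[of "u @ v" s] that(1) snoc.prems by simp
    also have "\<dots> \<le> c * (c ^ length v * measure R (cylinder A u))"
      using snoc c by (intro mult_left_mono) auto
    finally show ?case by (simp add: mult.assoc)
  qed
  then show ?thesis
    unfolding finite_energy_def using c(2) by (intro exI[of _ c] conjI exI[of _ 1]) (auto simp: in_lists_conv_set subset_iff)
qed

lemma Plus_iff [simp]: "Inl a \<in> A <+> B \<longleftrightarrow> a \<in> A" "Inr b \<in> A <+> B \<longleftrightarrow> b \<in> B"
  by auto

context hidden_bits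
begin

abbreviation alphabet :: "(nat \<times> nat) set" where "alphabet \<equiv> {1..} \<times> {0, 1}"

abbreviation X :: "int \<Rightarrow> 'w \<Rightarrow> nat \<times> nat" where "X \<equiv> \<lambda>i \<omega>. (K i \<omega>, Z (K i \<omega>) \<omega>)"

text \<open>The source sequence as a function of the joint family of indices, at \<open>Inl\<close>, and bits, at \<open>Inr\<close>.\<close>

definition symbols :: "(int + nat \<Rightarrow> nat) \<Rightarrow> int \<Rightarrow> nat \<times> nat" where
  "symbols v i = (v (Inl i), v (Inr (v (Inl i))))"

lemma component_measurable:
  assumes "j \<in> J" "J \<subseteq> I"
  shows "(\<lambda>v. v j) \<in> measurable (PiM J val) (count_space UNIV)"
proof -
  have "(\<lambda>v. v j) \<in> measurable (PiM J val) (val j)"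
    by (rule measurable_component_singleton[OF assms(1)])
  moreover have "(\<lambda>n. n) \<in> measurable (val j) (count_space UNIV)" by (cases j) simp_all
  ultimately show ?thesis by (rule measurable_compose)
qed

lemma symbols_measurable:
  assumes "Inl i \<in> J" "Inr ` {1..} \<subseteq> J" "J \<subseteq> I"
  shows "(\<lambda>v. symbols v i) \<in> measurable (PiM J val) (count_space UNIV)"
proof -
  have 1: "(\<lambda>v. v (Inl i)) \<in> measurable (PiM J val) (count_space {1..})"
    using measurable_component_singleton[OF assms(1), of val] by simp
  have "(\<lambda>v. v (Inr (v (Inl i)))) \<in> measurable (PiM J val) (count_space UNIV)"
    by (rule measurable_compose_countable'[OF _ 1, where f = "\<lambda>k v. v (Inr k)"])
       (rule component_measurable, use assms in auto)
  then show ?thesis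
    unfolding symbols_def
    by (rule measurable_count_space_op[where F = Pair, OF component_measurable[OF assms(1,3)]])
qed

lemma space_val: "v \<in> space (PiM J val) \<Longrightarrow> Inl i \<in> J \<Longrightarrow> v (Inl i) \<ge> 1"
  "v \<in> space (PiM J val) \<Longrightarrow> Inr k \<in> J \<Longrightarrow> v (Inr k) \<in> {0, 1}"
  by (auto simp: space_PiM PiE_def Pi_def split: sum.splits dest: bspec)

lemma symbols_measurable_seq: "symbols \<in> measurable (PiM I val) (seq_space alphabet)"
proof (rule measurable_seq_spaceI)
  fix i
  have 1: "(\<lambda>v. symbols v i) \<in> measurable (PiM I val) (count_space UNIV)"
    by (rule symbols_measurable) auto
  have 2: "symbols v i \<in> alphabet" if v: "v \<in> space (PiM I val)" for v
  proof -
    have 3: "v (Inl i) \<ge> 1" by (rule space_val(1)[OF v]) simp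
    then have "v (Inr (v (Inl i))) \<in> {0, 1}" by (intro space_val(2)[OF v] InrI) simp
    with 3 show ?thesis by (simp add: symbols_def)
  qed
  show "(\<lambda>v. symbols v i) \<in> measurable (PiM I val) (count_space alphabet)"
    by (rule measurable_count_space_into[OF 1 _ 2]) simp
qed

lemma V_restrict_measurable: "J \<subseteq> I \<Longrightarrow> (\<lambda>\<omega>. restrict (\<lambda>j. V j \<omega>) J) \<in> measurable P (PiM J val)"
  by (rule measurable_restrict) (use V_measurable in blast)

lemma symbols_V: "\<omega> \<in> space P \<Longrightarrow> symbols (restrict (\<lambda>j. V j \<omega>) I) = (\<lambda>i. X i \<omega>)"
  using K_ge_1 by (auto simp: symbols_def fun_eq_iff)

lemma X_measurable: "(\<lambda>\<omega> i. X i \<omega>) \<in> measurable P (seq_space alphabet)"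
  using measurable_compose[OF V_restrict_measurable[OF subset_refl] symbols_measurable_seq]
  by (subst measurable_cong[OF symbols_V[symmetric]])

definition \<mu> :: "(int \<Rightarrow> nat \<times> nat) measure" where
  "\<mu> = distr P (seq_space alphabet) (\<lambda>\<omega> i. X i \<omega>)"

text \<open>Shifting the source amounts to translating the indices while keeping the bits. The joint family
  has a product law, and this reindexing exchanges only coordinates with equal laws.\<close>

lemma stationary_\<mu>: "distr \<mu> \<mu> shift = \<mu>"
proof -
  define N where "N j = distr P (val j) (V j)" for j
  define L where "L = PiM I N"
  define h :: "int + nat \<Rightarrow> int + nat" where "h = map_sum (\<lambda>i. i + 1) id"
  define \<tau> where "\<tau> v = (\<lambda>j\<in>I. v (h j))" for v :: "int + nat \<Rightarrow> nat"
  have hI: "h j \<in> I" if "j \<in> I" for j using that by (auto simp: h_def)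
  have sets_L: "sets L = sets (PiM I val)"
    unfolding L_def by (rule sets_PiM_cong) (simp_all add: N_def)
  have law: "distr P (PiM I val) (\<lambda>\<omega>. restrict (\<lambda>j. V j \<omega>) I) = L"
    using indep_vars_iff_distr_eq_PiM'[of I V val] V_measurable indep unfolding L_def N_def by blast
  have N_shift: "N (h j) = N j" if "j \<in> I" for j
  proof (cases j)
    case (Inl i)
    have "distr P (count_space {1..}) (K (i + 1)) = distr P (count_space {1..}) (K i)"
    proof (rule measure_eqI_countable[where A = "{1..}"])
      fix k :: nat assume "k \<in> {1..}"
      have "emeasure (distr P (count_space {1..}) (K i)) {k} = ennreal (pmf \<kappa> k)" for i
      proof -
        have "emeasure (distr P (count_space {1..}) (K i)) {k} = emeasure P (K i -` {k} \<inter> space P)"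
          using \<open>k \<in> {1..}\<close> by (subst emeasure_distr[OF K_measurable]) auto
        also have "K i -` {k} \<inter> space P = {\<omega> \<in> space P. K i \<omega> = k}" by auto
        finally show ?thesis by (simp add: emeasure_eq_measure prob_K)
      qed
      then show "emeasure (distr P (count_space {1..}) (K (i + 1))) {k} =
        emeasure (distr P (count_space {1..}) (K i)) {k}" by simp
    qed simp_all
    then show ?thesis by (simp add: N_def h_def Inl)
  next
    case (Inr k)
    then show ?thesis by (simp add: h_def)
  qed
  have "distr L L \<tau> = L"
  proof -
    have "distr (PiM I N) (PiM I (\<lambda>j. N (h j))) (\<lambda>v. \<lambda>j\<in>I. v (h j)) = PiM I (\<lambda>j. N (h j))"
    proof (rule distr_PiM_reindex)
      show "prob_space (N j)" if "j \<in> I" for j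
        unfolding N_def by (rule prob_space_distr) (rule V_measurable[OF that])
      show "inj_on h I" by (auto simp: inj_on_def h_def)
      show "h \<in> I \<rightarrow> I" using hI by auto
    qed
    moreover have "PiM I (\<lambda>j. N (h j)) = PiM I N"
      by (rule PiM_cong) (simp_all add: N_shift)
    ultimately show ?thesis by (simp add: L_def \<tau>_def[abs_def])
  qed
  have \<tau>_meas: "\<tau> \<in> measurable L L"
    unfolding L_def \<tau>_def[abs_def]
  proof (rule measurable_restrict)
    fix j assume j: "j \<in> I"
    have "(\<lambda>v. v (h j)) \<in> measurable (PiM I N) (N (h j))"
      by (rule measurable_component_singleton) (rule hI[OF j])
    then show "(\<lambda>v. v (h j)) \<in> measurable (PiM I N) (N j)" by (simp add: N_shift[OF j])
  qed
  have symbols_L: "symbols \<in> measurable L (seq_space alphabet)"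
    using symbols_measurable_seq by (simp add: measurable_cong_sets[OF sets_L refl])
  have \<mu>: "\<mu> = distr L (seq_space alphabet) symbols"
  proof -
    have "distr L (seq_space alphabet) symbols =
       distr P (seq_space alphabet) (symbols \<circ> (\<lambda>\<omega>. restrict (\<lambda>j. V j \<omega>) I))"
      unfolding law[symmetric]
      by (rule distr_distr[OF symbols_measurable_seq V_restrict_measurable[OF subset_refl]])
    also have "\<dots> = \<mu>"
      unfolding \<mu>_def by (rule distr_cong[OF refl refl]) (simp only: comp_apply symbols_V)
    finally show ?thesis by simp
  qed
  have "distr \<mu> \<mu> shift = distr \<mu> (seq_space alphabet) shift"
    by (rule distr_cong) (simp_all add: \<mu>_def)
  also have "\<dots> = distr L (seq_space alphabet) (shift \<circ> symbols)"
    unfolding \<mu> by (rule distr_distr[OF measurable_shift symbols_L])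
  also have "\<dots> = distr L (seq_space alphabet) (symbols \<circ> \<tau>)"
  proof (rule distr_cong)
    fix v assume "v \<in> space L"
    then have v: "v \<in> space (PiM I val)" using sets_eq_imp_space_eq[OF sets_L] by simp
    show "(shift \<circ> symbols) v = (symbols \<circ> \<tau>) v"
      using space_val(1)[OF v] by (auto simp: fun_eq_iff shift_def symbols_def \<tau>_def h_def)
  qed simp_all
  also have "\<dots> = distr (distr L L \<tau>) (seq_space alphabet) symbols"
    by (rule distr_distr[OF symbols_L \<tau>_meas, symmetric])
  also have "\<dots> = \<mu>" by (simp add: \<open>distr L L \<tau> = L\<close> \<mu>)
  finally show ?thesis .
qed

lemma integral_\<mu>:
  fixes g :: "(int \<Rightarrow> nat \<times> nat) \<Rightarrow> real"
  assumes "g \<in> borel_measurable (seq_space alphabet)"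
  shows "(\<integral>x. g x \<partial>\<mu>) = expectation (\<lambda>\<omega>. g (\<lambda>i. X i \<omega>))"
  unfolding \<mu>_def by (rule integral_distr[OF X_measurable assms])

lemma length_code_measurable:
  "(\<lambda>x. real (length (code (x i)))) \<in> borel_measurable (seq_space alphabet)"
  by (rule measurable_compose[OF measurable_seq_component]) simp

sublocale coding: stationary_coding alphabet "{0, 1, 2 :: nat}" \<mu> code
proof (rule stationary_coding.intro)
  show "prob_space \<mu>" unfolding \<mu>_def by (rule prob_space_distr) (rule X_measurable)
  show "sets \<mu> = sets (seq_space alphabet)" by (simp add: \<mu>_def)
  show "integrable \<mu> (\<lambda>x. real (length (code (x 1))))"
    unfolding \<mu>_def integrable_distr_eq[OF X_measurable length_code_measurable]
    using integrable_word_length by (simp add: length_code)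
  show "set (code a) \<subseteq> {0, 1, 2}" if "a \<in> alphabet" for a
    using set_code that by (cases a) auto
qed (auto simp: stationary_\<mu> code_nonempty)

lemma coding_L: "coding.L = mean_length"
  unfolding coding.L_def integral_\<mu>[OF length_code_measurable]
  by (simp add: length_code expectation_word_length)

lemma coding_S: "real (coding.S m (\<lambda>i. X i \<omega>)) = total_length m \<omega>"
  by (simp add: coding.S_def total_length_def length_code)

lemma coding_law_of_large_numbers:
  "(\<lambda>m. (\<integral>x. \<bar>real (coding.S m x) - real m * coding.L\<bar> \<partial>\<mu>) / real m) \<longlonglongrightarrow> 0"
proof -
  have "(\<integral>x. \<bar>real (coding.S m x) - real m * coding.L\<bar> \<partial>\<mu>)
      = expectation (\<lambda>\<omega>. \<bar>total_length m \<omega> - real m * mean_length\<bar>)" for m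
  proof (subst integral_\<mu>)
    show "(\<lambda>x. \<bar>real (coding.S m x) - real m * coding.L\<bar>) \<in> borel_measurable (seq_space alphabet)"
      using coding.S_M[of m] by (simp add: measurable_cong_sets[OF coding.sets_M refl])
  qed (simp add: coding_S coding_L)
  then show ?thesis using weak_law_L1 by simp
qed

abbreviation Y :: "'w \<Rightarrow> int \<Rightarrow> nat" where "Y \<omega> \<equiv> concat_two_sided code (\<lambda>i. X i \<omega>)"

definition \<nu> :: "(int \<Rightarrow> nat) measure" where
  "\<nu> = distr \<mu> (seq_space {0, 1, 2}) (concat_two_sided code)"

definition \<rho> :: "(int \<Rightarrow> nat) measure" where "\<rho> = coding.mean_law"

sublocale limit: stationary_limit "{0, 1, 2 :: nat}" \<nu> \<rho>
  unfolding \<nu>_def \<rho>_def by (rule coding.mean_law_stationary_limit[OF coding_law_of_large_numbers])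

lemma Y_measurable: "Y \<in> measurable P (seq_space {0, 1, 2})"
  using measurable_compose[OF X_measurable, of "concat_two_sided code"] coding.y_M
  by (simp add: measurable_cong_sets[OF coding.sets_M refl])

lemma \<nu>_eq: "\<nu> = distr P (seq_space {0, 1, 2}) Y"
  unfolding \<nu>_def \<mu>_def
  using coding.y_M X_measurable
  by (subst distr_distr) (simp_all add: measurable_cong_sets[OF coding.sets_M refl] comp_def)

lemma measure_\<nu>:
  "B \<in> sets (seq_space {0, 1, 2}) \<Longrightarrow> measure \<nu> B = prob {\<omega> \<in> space P. Y \<omega> \<in> B}"
  unfolding \<nu>_eq by (subst measure_distr[OF Y_measurable]) (auto intro!: arg_cong[where f = prob])

lemma bit_sequence_X: "\<omega> \<in> space P \<Longrightarrow> bit_sequence (\<lambda>i. K i \<omega>) (\<lambda>k. Z k \<omega>)"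
  using K_ge_1 Z_in by unfold_locales auto

subsection \<open>Resampling one index\<close>

text \<open>The index \<open>K j\<close> is independent of all other indices and bits, so it can be replaced by a fresh random
  variable with law \<open>\<kappa>\<close>. The proof sums over the countably many values of \<open>K j\<close>.\<close>

lemma emeasure_resample:
  fixes j :: int and S :: "nat \<Rightarrow> (int + nat \<Rightarrow> nat) set"
  defines "J \<equiv> I - {Inl j}"
  defines "W \<equiv> (\<lambda>\<omega>. restrict (\<lambda>i. V i \<omega>) J)"
  assumes S: "\<And>k. S k \<in> sets (PiM J val)"
  shows "emeasure P {\<omega> \<in> space P. W \<omega> \<in> S (K j \<omega>)} = (\<integral>\<^sup>+\<omega>. emeasure \<kappa> {k. W \<omega> \<in> S k} \<partial>P)"
    and "(\<lambda>\<omega>. emeasure \<kappa> {k. W \<omega> \<in> S k}) \<in> borel_measurable P"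
proof -
  have W [measurable]: "W \<in> measurable P (PiM J val)"
    unfolding W_def by (rule V_restrict_measurable) (auto simp: J_def)
  note S [measurable]
  have \<kappa>_sum: "emeasure \<kappa> {k. W \<omega> \<in> S k} = (\<Sum>k. ennreal (pmf \<kappa> k) * indicator (S k) (W \<omega>))" for \<omega>
  proof -
    have "emeasure \<kappa> {k. W \<omega> \<in> S k} = (\<integral>\<^sup>+k. ennreal (pmf \<kappa> k) * indicator {k. W \<omega> \<in> S k} k \<partial>count_space UNIV)"
      by (simp add: nn_integral_pmf[symmetric] nn_integral_count_space_indicator)
    then show ?thesis by (simp add: nn_integral_count_space_nat indicator_def)
  qed
  show "(\<lambda>\<omega>. emeasure \<kappa> {k. W \<omega> \<in> S k}) \<in> borel_measurable P"
    unfolding \<kappa>_sum by measurable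
  have prod: "emeasure P {\<omega> \<in> space P. W \<omega> \<in> S k \<and> K j \<omega> = k} = ennreal (pmf \<kappa> k) * emeasure P {\<omega> \<in> space P. W \<omega> \<in> S k}" for k
  proof (cases "k \<ge> 1")
    case True
    let ?Kj = "\<lambda>\<omega>. restrict (\<lambda>i. V i \<omega>) {Inl j}"
    let ?E = "{v \<in> space (PiM {Inl j} val). v (Inl j) = k}"
    have ind: "indep_var (PiM J val) W (PiM {Inl j} val) ?Kj"
      unfolding W_def by (rule indep_var_restrict[OF indep]) (auto simp: J_def)
    have "(\<lambda>v. v (Inl j)) \<in> measurable (PiM {Inl j} val) (count_space UNIV)"
      by (rule component_measurable) auto
    then have E: "?E \<in> sets (PiM {Inl j} val)" by measurable
    have "prob ((\<lambda>\<omega>. (W \<omega>, ?Kj \<omega>)) -` (S k \<times> ?E) \<inter> space P) = prob (W -` S k \<inter> space P) * prob (?Kj -` ?E \<inter> space P)"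
      by (rule indep_varD[OF ind S E])
    moreover have sp: "?Kj \<omega> \<in> space (PiM {Inl j} val)" if "\<omega> \<in> space P" for \<omega>
      by (rule measurable_space[OF V_restrict_measurable that]) auto
    then have "(\<lambda>\<omega>. (W \<omega>, ?Kj \<omega>)) -` (S k \<times> ?E) \<inter> space P = {\<omega> \<in> space P. W \<omega> \<in> S k \<and> K j \<omega> = k}"
      by auto
    moreover have "?Kj -` ?E \<inter> space P = {\<omega> \<in> space P. K j \<omega> = k}" using sp by auto
    moreover have "W -` S k \<inter> space P = {\<omega> \<in> space P. W \<omega> \<in> S k}" by auto
    ultimately show ?thesis by (simp add: emeasure_eq_measure prob_K ennreal_mult' mult.commute)
  next
    case False
    then have "{\<omega> \<in> space P. W \<omega> \<in> S k \<and> K j \<omega> = k} = {}" using K_ge_1[of _ j] by auto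
    moreover have "pmf \<kappa> k = 0" using False by (simp add: pmf_\<kappa>)
    ultimately show ?thesis by (simp only: emeasure_empty) simp
  qed
  have "emeasure P {\<omega> \<in> space P. W \<omega> \<in> S (K j \<omega>)} = emeasure P (\<Union>k. {\<omega> \<in> space P. W \<omega> \<in> S k \<and> K j \<omega> = k})"
    by (rule arg_cong[where f = "emeasure P"]) auto
  also have "\<dots> = (\<Sum>k. emeasure P {\<omega> \<in> space P. W \<omega> \<in> S k \<and> K j \<omega> = k})"
    by (rule suminf_emeasure[symmetric]) (auto simp: disjoint_family_on_def)
  also have "\<dots> = (\<Sum>k. \<integral>\<^sup>+\<omega>. ennreal (pmf \<kappa> k) * indicator (S k) (W \<omega>) \<partial>P)"
  proof (rule suminf_cong)
    fix k
    have "emeasure P {\<omega> \<in> space P. W \<omega> \<in> S k} = (\<integral>\<^sup>+\<omega>. indicator {\<omega> \<in> space P. W \<omega> \<in> S k} \<omega> \<partial>P)" by simp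
    also have "\<dots> = (\<integral>\<^sup>+\<omega>. indicator (S k) (W \<omega>) \<partial>P)"
      by (rule nn_integral_cong) (auto simp: indicator_def)
    finally show "emeasure P {\<omega> \<in> space P. W \<omega> \<in> S k \<and> K j \<omega> = k} = (\<integral>\<^sup>+\<omega>. ennreal (pmf \<kappa> k) * indicator (S k) (W \<omega>) \<partial>P)"
      unfolding prod by (subst nn_integral_cmult) auto
  qed
  also have "\<dots> = (\<integral>\<^sup>+\<omega>. emeasure \<kappa> {k. W \<omega> \<in> S k} \<partial>P)"
    unfolding \<kappa>_sum by (rule nn_integral_suminf[symmetric]) measurable
  finally show "emeasure P {\<omega> \<in> space P. W \<omega> \<in> S (K j \<omega>)} = (\<integral>\<^sup>+\<omega>. emeasure \<kappa> {k. W \<omega> \<in> S k} \<partial>P)" .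
qed

definition ratio :: real where "ratio = 2 * 3 powr \<alpha> / (1 + 2 * 3 powr \<alpha>)"

lemma ratio: "0 \<le> ratio" "ratio < 1"
  by (auto simp: ratio_def add_pos_nonneg divide_less_eq_1)

text \<open>Up to its last letter 2 the string \<open>w\<close> is an event about the blocks before some position \<open>j\<close>; the rest \<open>p\<close>
  is a prefix of block \<open>j\<close>. All indices other than \<open>K j\<close>, and all bits, are kept fixed while \<open>K j\<close> is
  resampled, and for each choice of them the bound is \<open>compatible_snoc_le\<close>.\<close>

lemma measure_\<nu>_snoc_le:
  assumes s: "s \<in> {0, 1, 2}"
  shows "measure \<nu> (cylinder {0, 1, 2} (w @ [s])) \<le> ratio * measure \<nu> (cylinder {0, 1, 2} w)"
proof -
  obtain w' p where w: "w = w' @ p" "w' = [] \<or> last w' = 2" "2 \<notin> set p"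
    using ex_split_after_last_2 by blast
  define r where "r = count_list w' 2"
  define j where "j = int r + 1"
  define J where "J = I - {Inl j}"
  define W where "W \<omega> = restrict (\<lambda>i. V i \<omega>) J" for \<omega>
  define C where "C x = concat (map (\<lambda>i. code (x (int i))) [1..<Suc r])" for x
  define S where "S q k = {v \<in> space (PiM J val). C (symbols v) = w' \<and> k \<ge> 1 \<and> prefix q (code (k, v (Inr k)))}" for q k
  have J: "J \<subseteq> I" "Inr ` {1..} \<subseteq> J" by (auto simp: J_def)
  have C_meas: "(\<lambda>v. C (symbols v)) \<in> measurable (PiM J val) (count_space UNIV)"
  proof -
    have "(\<lambda>v. concat (map (\<lambda>i. code (symbols v (int i))) [1..<Suc m])) \<in> measurable (PiM J val) (count_space UNIV)"
      if "m \<le> r" for m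
      using that
    proof (induction m)
      case (Suc m)
      have "(\<lambda>v. code (symbols v (int (Suc m)))) \<in> measurable (PiM J val) (count_space UNIV)"
        by (rule measurable_compose[OF symbols_measurable]) (use J Suc.prems in \<open>auto simp: J_def j_def\<close>)
      with Suc have "(\<lambda>v. concat (map (\<lambda>i. code (symbols v (int i))) [1..<Suc m]) @ code (symbols v (int (Suc m))))
         \<in> measurable (PiM J val) (count_space UNIV)"
        by (intro measurable_count_space_op[where F = "(@)"]) auto
      moreover have "[1..<Suc (Suc m)] = [1..<Suc m] @ [Suc m]" by simp
      ultimately show ?case by (simp only: map_append concat_append list.map concat.simps append_Nil2)
    qed simp
    then show ?thesis unfolding C_def by blast
  qed
  have S_sets: "S q k \<in> sets (PiM J val)" for q k
  proof (cases "k \<ge> 1")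
    case True
    have bit: "(\<lambda>v. v (Inr k)) \<in> measurable (PiM J val) (count_space UNIV)"
      by (rule component_measurable) (use J True in auto)
    have "S q k = ((\<lambda>v. C (symbols v)) -` {w'} \<inter> space (PiM J val)) \<inter>
        ((\<lambda>v. v (Inr k)) -` {z. prefix q (code (k, z))} \<inter> space (PiM J val))"
      using True by (auto simp: S_def)
    then show ?thesis
      using measurable_sets[OF C_meas, of "{w'}"] measurable_sets[OF bit, of "{z. prefix q (code (k, z))}"]
      by (simp only: sets.Int sets_count_space Pow_UNIV UNIV_I)
  qed (simp add: S_def)
  have event: "prob {\<omega> \<in> space P. Y \<omega> \<in> cylinder {0, 1, 2} (w' @ q)} = prob {\<omega> \<in> space P. W \<omega> \<in> S q (K j \<omega>)}"
    if q: "2 \<notin> set (butlast q)" for q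
  proof (rule arg_cong[where f = prob], rule Collect_cong, rule conj_cong[OF refl])
    fix \<omega> assume \<omega>: "\<omega> \<in> space P"
    interpret bit_sequence "\<lambda>i. K i \<omega>" "\<lambda>k. Z k \<omega>" by (rule bit_sequence_X[OF \<omega>])
    have sp: "W \<omega> \<in> space (PiM J val)"
      using measurable_space[OF V_restrict_measurable[OF J(1)] \<omega>] by (simp add: W_def)
    have CW: "C (symbols (W \<omega>)) = C (\<lambda>i. X i \<omega>)"
      unfolding C_def using K_ge_1[OF \<omega>]
      by (intro arg_cong[where f = concat] map_cong refl) (auto simp: symbols_def W_def J_def j_def)
    have "Y \<omega> \<in> cylinder {0, 1, 2} (w' @ q) \<longleftrightarrow> block (Y \<omega>) 1 (int (length (w' @ q))) = w' @ q"
      using measurable_space[OF Y_measurable \<omega>] by (simp add: cylinder_def)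
    also have "\<dots> \<longleftrightarrow> C (\<lambda>i. X i \<omega>) = w' \<and> prefix q (code (X j \<omega>))"
      unfolding C_def j_def r_def by (rule prefix_iff[OF w(2) q])
    also have "\<dots> \<longleftrightarrow> W \<omega> \<in> S q (K j \<omega>)"
      using sp CW K_ge_1[OF \<omega>, of j] by (auto simp: S_def W_def J_def)
    finally show "Y \<omega> \<in> cylinder {0, 1, 2} (w' @ q) \<longleftrightarrow> W \<omega> \<in> S q (K j \<omega>)" .
  qed
  have le: "emeasure \<kappa> {k. W \<omega> \<in> S (p @ [s]) k} \<le> ennreal ratio * emeasure \<kappa> {k. W \<omega> \<in> S p k}" if \<omega>: "\<omega> \<in> space P" for \<omega>
  proof -
    let ?\<zeta> = "\<lambda>k. W \<omega> (Inr k)"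
    have sp: "W \<omega> \<in> space (PiM J val)"
      using measurable_space[OF V_restrict_measurable[OF J(1)] \<omega>] by (simp add: W_def)
    have \<zeta>: "?\<zeta> k \<in> {0, 1}" if "k \<ge> 1" for k by (rule space_val(2)[OF sp]) (use J that in auto)
    show ?thesis
    proof (cases "C (symbols (W \<omega>)) = w'")
      case True
      then have "{k. W \<omega> \<in> S q k} = compatible ?\<zeta> q" for q
        using sp compatible_def[of ?\<zeta> p q] \<zeta> w(3) by (auto simp: S_def)
      then show ?thesis
        using compatible_snoc_le[of ?\<zeta> p s, OF \<zeta> w(3) s] ratio(1)
        unfolding measure_pmf.emeasure_eq_measure ennreal_mult[OF ratio(1) measure_nonneg, symmetric] ratio_def[symmetric]
        by (simp only: ennreal_leI)
    next
      case False
      then show ?thesis by (simp add: S_def)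
    qed
  qed
  have "emeasure P {\<omega> \<in> space P. W \<omega> \<in> S (p @ [s]) (K j \<omega>)} = (\<integral>\<^sup>+\<omega>. emeasure \<kappa> {k. W \<omega> \<in> S (p @ [s]) k} \<partial>P)"
    using emeasure_resample(1)[of "S (p @ [s])" j] S_sets by (simp add: W_def J_def)
  also have "\<dots> \<le> (\<integral>\<^sup>+\<omega>. ennreal ratio * emeasure \<kappa> {k. W \<omega> \<in> S p k} \<partial>P)"
    by (rule nn_integral_mono) (rule le)
  also have "\<dots> = ennreal ratio * (\<integral>\<^sup>+\<omega>. emeasure \<kappa> {k. W \<omega> \<in> S p k} \<partial>P)"
    using emeasure_resample(2)[of "S p" j] S_sets by (intro nn_integral_cmult) (simp add: W_def J_def)
  also have "\<dots> = ennreal ratio * emeasure P {\<omega> \<in> space P. W \<omega> \<in> S p (K j \<omega>)}"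
    using emeasure_resample(1)[of "S p" j] S_sets by (simp add: W_def J_def)
  finally have "prob {\<omega> \<in> space P. W \<omega> \<in> S (p @ [s]) (K j \<omega>)} \<le> ratio * prob {\<omega> \<in> space P. W \<omega> \<in> S p (K j \<omega>)}"
    unfolding emeasure_eq_measure ennreal_mult[OF ratio(1) measure_nonneg, symmetric]
    by (subst (asm) ennreal_le_iff) (simp_all add: ratio(1))
  moreover have "2 \<notin> set (butlast p)" using w(3) by (auto dest: in_set_butlastD)
  ultimately show ?thesis
    unfolding w(1) append_assoc measure_\<nu>[OF cylinder_sets]
    using event[of "p @ [s]"] event[of p] w(3) by simp
qed

lemma finite_energy_\<rho>: "finite_energy {0, 1, 2} \<rho>"
  by (rule finite_energyI[OF limit.stationary_limit_axioms _ ratio measure_\<nu>_snoc_le]) auto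

end

section \<open>Recovering the bits\<close>

lemma measurable_occurs_in:
  fixes A :: "'a::countable set"
  shows "{x \<in> space (seq_space A). occurs_in u x} \<in> sets (seq_space A)"
proof -
  have "{x \<in> space (seq_space A). occurs_in u x} =
    (\<Union>i. (\<lambda>x. block x (i + 1) (i + int (length u))) -` {u} \<inter> space (seq_space A))"
    by (auto simp: occurs_in_def)
  also have "\<dots> \<in> sets (seq_space A)"
    by (intro sets.countable_UN') (auto intro!: measurable_sets[OF measurable_block])
  finally show ?thesis .
qed

lemma measurable_predictor_seq: "predictor_seq k \<in> measurable (seq_space A) (count_space UNIV)"
proof -
  have [measurable]: "Measurable.pred (seq_space A) (occurs_in u)" for u :: "nat list"
    using measurable_occurs_in[of A u] by (simp add: pred_def)
  show ?thesis unfolding predictor_seq_def predictor_def Let_def by measurable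
qed

lemma measurable_predictor_str:
  "(\<lambda>x. predictor_str k (block x a b)) \<in> measurable (seq_space A) (count_space UNIV)"
  by (rule measurable_compose[OF measurable_block]) simp

context hidden_bits
begin

lemma pmf_\<kappa>_pos: "k \<ge> 1 \<Longrightarrow> pmf \<kappa> k > 0"
  using zeta_pos by (simp add: pmf_\<kappa>)

lemma expectation_K_neq: "expectation (\<lambda>\<omega>. indicator (- {k}) (K i \<omega>)) = 1 - pmf \<kappa> k"
proof -
  have "expectation (\<lambda>\<omega>. indicator (- {k}) (K i \<omega>)) = measure_pmf.prob \<kappa> (- {k})"
    by (subst expectation_K) simp
  also have "\<dots> = 1 - pmf \<kappa> k"
    using measure_pmf.prob_compl[of "{k}" \<kappa>] by (simp add: Compl_eq_Diff_UNIV measure_pmf_single)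
  finally show ?thesis .
qed

lemma integrable_indicator_K: "integrable P (\<lambda>\<omega>. indicator A (K i \<omega>) :: real)"
proof (rule integrable_const_bound[where B = 1])
  show "(\<lambda>\<omega>. indicator A (K i \<omega>) :: real) \<in> borel_measurable P"
    by (rule measurable_compose[OF K_measurable']) simp
qed (simp add: indicator_def)

lemma AE_index_occurs:
  assumes k: "k \<ge> 1"
  shows "AE \<omega> in P. k \<in> range (\<lambda>i. K i \<omega>)"
proof -
  let ?N = "{\<omega> \<in> space P. \<forall>i. K i \<omega> \<noteq> k}"
  have N: "?N \<in> events" by measurable
  have le: "prob ?N \<le> (1 - pmf \<kappa> k) ^ m" for m
  proof -
    let ?g = "\<lambda>\<omega>. \<Prod>i\<in>{1..int m}. indicator (- {k}) (K i \<omega>) :: real"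
    have "prob ?N = expectation (indicator ?N)" using N by simp
    also have "\<dots> \<le> expectation ?g"
    proof (rule integral_mono)
      show "integrable P ?g" by (rule expectation_prod_K) (auto intro: integrable_indicator_K)
      show "indicator ?N \<omega> \<le> ?g \<omega>" for \<omega>
        by (cases "\<omega> \<in> ?N") (auto intro!: prod_nonneg)
    qed (use N in \<open>simp add: integrable_indicator_iff emeasure_eq_measure\<close>)
    also have "\<dots> = (1 - pmf \<kappa> k) ^ m"
      by (subst expectation_prod_K) (auto intro: integrable_indicator_K simp: expectation_K_neq)
    finally show ?thesis .
  qed
  have "(\<lambda>m. (1 - pmf \<kappa> k) ^ m) \<longlonglongrightarrow> 0"
    using pmf_\<kappa>_pos[OF k] pmf_le_1[of \<kappa> k] by (intro LIMSEQ_realpow_zero) auto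
  then have "prob ?N \<le> 0"
    using le by (intro LIMSEQ_le_const) auto
  then have "prob ?N = 0" by (simp add: measure_le_0_iff)
  then have "?N \<in> null_sets P" using N by (simp add: null_sets_def emeasure_eq_measure)
  then show ?thesis by (rule AE_I') auto
qed

lemma AE_predictor_Y:
  assumes k: "k \<ge> 1"
  shows "AE \<omega> in P. predictor_seq k (Y \<omega>) = Z k \<omega>"
proof -
  have "AE \<omega> in P. \<omega> \<in> space P" by simp
  with AE_index_occurs[OF k] show ?thesis
  proof eventually_elim
    case (elim \<omega>)
    interpret bit_sequence "\<lambda>i. K i \<omega>" "\<lambda>k. Z k \<omega>" by (rule bit_sequence_X[OF elim(2)])
    show ?case using predictor_seq_eq[OF k] elim(1) by simp
  qed
qed

lemma predictor_set_invariant: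
  "{y \<in> space (seq_space {0, 1, 2}). \<forall>j\<in>J. predictor_seq j y \<in> B j} \<in> shift_invariant_sets {0, 1, 2}"
  if "finite J" for J
proof -
  have "{y \<in> space (seq_space {0, 1, 2}). predictor_seq j y \<in> B j} \<in> sets (seq_space {0, 1, 2})" for j
    using measurable_sets[OF measurable_predictor_seq, of "B j" j "{0, 1, 2}"]
    by (simp add: vimage_def Int_def conj_commute)
  then have "{y \<in> space (seq_space {0, 1, 2}). \<forall>j\<in>J. predictor_seq j y \<in> B j} \<in> sets (seq_space {0, 1, 2})"
    by (intro sets.sets_Collect_finite_All that)
  then show ?thesis
    by (auto simp: shift_invariant_sets_def predictor_seq_shift shift_space)
qed

text \<open>The event is shift-invariant, so it may be evaluated under the law of the coded source, where the
  predictors almost surely are the bits.\<close>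

lemma measure_\<rho>_predictor:
  assumes J: "finite J" "J \<subseteq> {1..}"
  shows "measure \<rho> {y \<in> space (seq_space {0, 1, 2}). \<forall>j\<in>J. predictor_seq j y \<in> B j} =
    prob {\<omega> \<in> space P. \<forall>j\<in>J. Z j \<omega> \<in> B j}"
proof -
  let ?S = "{y \<in> space (seq_space {0, 1, 2}). \<forall>j\<in>J. predictor_seq j y \<in> B j}"
  have S: "?S \<in> sets (seq_space {0, 1, 2})"
    using predictor_set_invariant[OF J(1)] by (auto simp: shift_invariant_sets_def)
  have "measure \<rho> ?S = measure \<nu> ?S"
    by (rule limit.measure_invariant[OF predictor_set_invariant[OF J(1)]])
  also have "\<dots> = prob {\<omega> \<in> space P. Y \<omega> \<in> ?S}" by (rule measure_\<nu>[OF S])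
  also have "\<dots> = prob {\<omega> \<in> space P. \<forall>j\<in>J. Z j \<omega> \<in> B j}"
  proof (rule measure_eq_AE)
    have "AE \<omega> in P. \<forall>j\<in>J. predictor_seq j (Y \<omega>) = Z j \<omega>"
      using J AE_predictor_Y by (intro AE_finite_allI) auto
    moreover have "AE \<omega> in P. Y \<omega> \<in> space (seq_space {0, 1, 2})"
      using measurable_space[OF Y_measurable] by auto
    ultimately show "AE \<omega> in P. (\<omega> \<in> {\<omega> \<in> space P. Y \<omega> \<in> ?S}) = (\<omega> \<in> {\<omega> \<in> space P. \<forall>j\<in>J. Z j \<omega> \<in> B j})"
      by eventually_elim auto
    show "{\<omega> \<in> space P. Y \<omega> \<in> ?S} \<in> events"
      using measurable_sets[OF Y_measurable S] by (simp add: vimage_def Int_def conj_commute)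
    have "{\<omega> \<in> space P. Z j \<omega> \<in> B j} \<in> events" if "j \<in> J" for j
    proof -
      have "Z j -` (B j \<inter> {0, 1}) \<inter> space P \<in> events"
        by (rule measurable_sets[OF Z_measurable]) (use that J in auto)
      also have "Z j -` (B j \<inter> {0, 1}) \<inter> space P = {\<omega> \<in> space P. Z j \<omega> \<in> B j}"
        using Z_in[of _ j] that J by auto
      finally show ?thesis .
    qed
    then show "{\<omega> \<in> space P. \<forall>j\<in>J. Z j \<omega> \<in> B j} \<in> events"
      by (intro sets.sets_Collect_finite_All J)
  qed
  finally show ?thesis .
qed

lemma prob_Z_prod:
  assumes J: "finite J" "J \<subseteq> {1..}"
  shows "prob {\<omega> \<in> space P. \<forall>j\<in>J. Z j \<omega> \<in> B j} = (\<Prod>j\<in>J. prob {\<omega> \<in> space P. Z j \<omega> \<in> B j})"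
proof (cases "J = {}")
  case True
  then show ?thesis by (simp add: prob_space)
next
  case False
  define A where "A i = (case i of Inl _ \<Rightarrow> {} | Inr j \<Rightarrow> B j \<inter> {0, 1})" for i :: "int + nat"
  have "prob (\<Inter>i\<in>Inr ` J. V i -` A i \<inter> space P) = (\<Prod>i\<in>Inr ` J. prob (V i -` A i \<inter> space P))"
    by (rule indep_varsD[OF indep]) (use J False in \<open>auto simp: A_def\<close>)
  moreover have *: "V (Inr j) -` A (Inr j) \<inter> space P = {\<omega> \<in> space P. Z j \<omega> \<in> B j}" if "j \<in> J" for j
    using Z_in[of _ j] J that by (auto simp: A_def)
  then have "(\<Inter>i\<in>Inr ` J. V i -` A i \<inter> space P) = {\<omega> \<in> space P. \<forall>j\<in>J. Z j \<omega> \<in> B j}"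
    using False by (simp add: image_image) blast
  moreover have "(\<Prod>i\<in>Inr ` J. prob (V i -` A i \<inter> space P)) = (\<Prod>j\<in>J. prob {\<omega> \<in> space P. Z j \<omega> \<in> B j})"
    using * by (subst prod.reindex) (auto intro!: prod.cong)
  ultimately show ?thesis by simp
qed

subsection \<open>Prediction from a finite window\<close>

definition misses :: "nat \<Rightarrow> int \<Rightarrow> nat \<Rightarrow> (int \<Rightarrow> nat) set" where
  "misses k i n = {y \<in> space (seq_space {0, 1, 2}). predictor_str k (block y (i + 1) (i + int n)) \<noteq> predictor_seq k y}"

lemma misses_sets: "misses k i n \<in> sets (seq_space {0, 1, 2})"
proof -
  have "(\<lambda>y. predictor_str k (block y (i + 1) (i + int n)) \<noteq> predictor_seq k y)
      \<in> measurable (seq_space {0, 1, 2}) (count_space UNIV)"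
    by (rule measurable_count_space_op[where F = "(\<noteq>)", OF measurable_predictor_str measurable_predictor_seq])
  then show ?thesis unfolding misses_def by (simp add: pred_def)
qed

text \<open>The predictor on the full sequence is shift-invariant, so moving the window is a shift of the
  event.\<close>

lemma measure_misses_shift: "measure \<rho> (misses k i n) = measure \<rho> (misses k 0 n)"
proof -
  have step: "measure \<rho> (misses k (i + 1) n) = measure \<rho> (misses k i n)" for i
  proof -
    have shift: "shift \<in> measurable \<rho> \<rho>"
      by (subst measurable_cong_sets[OF limit.sets_R limit.sets_R]) (rule measurable_shift)
    have "measure \<rho> (misses k i n) = measure (distr \<rho> \<rho> shift) (misses k i n)"
      using limit.stationary by (simp add: stationary_def)
    also have "\<dots> = measure \<rho> (shift -` misses k i n \<inter> space \<rho>)"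
      by (rule measure_distr[OF shift]) (unfold limit.sets_R, rule misses_sets)
    also have "shift -` misses k i n \<inter> space \<rho> = misses k (i + 1) n"
    proof -
      have "block (shift y) (i + 1) (i + int n) = block y (i + 1 + 1) (i + 1 + int n)" for y :: "int \<Rightarrow> nat"
        using block_shift_pow[of 1 y "i + 1" "i + int n"] by (simp add: add_ac)
      then show ?thesis
        unfolding misses_def limit.space_R by (auto simp: shift_space predictor_seq_shift)
    qed
    finally show ?thesis by simp
  qed
  show ?thesis
  proof (induction i rule: int_induct[where k = 0])
    case (step2 i)
    then show ?case using step[of "i - 1"] by simp
  qed (simp_all add: step)
qed

lemma block_start_total_length:
  "real_of_int (block_start code (\<lambda>i. X i \<omega>) (int m + 1)) = 1 + total_length m \<omega>"
proof (induction m)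
  case 0
  show ?case by (simp add: block_start_1 total_length_def)
next
  case (Suc m)
  then show ?case
    using block_start_step[of code "\<lambda>i. X i \<omega>" "int m + 1"] length_code[of "K (int m + 1) \<omega>" "Z (K (int m + 1) \<omega>) \<omega>"]
    by (simp add: total_length_def add_ac)
qed

text \<open>If the first \<open>m\<close> blocks have at most \<open>n\<close> letters, then every window of \<open>n\<close> letters that starts inside
  block 1 contains the final 2 of block 1 and the blocks \<open>2, \<dots>, m\<close>. If one of these blocks has index
  \<open>k\<close>, the window predicts correctly.\<close>

lemma visits_misses_le:
  assumes k: "k \<ge> 1" and \<omega>: "\<omega> \<in> space P" and m: "m \<ge> 1"
  shows "coding.visits (misses k 0 n) (\<lambda>i. X i \<omega>) \<le>
    word_length (K 1 \<omega>) * indicator {n<..} (total_length m \<omega>) +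
    word_length (K 1 \<omega>) * (\<Prod>i\<in>{2..int m}. indicator (- {k}) (K i \<omega>))"
proof (cases "total_length m \<omega> \<le> real n \<and> (\<exists>i\<in>{2..int m}. K i \<omega> = k)")
  case True
  then obtain i where i: "2 \<le> i" "i \<le> int m" "K i \<omega> = k" and total: "total_length m \<omega> \<le> real n" by auto
  interpret bit_sequence "\<lambda>i. K i \<omega>" "\<lambda>k. Z k \<omega>" by (rule bit_sequence_X[OF \<omega>])
  have len: "bs 2 = 1 + int (length (code (X 1 \<omega>)))"
    using block_start_step[of code "\<lambda>i. X i \<omega>" 1] by (simp add: block_start_1)
  have lo: "bs 2 \<le> bs i" by (rule block_start_mono[of code "\<lambda>i. X i \<omega>", OF code_nonempty i(1)])
  have "bs (i + 1) \<le> bs (int m + 1)" using i(2) by (intro block_start_mono[of code "\<lambda>i. X i \<omega>", OF code_nonempty]) simp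
  moreover have "bs (int m + 1) \<le> 1 + int n" using block_start_total_length[of \<omega> m] total by linarith
  ultimately have hi: "bs (i + 1) - 1 \<le> int n" by linarith
  have "(shift ^^ j) (Y \<omega>) \<notin> misses k 0 n" if j: "j < length (code (X 1 \<omega>))" for j
  proof -
    have "predictor_str k (block (Y \<omega>) (int j + 1) (int n + int j)) = Z k \<omega>"
      by (rule predictor_str_eq[OF k i(3)]) (use lo hi len j in linarith)+
    moreover have "predictor_seq k (Y \<omega>) = Z k \<omega>"
      using predictor_seq_eq[OF k] i(3) by auto
    ultimately show ?thesis
      by (simp add: misses_def block_shift_pow predictor_seq_shift_pow add_ac)
  qed
  then have "coding.visits (misses k 0 n) (\<lambda>i. X i \<omega>) = 0"
    unfolding coding.visits_def by (intro sum.neutral) auto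
  moreover have "0 \<le> word_length (K 1 \<omega>) * indicator {n<..} (total_length m \<omega>)"
    "0 \<le> word_length (K 1 \<omega>) * (\<Prod>i\<in>{2..int m}. indicator (- {k}) (K i \<omega>))"
    using word_length_ge[of "K 1 \<omega>"] by (auto intro!: mult_nonneg_nonneg prod_nonneg)
  ultimately show ?thesis by linarith
next
  case False
  have "coding.visits (misses k 0 n) (\<lambda>i. X i \<omega>) \<le> word_length (K 1 \<omega>)"
    using coding.visits_le[of "misses k 0 n" "\<lambda>i. X i \<omega>"] by (simp add: length_code)
  also have "\<dots> \<le> word_length (K 1 \<omega>) * indicator {n<..} (total_length m \<omega>) +
    word_length (K 1 \<omega>) * (\<Prod>i\<in>{2..int m}. indicator (- {k}) (K i \<omega>))"
  proof (cases "total_length m \<omega> \<le> real n")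
    case True
    then have "(\<Prod>i\<in>{2..int m}. indicator (- {k}) (K i \<omega>)) = (1 :: real)"
      using False by (intro prod.neutral) auto
    then show ?thesis using word_length_ge[of "K 1 \<omega>"] by simp
  next
    case False
    then show ?thesis using word_length_ge[of "K 1 \<omega>"] by (simp add: prod_nonneg)
  qed
  finally show ?thesis .
qed

text \<open>The summands come from the two terms into which the product is split for
  \<open>expectation_long_total\<close>.\<close>

definition tail_const :: real where
  "tail_const = measure_pmf.expectation \<kappa> (\<lambda>k. (word_length k)\<^sup>2) + var_length / mean_length\<^sup>2"

lemma mean_length_ge_1: "1 \<le> mean_length"
  using coding.L_ge_1 by (simp add: coding_L)

lemma integrable_long_total:
  "integrable P (\<lambda>\<omega>. word_length (K 1 \<omega>) * indicator {n<..} (total_length m \<omega>))"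
  by (rule Bochner_Integration.integrable_bound[OF integrable_word_length[of 1]])
     (use word_length_ge in \<open>auto simp: indicator_def\<close>)

text \<open>The indicator is bounded as in Chebyshev's inequality. The length of block 1 is not independent of
  the total length, so the product is split by \<open>l \<le> l\<^sup>2 / t + t\<close> with \<open>t = sqrt m\<close>.\<close>

lemma expectation_long_total:
  assumes m: "m \<ge> 1" and n: "2 * real m * mean_length \<le> n"
  shows "expectation (\<lambda>\<omega>. word_length (K 1 \<omega>) * indicator {n<..} (total_length m \<omega>)) \<le> tail_const / sqrt (real m)"
proof -
  define t where "t = sqrt (real m)"
  define c where "c = real m * mean_length"
  have t: "t > 0" "real m = t * t" using m by (auto simp: t_def)
  have c: "c > 0" using m mean_length_ge_1 by (simp add: c_def)
  let ?D = "\<lambda>\<omega>. (total_length m \<omega> - real m * mean_length)\<^sup>2"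
  let ?R = "\<lambda>\<omega>. (word_length (K 1 \<omega>))\<^sup>2 / t + t * (?D \<omega> / c\<^sup>2)"
  have le: "word_length (K 1 \<omega>) * indicator {n<..} (total_length m \<omega>) \<le> ?R \<omega>" for \<omega>
  proof (cases "total_length m \<omega> > n")
    case True
    let ?l = "word_length (K 1 \<omega>)"
    have "2 * c \<le> n" using n by (simp add: c_def)
    then have "c \<le> total_length m \<omega> - c" using True by linarith
    then have "c\<^sup>2 \<le> ?D \<omega>" using c unfolding c_def[symmetric] by (intro power_mono) auto
    then have "1 \<le> ?D \<omega> / c\<^sup>2" using c by simp
    then have "t * 1 \<le> t * (?D \<omega> / c\<^sup>2)" using t by (intro mult_left_mono) auto
    moreover have "?l \<le> ?l\<^sup>2 / t + t"
    proof -
      have "0 \<le> (?l - t)\<^sup>2" "0 \<le> ?l * t" using t word_length_ge[of "K 1 \<omega>"] by auto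
      then have "?l * t \<le> ?l\<^sup>2 + t * t" by (simp add: power2_eq_square algebra_simps)
      then show ?thesis using t by (simp add: field_simps)
    qed
    ultimately show ?thesis using True by simp
  next
    case False
    then show ?thesis using t by simp
  qed
  have int: "integrable P ?R"
    using integrable_word_length_square[of 1] expectation_total_length_dev(1)[of m] by auto
  have "expectation (\<lambda>\<omega>. word_length (K 1 \<omega>) * indicator {n<..} (total_length m \<omega>)) \<le> expectation ?R"
    by (rule integral_mono[OF integrable_long_total int le])
  also have "\<dots> = expectation (\<lambda>\<omega>. (word_length (K 1 \<omega>))\<^sup>2) / t + t * (real m * var_length / c\<^sup>2)"
    using integrable_word_length_square[of 1] expectation_total_length_dev[of m] by simp
  also have "expectation (\<lambda>\<omega>. (word_length (K 1 \<omega>))\<^sup>2) = measure_pmf.expectation \<kappa> (\<lambda>k. (word_length k)\<^sup>2)"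
    by (rule expectation_K)
  also have "t * (real m * var_length / c\<^sup>2) = var_length / mean_length\<^sup>2 / t"
    using t c unfolding c_def t(2) by (simp add: power2_eq_square field_simps)
  finally show ?thesis by (simp add: tail_const_def t_def add_divide_distrib)
qed

lemma expectation_length_unless:
  assumes m: "m \<ge> 1"
  shows "expectation (\<lambda>\<omega>. word_length (K 1 \<omega>) * (\<Prod>i\<in>{2..int m}. indicator (- {k}) (K i \<omega>))) =
      mean_length * (1 - pmf \<kappa> k) ^ (m - 1)" (is "expectation ?f = _")
    and "integrable P (\<lambda>\<omega>. word_length (K 1 \<omega>) * (\<Prod>i\<in>{2..int m}. indicator (- {k}) (K i \<omega>)))"
proof -
  define g where "g i = (if i = 1 then word_length else indicator (- {k}))" for i :: int
  have eq: "?f = (\<lambda>\<omega>. \<Prod>i\<in>insert 1 {2..int m}. g i (K i \<omega>))"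
    by (auto simp: g_def intro!: prod.cong)
  have g: "integrable P (\<lambda>\<omega>. g i (K i \<omega>))" for i
    by (cases "i = 1") (auto simp: g_def integrable_word_length integrable_indicator_K)
  show "integrable P ?f" unfolding eq by (rule expectation_prod_K(2)[OF _ g]) simp
  have "expectation ?f = (\<Prod>i\<in>insert 1 {2..int m}. expectation (\<lambda>\<omega>. g i (K i \<omega>)))"
    unfolding eq by (rule expectation_prod_K(1)[OF _ g]) simp
  also have "\<dots> = mean_length * (\<Prod>i\<in>{2..int m}. expectation (\<lambda>\<omega>. g i (K i \<omega>)))"
    by (simp add: g_def expectation_word_length)
  also have "(\<Prod>i\<in>{2..int m}. expectation (\<lambda>\<omega>. g i (K i \<omega>))) = (\<Prod>i\<in>{2..int m}. 1 - pmf \<kappa> k)"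
    by (rule prod.cong) (auto simp: g_def expectation_K_neq)
  also have "\<dots> = (1 - pmf \<kappa> k) ^ (m - 1)"
  proof -
    have "nat (int m - 1) = m - 1" using m by linarith
    then show ?thesis by simp
  qed
  finally show "expectation ?f = mean_length * (1 - pmf \<kappa> k) ^ (m - 1)" .
qed

lemma measure_misses_le:
  assumes k: "k \<ge> 1" and m: "m \<ge> 1" and n: "2 * real m * mean_length \<le> real n"
  shows "measure \<rho> (misses k 0 n) \<le> tail_const / sqrt (real m) + (1 - pmf \<kappa> k) ^ (m - 1)"
proof -
  let ?f = "\<lambda>\<omega>. word_length (K 1 \<omega>) * indicator {n<..} (total_length m \<omega>)"
  let ?g = "\<lambda>\<omega>. word_length (K 1 \<omega>) * (\<Prod>i\<in>{2..int m}. indicator (- {k}) (K i \<omega>))"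
  have meas: "coding.visits (misses k 0 n) \<in> borel_measurable (seq_space alphabet)"
    using coding.visits_M[OF misses_sets] by (simp add: measurable_cong_sets[OF coding.sets_M refl])
  have "measure \<rho> (misses k 0 n) * mean_length = (\<integral>x. coding.visits (misses k 0 n) x \<partial>\<mu>)"
    unfolding \<rho>_def coding.measure_mean_law[OF misses_sets] coding_L using mean_length_ge_1 by simp
  also have "\<dots> = expectation (\<lambda>\<omega>. coding.visits (misses k 0 n) (\<lambda>i. X i \<omega>))"
    by (rule integral_\<mu>[OF meas])
  also have "\<dots> \<le> expectation (\<lambda>\<omega>. ?f \<omega> + ?g \<omega>)"
  proof (rule integral_mono)
    show "integrable P (\<lambda>\<omega>. coding.visits (misses k 0 n) (\<lambda>i. X i \<omega>))"
      using coding.integrable_visits[OF misses_sets, of k 0 n]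
        integrable_distr_eq[OF X_measurable meas, folded \<mu>_def] by blast
    show "integrable P (\<lambda>\<omega>. ?f \<omega> + ?g \<omega>)"
      by (intro Bochner_Integration.integrable_add integrable_long_total expectation_length_unless(2)[OF m])
  qed (rule visits_misses_le[OF k _ m])
  also have "\<dots> = expectation ?f + expectation ?g"
    by (intro Bochner_Integration.integral_add integrable_long_total expectation_length_unless(2)[OF m])
  also have "\<dots> \<le> tail_const / sqrt (real m) + mean_length * (1 - pmf \<kappa> k) ^ (m - 1)"
    using expectation_long_total[OF m n] expectation_length_unless(1)[OF m, of k] by linarith
  also have "\<dots> \<le> tail_const / sqrt (real m) * mean_length + mean_length * (1 - pmf \<kappa> k) ^ (m - 1)"
  proof -
    have "0 \<le> tail_const"
      unfolding tail_const_def using var_length_nonneg by (intro add_nonneg_nonneg integral_nonneg_AE) auto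
    then have "tail_const / sqrt (real m) * 1 \<le> tail_const / sqrt (real m) * mean_length"
      using mean_length_ge_1 by (intro mult_left_mono) auto
    then show ?thesis by simp
  qed
  also have "\<dots> = (tail_const / sqrt (real m) + (1 - pmf \<kappa> k) ^ (m - 1)) * mean_length"
    by (simp add: algebra_simps)
  finally show ?thesis using mean_length_ge_1 by (simp add: mult_le_cancel_right)
qed

text \<open>Half the number of blocks that are expected in \<open>n\<close> letters, so that with high probability all of them
  fit.\<close>

definition window :: "nat \<Rightarrow> nat" where "window n = nat \<lfloor>real n / (2 * mean_length)\<rfloor>"

lemma window_bounds:
  "2 * real (window n) * mean_length \<le> real n" "real n \<le> 2 * mean_length * (real (window n) + 1)"
proof -
  have L: "mean_length > 0" using mean_length_ge_1 by simp
  have "real (window n) \<le> real n / (2 * mean_length)"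
    unfolding window_def using L by (intro of_nat_floor) simp
  then show "2 * real (window n) * mean_length \<le> real n" using L by (simp add: field_simps)
  have "real n / (2 * mean_length) \<le> real (window n) + 1" unfolding window_def by linarith
  then show "real n \<le> 2 * mean_length * (real (window n) + 1)" using L by (simp add: field_simps)
qed

lemma window_at_top: "filterlim window at_top sequentially"
  unfolding filterlim_at_top
proof
  fix m
  show "\<forall>\<^sub>F n in sequentially. m \<le> window n"
    using eventually_ge_at_top[of "nat \<lceil>2 * mean_length * (real m + 1)\<rceil>"]
  proof eventually_elim
    case (elim n)
    then have "2 * mean_length * (real m + 1) \<le> real n" by linarith
    also have "\<dots> \<le> 2 * mean_length * (real (window n) + 1)" by (rule window_bounds)
    finally show ?case using mean_length_ge_1 by simp
  qed
qed

lemma tail_const_tendsto: "(\<lambda>n. tail_const / sqrt (real (window n))) \<longlonglongrightarrow> 0"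
  by (intro real_tendsto_divide_at_top[OF tendsto_const] filterlim_compose[OF sqrt_at_top]
      filterlim_compose[OF filterlim_real_sequentially] window_at_top)

lemma measure_misses_tendsto:
  assumes k: "k \<ge> 1"
  shows "(\<lambda>n. measure \<rho> (misses k i n)) \<longlonglongrightarrow> 0"
proof (rule Lim_null_comparison)
  show "\<forall>\<^sub>F n in sequentially. norm (measure \<rho> (misses k i n)) \<le>
      tail_const / sqrt (real (window n)) + (1 - pmf \<kappa> k) ^ (window n - 1)"
    using filterlim_at_top[THEN iffD1, OF window_at_top, rule_format, of 1]
  proof eventually_elim
    case (elim n)
    then show ?case
      unfolding measure_misses_shift[of k i] real_norm_def abs_of_nonneg[OF measure_nonneg]
      by (rule measure_misses_le[OF k _ window_bounds(1)])
  qed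
  have "(\<lambda>m. (1 - pmf \<kappa> k) ^ m) \<longlonglongrightarrow> 0"
    using pmf_\<kappa>_pos[OF k] pmf_le_1[of \<kappa> k] by (intro LIMSEQ_realpow_zero) auto
  moreover have "filterlim (\<lambda>n. window n - 1) at_top sequentially"
    by (rule filterlim_compose[OF filterlim_minus_const_nat_at_top window_at_top])
  ultimately have "(\<lambda>n. (1 - pmf \<kappa> k) ^ (window n - 1)) \<longlonglongrightarrow> 0" by (rule filterlim_compose)
  then show "(\<lambda>n. tail_const / sqrt (real (window n)) + (1 - pmf \<kappa> k) ^ (window n - 1)) \<longlonglongrightarrow> 0"
    using tendsto_add[OF tail_const_tendsto] by fastforce
qed

text \<open>The probability that \<open>k\<close> is missed by \<open>window n - 1\<close> independent indices is at most \<open>exp (- p * (window n - 1))\<close>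
  with \<open>p\<close> the mass of \<open>k\<close>. For large \<open>n\<close> the exponent is at most \<open>- p * n / (4 * mean_length)\<close>, and \<open>c\<close> is chosen so that
  this is at most \<open>ln \<epsilon>\<close> in the whole range of \<open>k\<close>.\<close>

lemma eventually_misses_le:
  assumes \<epsilon>: "0 < \<epsilon>" "\<epsilon> < 1"
  obtains c where "c > 0"
    "\<forall>\<^sub>F n in sequentially. \<forall>k. 1 \<le> k \<and> real k \<le> c * real n powr inverse \<alpha> \<longrightarrow> measure \<rho> (misses k 0 n) \<le> 2 * \<epsilon>"
proof -
  define a where "a = - ln \<epsilon>"
  define d where "d = 4 * mean_length * zeta_sum \<alpha> * a"
  define c where "c = (1 / d) powr inverse \<alpha>"
  have a: "a > 0" using \<epsilon> by (simp add: a_def)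
  have d: "d > 0" using a mean_length_ge_1 zeta_pos by (simp add: d_def)
  then have c: "c > 0" by (simp add: c_def)
  have ev1: "\<forall>\<^sub>F n in sequentially. tail_const / sqrt (real (window n)) < \<epsilon>"
    by (rule order_tendstoD(2)[OF tail_const_tendsto \<epsilon>(1)])
  have ev2: "\<forall>\<^sub>F n in sequentially. 3 \<le> window n"
    using window_at_top unfolding filterlim_at_top by blast
  have "\<forall>\<^sub>F n in sequentially. \<forall>k. 1 \<le> k \<and> real k \<le> c * real n powr inverse \<alpha> \<longrightarrow> measure \<rho> (misses k 0 n) \<le> 2 * \<epsilon>"
    using ev1 ev2 eventually_gt_at_top[of 0]
  proof eventually_elim
    case (elim n)
    show ?case
    proof (intro allI impI)
      fix k :: nat assume k: "1 \<le> k \<and> real k \<le> c * real n powr inverse \<alpha>"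
      let ?p = "pmf \<kappa> k"
      have "c * real n powr inverse \<alpha> = (real n / d) powr inverse \<alpha>"
        unfolding c_def using d by (simp add: powr_mult[symmetric])
      then have "real k powr \<alpha> \<le> ((real n / d) powr inverse \<alpha>) powr \<alpha>"
        using k \<alpha> by (intro powr_mono2) auto
      also have "\<dots> = real n / d" using \<alpha> d elim by (simp add: powr_powr)
      finally have "real k powr \<alpha> * d \<le> real n" using d by (simp add: field_simps)
      then have "4 * mean_length * a * (real k powr \<alpha> * zeta_sum \<alpha>) \<le> real n"
        by (simp add: d_def mult_ac)
      moreover have "0 < real k powr \<alpha> * zeta_sum \<alpha>" using k zeta_pos by simp
      ultimately have "4 * mean_length * a \<le> real n / (real k powr \<alpha> * zeta_sum \<alpha>)"
        by (subst pos_le_divide_eq) auto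
      moreover have "?p = 1 / (real k powr \<alpha> * zeta_sum \<alpha>)" by (simp add: pmf_\<kappa> powr_minus field_simps)
      ultimately have p: "4 * mean_length * a \<le> ?p * real n" by simp
      have "real n \<le> 2 * mean_length * (real (window n) + 1)" by (rule window_bounds)
      also have "\<dots> \<le> 2 * mean_length * (2 * real (window n - 1))"
        using elim(2) mean_length_ge_1 by (intro mult_left_mono) (auto simp: of_nat_diff)
      finally have "?p * real n \<le> ?p * (4 * mean_length * real (window n - 1))"
        by (intro mult_left_mono) auto
      with p have "4 * mean_length * a \<le> 4 * mean_length * (?p * real (window n - 1))"
        by (simp add: mult_ac)
      then have pa: "a \<le> ?p * real (window n - 1)" using mean_length_ge_1 by simp
      have "(1 - ?p) ^ (window n - 1) \<le> exp (- ?p) ^ (window n - 1)"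
        using exp_ge_add_one_self[of "- ?p"] pmf_le_1[of \<kappa> k] by (intro power_mono) auto
      also have "\<dots> = exp (- (?p * real (window n - 1)))" by (simp add: exp_of_nat_mult[symmetric] mult_ac)
      also have "\<dots> \<le> exp (- a)" using pa by simp
      also have "\<dots> = \<epsilon>" using \<epsilon> by (simp add: a_def)
      finally have "(1 - ?p) ^ (window n - 1) \<le> \<epsilon>" .
      moreover have "measure \<rho> (misses k 0 n) \<le> tail_const / sqrt (real (window n)) + (1 - ?p) ^ (window n - 1)"
        by (rule measure_misses_le) (use k elim(2) window_bounds(1) in auto)
      ultimately show "measure \<rho> (misses k 0 n) \<le> 2 * \<epsilon>" using elim(1) by linarith
    qed
  qed
  with c that show ?thesis by blast
qed

end

section \<open>Processes with the stationary mean as their law\<close>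

context hidden_bits
begin

context
  fixes Q :: "'v measure" and U :: "int \<Rightarrow> 'v \<Rightarrow> nat"
  assumes process: "process Q {0, 1, 2} U" and law: "process_law Q {0, 1, 2} U = \<rho>"
begin

abbreviation path :: "'v \<Rightarrow> int \<Rightarrow> nat" where "path \<omega> \<equiv> \<lambda>i. U i \<omega>"

lemma prob_Q: "prob_space Q"
  using process by (simp add: process_def)

lemma path_measurable: "path \<in> measurable Q (seq_space {0, 1, 2})"
  using process unfolding process_def by (intro measurable_seq_spaceI) blast

lemma path_space: "\<omega> \<in> space Q \<Longrightarrow> path \<omega> \<in> space (seq_space {0, 1, 2})"
  using measurable_space[OF path_measurable] .

lemma measure_path:
  assumes "B \<in> sets (seq_space {0, 1, 2})"
  shows "measure Q {\<omega> \<in> space Q. path \<omega> \<in> B} = measure \<rho> B"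
proof -
  have "measure \<rho> B = measure Q (path -` B \<inter> space Q)"
    unfolding law[symmetric] process_law_def by (rule measure_distr[OF path_measurable assms])
  also have "path -` B \<inter> space Q = {\<omega> \<in> space Q. path \<omega> \<in> B}" by auto
  finally show ?thesis by simp
qed

abbreviation bit :: "nat \<Rightarrow> 'v \<Rightarrow> nat" where "bit k \<omega> \<equiv> predictor_seq k (path \<omega>)"

lemma bit_measurable: "bit k \<in> measurable Q (count_space UNIV)"
  by (rule measurable_compose[OF path_measurable measurable_predictor_seq])

lemma measure_bits:
  assumes J: "finite J" "J \<subseteq> {1..}"
  shows "measure Q {\<omega> \<in> space Q. \<forall>j\<in>J. bit j \<omega> \<in> B j} = prob {\<omega> \<in> space P. \<forall>j\<in>J. Z j \<omega> \<in> B j}"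
proof -
  have "measure Q {\<omega> \<in> space Q. \<forall>j\<in>J. bit j \<omega> \<in> B j} =
    measure Q {\<omega> \<in> space Q. path \<omega> \<in> {y \<in> space (seq_space {0, 1, 2}). \<forall>j\<in>J. predictor_seq j y \<in> B j}}"
    using path_space by (intro arg_cong[where f = "measure Q"]) auto
  also have "\<dots> = measure \<rho> {y \<in> space (seq_space {0, 1, 2}). \<forall>j\<in>J. predictor_seq j y \<in> B j}"
    by (rule measure_path)
       (use predictor_set_invariant[OF J(1)] in \<open>simp add: shift_invariant_sets_def\<close>)
  also have "\<dots> = prob {\<omega> \<in> space P. \<forall>j\<in>J. Z j \<omega> \<in> B j}" by (rule measure_\<rho>_predictor[OF J])
  finally show ?thesis .
qed

lemma measure_bit: "k \<ge> 1 \<Longrightarrow> measure Q {\<omega> \<in> space Q. bit k \<omega> \<in> B} = prob {\<omega> \<in> space P. Z k \<omega> \<in> B}"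
  using measure_bits[of "{k}" "\<lambda>_. B"] by simp

lemma indep_bits: "prob_space.indep_vars Q (\<lambda>_. count_space UNIV) bit {1..}"
proof -
  interpret Q: prob_space Q by (rule prob_Q)
  show ?thesis
    unfolding Q.indep_vars_def2
  proof (intro conjI ballI)
    show "Q.indep_sets (\<lambda>k. {bit k -` A \<inter> space Q |A. A \<in> sets (count_space UNIV)}) {1..}"
    proof (rule Q.indep_setsI)
      fix k show "{bit k -` A \<inter> space Q |A. A \<in> sets (count_space UNIV)} \<subseteq> Q.events"
        using measurable_sets[OF bit_measurable] by auto
    next
      fix A :: "nat \<Rightarrow> 'v set" and J :: "nat set"
      assume J: "J \<noteq> {}" "J \<subseteq> {1..}" "finite J"
        and A: "\<forall>j\<in>J. A j \<in> {bit j -` A \<inter> space Q |A. A \<in> sets (count_space UNIV)}"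
      from A have "\<exists>B. \<forall>j\<in>J. A j = bit j -` B j \<inter> space Q" by (intro bchoice) auto
      then obtain B where B: "\<And>j. j \<in> J \<Longrightarrow> A j = bit j -` B j \<inter> space Q" by blast
      have "\<Inter> (A ` J) = {\<omega> \<in> space Q. \<forall>j\<in>J. bit j \<omega> \<in> B j}" using J(1) B by auto
      then have "Q.prob (\<Inter> (A ` J)) = (\<Prod>j\<in>J. prob {\<omega> \<in> space P. Z j \<omega> \<in> B j})"
        using measure_bits[OF J(3,2), of B] prob_Z_prod[OF J(3,2), of B] by simp
      also have "\<dots> = (\<Prod>j\<in>J. Q.prob (A j))"
      proof (rule prod.cong[OF refl])
        fix j assume j: "j \<in> J"
        have "A j = {\<omega> \<in> space Q. bit j \<omega> \<in> B j}" using B[OF j] by auto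
        then show "prob {\<omega> \<in> space P. Z j \<omega> \<in> B j} = Q.prob (A j)"
          using measure_bit[of j "B j"] j J(2) by auto
      qed
      finally show "Q.prob (\<Inter> (A ` J)) = (\<Prod>j\<in>J. Q.prob (A j))" .
    qed
  qed (rule bit_measurable)
qed

text \<open>The predictor takes the value 2 on a null set only; there it is replaced by 0.\<close>

lemma bit_invariant_measurable:
  assumes k: "k \<ge> 1"
  shows "\<exists>Z' \<in> measurable (shift_invariant_field Q {0, 1, 2} U) (count_space {0, 1}). AE \<omega> in Q. bit k \<omega> = Z' \<omega>"
proof (intro bexI)
  interpret Q: prob_space Q by (rule prob_Q)
  let ?T = "sigma (space (seq_space {0, 1, 2})) (shift_invariant_sets {0, 1, 2})"
  let ?one = "{y \<in> space (seq_space {0, 1, 2}). predictor_seq k y = 1}"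
  let ?h = "\<lambda>y. if predictor_seq k y = 1 then 1 else 0 :: nat"
  have sub: "shift_invariant_sets {0, 1, 2 :: nat} \<subseteq> Pow (space (seq_space {0, 1, 2}))"
    using sets.sets_into_space by (auto simp: shift_invariant_sets_def)
  have one: "?one \<in> sets ?T"
    using predictor_set_invariant[of "{k}" "\<lambda>_. {1}"] sub by (auto intro!: sigma_sets.Basic)
  have "space ?T = space (seq_space {0, 1, 2 :: nat})" using sub by (rule space_measure_of)
  then have "{y \<in> space ?T. predictor_seq k y = 1} = ?one" by (simp only:)
  then have h: "?h \<in> measurable ?T (count_space {0, 1})"
    using one by (intro measurable_If) (simp_all only: measurable_const space_count_space insert_iff simp_thms)
  have "path \<in> measurable (shift_invariant_field Q {0, 1, 2} U) ?T"
    unfolding shift_invariant_field_def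
    by (rule measurable_vimage_algebra1) (use path_space sub in \<open>auto simp: space_measure_of\<close>)
  from measurable_compose[OF this h]
  show "(\<lambda>\<omega>. ?h (path \<omega>)) \<in> measurable (shift_invariant_field Q {0, 1, 2} U) (count_space {0, 1})" .
  have "{\<omega> \<in> space P. Z k \<omega> \<in> {0, 1}} = space P" using Z_in[OF _ k] by auto
  then have "Q.prob {\<omega> \<in> space Q. bit k \<omega> \<in> {0, 1}} = 1"
    using measure_bit[OF k, of "{0, 1}"] prob_space by simp
  moreover have "{\<omega> \<in> space Q. bit k \<omega> \<in> {0, 1}} \<in> Q.events"
    using measurable_sets[OF bit_measurable[of k], of "{0, 1}"] by (simp add: vimage_def Int_def conj_commute)
  ultimately have "AE \<omega> in Q. \<omega> \<in> {\<omega> \<in> space Q. bit k \<omega> \<in> {0, 1}}"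
    by (subst Q.prob_eq_1[symmetric])
  then show "AE \<omega> in Q. bit k \<omega> = ?h (path \<omega>)" by eventually_elim auto
qed

lemma measure_prediction:
  "measure Q {\<omega> \<in> space Q. predictor_str k (block (path \<omega>) (i + 1) (i + int n)) = bit k \<omega>} =
    1 - measure \<rho> (misses k i n)"
proof -
  interpret Q: prob_space Q by (rule prob_Q)
  have ev: "{\<omega> \<in> space Q. path \<omega> \<in> misses k i n} \<in> Q.events"
    using measurable_sets[OF path_measurable misses_sets[of k i n]]
    by (simp add: vimage_def Int_def conj_commute)
  have "{\<omega> \<in> space Q. predictor_str k (block (path \<omega>) (i + 1) (i + int n)) = bit k \<omega>} =
    space Q - {\<omega> \<in> space Q. path \<omega> \<in> misses k i n}"
    using path_space by (auto simp: misses_def)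
  then show ?thesis using Q.prob_compl[OF ev] measure_path[OF misses_sets] by simp
qed

text \<open>For large \<open>n\<close> the set contains all \<open>k\<close> up to \<open>c * n powr inverse \<alpha>\<close>. Rounding down loses at most 1, which after
  normalisation is below \<open>c / 2\<close>.\<close>

lemma card_predictable_set:
  assumes \<delta>: "\<delta> \<in> {1 / 2<..<1}"
  shows "liminf (\<lambda>n. ennreal (real n powr (- inverse \<alpha>)) *
      emeasure (count_space UNIV) (predictable_set Q U bit predictor_str \<delta> n)) > 0"
proof -
  \<comment> \<open>A failure probability of at most \<open>2 * \<epsilon>\<close> means success with probability at least \<open>\<delta>\<close>.\<close>
  define \<epsilon> where "\<epsilon> = (1 - \<delta>) / 2"
  have \<epsilon>: "0 < \<epsilon>" "\<epsilon> < 1" using \<delta> by (auto simp: \<epsilon>_def)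
  obtain c where c: "c > 0" and ev: "\<forall>\<^sub>F n in sequentially. \<forall>k. 1 \<le> k \<and> real k \<le> c * real n powr inverse \<alpha> \<longrightarrow>
      measure \<rho> (misses k 0 n) \<le> 2 * \<epsilon>"
    using eventually_misses_le[OF \<epsilon>] .
  have "(\<lambda>n. real n powr (- inverse \<alpha>)) \<longlonglongrightarrow> 0"
    using \<alpha> by (intro tendsto_neg_powr filterlim_real_sequentially) simp
  then have small: "\<forall>\<^sub>F n in sequentially. real n powr (- inverse \<alpha>) < c / 2"
    using c by (intro order_tendstoD(2)[of _ 0]) auto
  have "\<forall>\<^sub>F n in sequentially. ennreal (c / 2) \<le> ennreal (real n powr (- inverse \<alpha>)) *
      emeasure (count_space UNIV) (predictable_set Q U bit predictor_str \<delta> n)"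
    using ev small eventually_gt_at_top[of 0]
  proof eventually_elim
    case (elim n)
    define r where "r = real n powr inverse \<alpha>"
    define M where "M = nat \<lfloor>c * r\<rfloor>"
    have r: "r > 0" "real n powr (- inverse \<alpha>) = 1 / r"
      using elim(3) by (simp_all add: r_def powr_minus field_simps)
    have "{1..M} \<subseteq> predictable_set Q U bit predictor_str \<delta> n"
    proof
      fix k assume k: "k \<in> {1..M}"
      have "real M \<le> c * r" unfolding M_def using c r by (intro of_nat_floor) simp
      then have "real k \<le> c * r" using k by (simp add: order.trans[of "real k" "real M"])
      then have "measure \<rho> (misses k 0 n) \<le> 2 * \<epsilon>" using elim(1) k unfolding r_def by auto
      then show "k \<in> predictable_set Q U bit predictor_str \<delta> n"
        using k measure_prediction[of k 0 n] unfolding predictable_set_def \<epsilon>_def by simp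
    qed
    then have "emeasure (count_space UNIV) {1..M} \<le> emeasure (count_space UNIV) (predictable_set Q U bit predictor_str \<delta> n)"
      by (intro emeasure_mono) auto
    then have "ennreal (real M) \<le> emeasure (count_space UNIV) (predictable_set Q U bit predictor_str \<delta> n)"
      by (simp add: ennreal_of_nat_eq_real_of_nat)
    moreover have "c * r - 1 \<le> real M" unfolding M_def by linarith
    ultimately have "ennreal (c * r - 1) \<le> emeasure (count_space UNIV) (predictable_set Q U bit predictor_str \<delta> n)"
      using ennreal_leI order.trans by blast
    then have "ennreal (1 / r) * ennreal (c * r - 1) \<le>
       ennreal (1 / r) * emeasure (count_space UNIV) (predictable_set Q U bit predictor_str \<delta> n)"
      by (rule mult_left_mono) simp
    moreover have "ennreal (c / 2) \<le> ennreal (1 / r) * ennreal (c * r - 1)"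
    proof -
      have "1 / r < c / 2" using elim(2) r(2) by simp
      then have "c / 2 \<le> 1 / r * (c * r - 1)" using r(1) by (simp add: field_simps)
      then show ?thesis using r by (simp add: ennreal_leI flip: ennreal_mult')
    qed
    ultimately show ?case unfolding r(2) by (rule order.trans[rotated])
  qed
  then have "ennreal (c / 2) \<le> liminf (\<lambda>n. ennreal (real n powr (- inverse \<alpha>)) *
      emeasure (count_space UNIV) (predictable_set Q U bit predictor_str \<delta> n))"
    by (rule Liminf_bounded)
  moreover have "0 < ennreal (c / 2)" using c by simp
  ultimately show ?thesis by (rule order.strict_trans2[rotated])
qed

lemma encodes_bits_predictor: "encodes_bits (inverse \<alpha>) Q {0, 1, 2} U bit predictor_str"
  unfolding encodes_bits_def
proof (intro conjI allI ballI impI)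
  show "prob_space.indep_vars Q (\<lambda>_. count_space UNIV) bit {1..}" by (rule indep_bits)
  fix k :: nat assume k: "k \<ge> 1"
  show "\<P>(\<omega> in Q. bit k \<omega> = z) = 1 / 2" if "z \<in> {0, 1}" for z
    using measure_bit[OF k, of "{z}"] Z_dist[OF k that] by simp
  show "\<exists>Z' \<in> measurable (shift_invariant_field Q {0, 1, 2} U) (count_space {0, 1}). AE \<omega> in Q. bit k \<omega> = Z' \<omega>"
    by (rule bit_invariant_measurable[OF k])
  show "(\<lambda>n. \<P>(\<omega> in Q. predictor_str k (block (path \<omega>) (i + 1) (i + int n)) = bit k \<omega>)) \<longlonglongrightarrow> 1" for i
    unfolding measure_prediction using tendsto_diff[OF tendsto_const measure_misses_tendsto[OF k, of i], of 1] by simp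
qed (rule card_predictable_set)

end

end

theorem proposition1p4:
  fixes \<alpha> \<beta> :: real
    and P :: "'w measure"
    and K :: "int \<Rightarrow> 'w \<Rightarrow> nat"
    and Z :: "nat \<Rightarrow> 'w \<Rightarrow> nat"
    and X :: "int \<Rightarrow> 'w \<Rightarrow> nat \<times> nat"
    and \<mu> :: "(int \<Rightarrow> nat \<times> nat) measure"
    and \<nu> :: "(int \<Rightarrow> nat) measure"
  assumes alpha: "\<alpha> > 1" "zeta_sum \<alpha> > 4"
    and beta: "\<beta> = inverse \<alpha>"
    and P: "prob_space P"
    and indep: "prob_space.indep_vars P
          (case_sum (\<lambda>_. count_space {1..}) (\<lambda>_. count_space {0, 1}))
          (case_sum K Z) (UNIV <+> {1..})"
    and K: "\<And>i k. k \<ge> 1 \<Longrightarrow> \<P>(\<omega> in P. K i \<omega> = k) = real k powr (- \<alpha>) / zeta_sum \<alpha>"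
    and Z: "\<And>k z. k \<ge> 1 \<Longrightarrow> z \<in> {0, 1} \<Longrightarrow> \<P>(\<omega> in P. Z k \<omega> = z) = 1 / 2"
    and X: "X = (\<lambda>i \<omega>. (K i \<omega>, Z (K i \<omega>) \<omega>))"
    and mu: "\<mu> = process_law P ({1..} \<times> {0, 1}) X"
    and nu: "\<nu> = distr \<mu> (seq_space {0, 1, 2}) (concat_two_sided code)"
  shows "asymp_mean_stationary {0, 1, 2} \<nu> \<and>
    prob_space (stationary_mean \<nu>) \<and>
    (\<forall>(Q :: 'v measure) (Y :: int \<Rightarrow> 'v \<Rightarrow> nat).
       process Q {0, 1, 2} Y \<and> process_law Q {0, 1, 2} Y = stationary_mean \<nu> \<longrightarrow>
         (\<exists>A. finite A \<and> process Q A Y) \<and>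
         stationary (process_law Q {0, 1, 2} Y) \<and>
         finite_energy {0, 1, 2} (process_law Q {0, 1, 2} Y) \<and>
         (\<exists>Z' s. encodes_bits \<beta> Q {0, 1, 2} Y Z' s) \<and>
         encodes_bits \<beta> Q {0, 1, 2} Y (\<lambda>k \<omega>. predictor_seq k (\<lambda>i. Y i \<omega>)) predictor_str)"
proof -
  interpret hidden_bits \<alpha> P K Z
    by (rule hidden_bits.intro) (fact alpha(1) P indep K Z)+
  have \<nu>: "\<nu> = hidden_bits.\<nu> P K Z"
    unfolding nu mu X process_law_def \<nu>_def \<mu>_def ..
  show ?thesis
    unfolding \<nu> limit.stationary_mean beta
  proof (intro conjI allI impI)
    show "asymp_mean_stationary {0, 1, 2} (hidden_bits.\<nu> P K Z)" by (rule limit.asymp_mean_stationary)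
    show "prob_space \<rho>" by (rule limit.prob_R)
    fix Q :: "'v measure" and Y :: "int \<Rightarrow> 'v \<Rightarrow> nat"
    assume "process Q {0, 1, 2} Y \<and> process_law Q {0, 1, 2} Y = \<rho>"
    then have QY: "process Q {0, 1, 2} Y" "process_law Q {0, 1, 2} Y = \<rho>" by auto
    show "\<exists>A. finite A \<and> process Q A Y" using QY(1) by (intro exI[of _ "{0, 1, 2}"]) simp
    show "stationary (process_law Q {0, 1, 2} Y)" unfolding QY(2) by (rule limit.stationary)
    show "finite_energy {0, 1, 2} (process_law Q {0, 1, 2} Y)" unfolding QY(2) by (rule finite_energy_\<rho>)
    show bits: "encodes_bits (inverse \<alpha>) Q {0, 1, 2} Y (\<lambda>k \<omega>. predictor_seq k (\<lambda>i. Y i \<omega>)) predictor_str"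
      by (rule encodes_bits_predictor[OF QY])
    then show "\<exists>Z' s. encodes_bits (inverse \<alpha>) Q {0, 1, 2} Y Z' s" by blast
  qed
qed

end
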